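(* For every $p\in[0,1)$, $\widetilde\alpha(\mathbf W^p)=0$ almost surely.
   Context: Graphon: measurable symmetric $W:[0,1]^2\to[0,1]$. An independent set of $W$ is a measurable $I\subseteq[0,1]$ with $W(x,y)=0$ for a.e. $(x,y)\in I\times I$; $\widetilde\alpha(W)=\sup\mathrm{Leb}(I)$ over independent sets $I$ of $W$. Brownian cographon $\mathbf W^p$: let $\mathfrak e$ be a Brownian excursion of length one; a.s. its local minima are strict, with distinct values, countably many; enumerate their positions $(b_i)$ measurably and attach i.i.d. decorations $s_i\in\{0,1\}$ with $\mathbb P(s_i=0)=p$, independent of $\mathfrak e$. For $x,y\in[0,1]$, $\mathrm{Dec}(x,y)$ is the decoration of the local minimum at which $\mathfrak e$ attains its minimum on $[\min(x,y),\max(x,y)]$, set to $0$ if this minimum is not unique or attained at $x$ or $y$. Then $\mathbf W^p(x,y)=\mathrm{Dec}(x,y)$. *)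

theory Defs
  imports "HOL-Probability.Probability"
begin

text \<open>
  The functions W below are defined on all pairs of reals; only their values on the unit
  square matter.  The supremum is taken over a set of reals that contains 0 and is bounded by 1.
\<close>

definition independent_set :: "(real \<Rightarrow> real \<Rightarrow> real) \<Rightarrow> real set \<Rightarrow> bool" where
  "independent_set W I \<longleftrightarrow> I \<in> sets lebesgue \<and> I \<subseteq> {0..1} \<and>
     (AE (x, y) in lborel \<Otimes>\<^sub>M lborel. x \<in> I \<and> y \<in> I \<longrightarrow> W x y = 0)"

definition independence_number :: "(real \<Rightarrow> real \<Rightarrow> real) \<Rightarrow> real" where
  "independence_number W = Sup {measure lebesgue I |I. independent_set W I}"

text \<open>
  The law of the Brownian excursion of length one is given by its finite-dimensional
  densities on the positive orthant, for times 0 < t 0 < ... < t n < 1: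
  entrance density from 0, transition densities of Brownian motion killed at 0,
  and exit density to 0 at time 1, with normalising constant 2 sqrt (2 pi).
\<close>

definition killed_density :: "real \<Rightarrow> real \<Rightarrow> real \<Rightarrow> real" where
  "killed_density t x y = normal_density x (sqrt t) y - normal_density (- x) (sqrt t) y"

text \<open>The density at time t of the first hitting time of x by a standard Brownian motion.\<close>

definition hitting_density :: "real \<Rightarrow> real \<Rightarrow> real" where
  "hitting_density t x = x / t * normal_density 0 (sqrt t) x"

definition excursion_density :: "nat \<Rightarrow> (nat \<Rightarrow> real) \<Rightarrow> (nat \<Rightarrow> real) \<Rightarrow> real" where
  "excursion_density n t x =
     (if \<forall>i\<le>n. 0 < x i
      then 2 * sqrt (2 * pi) * hitting_density (t 0) (x 0)
           * (\<Prod>i<n. killed_density (t (Suc i) - t i) (x i) (x (Suc i)))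
           * hitting_density (1 - t n) (x n)
      else 0)"

definition brownian_excursion :: "'a measure \<Rightarrow> ('a \<Rightarrow> real \<Rightarrow> real) \<Rightarrow> bool" where
  "brownian_excursion M e \<longleftrightarrow> prob_space M \<and>
     (\<forall>t\<in>{0..1}. (\<lambda>\<omega>. e \<omega> t) \<in> borel_measurable M) \<and>
     (\<forall>\<omega>\<in>space M. continuous_on {0..1} (e \<omega>) \<and> e \<omega> 0 = 0 \<and> e \<omega> 1 = 0) \<and>
     (\<forall>n t. 0 < t 0 \<and> t n < 1 \<and> (\<forall>i<n. t i < t (Suc i)) \<longrightarrow>
        distributed M (Pi\<^sub>M {..n} (\<lambda>_. lborel)) (\<lambda>\<omega>. \<lambda>i\<in>{..n}. e \<omega> (t i))
          (\<lambda>x. ennreal (excursion_density n t x)))"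

text \<open>
  The endpoints 0 and 1, where an excursion attains its global minimum, are not counted
  as local minima.
\<close>

definition local_minima :: "(real \<Rightarrow> real) \<Rightarrow> real set" where
  "local_minima f = {t \<in> {0<..<1}. \<exists>\<delta>>0. \<forall>u\<in>{0..1}. \<bar>u - t\<bar> < \<delta> \<longrightarrow> f t \<le> f u}"

definition path_algebra :: "'a measure \<Rightarrow> ('a \<Rightarrow> real \<Rightarrow> real) \<Rightarrow> 'a measure" where
  "path_algebra M e =
     vimage_algebra (space M) (\<lambda>\<omega>. restrict (e \<omega>) {0..1}) (Pi\<^sub>M {0..1} (\<lambda>_. borel))"

definition sequence_algebra :: "'a measure \<Rightarrow> (nat \<Rightarrow> 'a \<Rightarrow> real) \<Rightarrow> 'a measure" where
  "sequence_algebra M s =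
     vimage_algebra (space M) (\<lambda>\<omega> i. s i \<omega>) (Pi\<^sub>M UNIV (\<lambda>_. borel))"

text \<open>
  The positions are measurable with respect to the sigma-algebra generated by e, so that the
  independence of the decorations from e is also independence from the enumeration.
\<close>

definition measurable_enumeration ::
    "'a measure \<Rightarrow> ('a \<Rightarrow> real \<Rightarrow> real) \<Rightarrow> (nat \<Rightarrow> 'a \<Rightarrow> real) \<Rightarrow> bool" where
  "measurable_enumeration M e b \<longleftrightarrow>
     (\<forall>i. b i \<in> borel_measurable (path_algebra M e)) \<and>
     (AE \<omega> in M. bij_betw (\<lambda>i. b i \<omega>) UNIV (local_minima (e \<omega>)))"

definition decorations ::
    "'a measure \<Rightarrow> ('a \<Rightarrow> real \<Rightarrow> real) \<Rightarrow> real \<Rightarrow> (nat \<Rightarrow> 'a \<Rightarrow> real) \<Rightarrow> bool" where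
  "decorations M e p s \<longleftrightarrow>
     (\<forall>i. \<forall>\<omega>\<in>space M. s i \<omega> \<in> {0, 1}) \<and>
     (\<forall>i. measure M {\<omega> \<in> space M. s i \<omega> = 0} = p) \<and>
     prob_space.indep_vars M (\<lambda>_. borel) s UNIV \<and>
     prob_space.indep_set M (sets (path_algebra M e)) (sets (sequence_algebra M s))"

definition argmins :: "(real \<Rightarrow> real) \<Rightarrow> real set \<Rightarrow> real set" where
  "argmins f A = {t. is_arg_min f (\<lambda>u. u \<in> A) t}"

definition Dec :: "(real \<Rightarrow> real) \<Rightarrow> (nat \<Rightarrow> real) \<Rightarrow> (nat \<Rightarrow> real) \<Rightarrow> real \<Rightarrow> real \<Rightarrow> real" where
  "Dec f b s x y =
     (let A = argmins f {min x y..max x y}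
      in if is_singleton A \<and> x \<notin> A \<and> y \<notin> A then s (THE i. b i = the_elem A) else 0)"

definition brownian_cographon ::
    "('a \<Rightarrow> real \<Rightarrow> real) \<Rightarrow> (nat \<Rightarrow> 'a \<Rightarrow> real) \<Rightarrow> (nat \<Rightarrow> 'a \<Rightarrow> real) \<Rightarrow> 'a \<Rightarrow> real \<Rightarrow> real \<Rightarrow> real" where
  "brownian_cographon e b s \<omega> = Dec (e \<omega>) (\<lambda>i. b i \<omega>) (\<lambda>i. s i \<omega>)"

end

theory Submission
  imports Defs
begin

text \<open>
  Call a cell of the 4-adic grid a dip of the path if the path stays, on the first and the last
  quarter of the cell, above its value at the midpoint by the square root scale of the cell.
  The minimum over the cell is then attained strictly between these quarters, and if it is unique
  and decorated by 1, then the cographon is 1 on the product of the two quarters, so that an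
  independent set misses almost all of one of them.  If almost every x has dips decorated by 1
  in its neighbourhood at infinitely many scales, an independent set therefore has lower density
  less than 1 almost everywhere, and it is null by Vitali's covering theorem.

  The killed transition densities are dominated by Gaussian ones.  Away from the endpoints, the
  increments of the excursion on a grid thus have a law bounded by a constant times a product of
  Gaussian laws, with a constant that does not depend on the mesh.  For Gaussian increments, dips
  at a given scale have a probability bounded below, and dips in disjoint cells are independent;
  moreover two minima over separated intervals are almost surely distinct, because the increment
  over the gap has a bounded density.  Both facts pass to the excursion by refining the grid.
  The decorations of the dips seen from a point x are independent of the path, hence infinitely
  many of them are 1, and Fubini exchanges almost every x with almost every path.
\<close>

section \<open>Increments of the excursion and Gaussian increments\<close>

text \<open>Every probabilistic input is an upper bound for an exceptional event: a long run of
  cells without a dip, or two minima closer than \<epsilon>. This is why a one-sided comparison with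
  Gaussian increments is enough, even with a large constant \<open>C\<close>: the Gaussian bounds
  multiplied by it still tend to 0. An exceptional event must moreover be visible on every
  sufficiently fine grid. The absence of a dip is a strict inequality at some time and so survives a
  small shift to a grid point; a tie survives as closeness up to \<epsilon>. At level n the cell
  used for a point x has the number \<open>nat \<lfloor>x * 4 ^ n\<rfloor> + 2\<close>. It lies at a
  distance between one and three meshes to the right of x, whereas the cell of the next level lies
  within three quarters of a mesh, so all these cells are disjoint. Disjointness serves twice: it
  makes the Gaussian dips independent, and it makes the minima, and hence the indices of their
  decorations, distinct. Base 4 is chosen because quarters of cells are again cells and the standard
  deviation over a mesh \<open>1 / 4 ^ L\<close> is \<open>1 / 2 ^ L\<close>.\<close>

definition gauss :: "real \<Rightarrow> real measure" where
  "gauss \<sigma> = density lborel (\<lambda>x. ennreal (normal_density 0 \<sigma> x))"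

lemma sets_gauss [simp, measurable_cong]: "sets (gauss \<sigma>) = sets borel"
  by (simp add: gauss_def)

lemma space_gauss [simp]: "space (gauss \<sigma>) = UNIV"
  by (simp add: gauss_def)

lemma prob_space_gauss: "0 < \<sigma> \<Longrightarrow> prob_space (gauss \<sigma>)"
  unfolding gauss_def by (rule prob_space_normal_density)

lemma normal_density_shift: "normal_density m \<sigma> x = normal_density 0 \<sigma> (x - m)"
  by (simp add: normal_density_def)

lemma nn_integral_normal_shift:
  assumes [measurable]: "f \<in> borel_measurable borel"
  shows "(\<integral>\<^sup>+y. ennreal (normal_density m \<sigma> y) * f (y - m) \<partial>lborel) = (\<integral>\<^sup>+z. f z \<partial>gauss \<sigma>)"
proof -
  have "(\<integral>\<^sup>+y. ennreal (normal_density m \<sigma> y) * f (y - m) \<partial>lborel)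
      = (\<integral>\<^sup>+y. ennreal (normal_density m \<sigma> (m + 1 * y)) * f (m + 1 * y - m) \<partial>lborel)"
    by (subst nn_integral_real_affine[where c = 1 and t = m]) simp_all
  also have "\<dots> = (\<integral>\<^sup>+z. f z \<partial>gauss \<sigma>)"
    unfolding gauss_def
    by (subst nn_integral_density) (auto simp: normal_density_shift[of m])
  finally show ?thesis .
qed

text \<open>Passing from positions to the starting point and the increments preserves Lebesgue
  measure, and each transition density depends on one increment only, so the starting point splits
  off. The induction integrates over the last position while the others are fixed and absorbs its
  increment into \<open>F'\<close>. The weight \<open>g\<close> is left general because the entrance
  factor of the excursion will take its place.\<close>

lemma nn_integral_increments:
  fixes g :: "real \<Rightarrow> ennreal" and F :: "(nat \<Rightarrow> real) \<Rightarrow> ennreal"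
  assumes \<sigma>: "0 < \<sigma>" and g[measurable]: "g \<in> borel_measurable borel"
    and "F \<in> borel_measurable (Pi\<^sub>M {..<n} (\<lambda>_. borel))"
  shows "(\<integral>\<^sup>+x. g (x 0) * (\<Prod>i<n. ennreal (normal_density (x i) \<sigma> (x (Suc i))))
              * F (\<lambda>i\<in>{..<n}. x (Suc i) - x i) \<partial>Pi\<^sub>M {..n} (\<lambda>_. lborel))
       = (\<integral>\<^sup>+x. g x \<partial>lborel) * (\<integral>\<^sup>+y. F y \<partial>Pi\<^sub>M {..<n} (\<lambda>_. gauss \<sigma>))"
  using assms(3)
proof (induction n arbitrary: F)
  case 0
  interpret L: product_sigma_finite "\<lambda>_::nat. lborel :: real measure" ..
  have "(\<integral>\<^sup>+x. g (x 0) * F (\<lambda>i\<in>{..<0}. x (Suc i) - x i) \<partial>Pi\<^sub>M {0::nat} (\<lambda>_. lborel))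
      = (\<integral>\<^sup>+x. g x * F (\<lambda>_. undefined) \<partial>lborel)"
    by (subst L.product_nn_integral_singleton[symmetric]) (auto simp: restrict_def)
  then show ?case
    by (simp add: restrict_def nn_integral_multc PiM_empty nn_integral_count_space_finite)
next
  case (Suc n)
  interpret L: product_sigma_finite "\<lambda>_::nat. lborel :: real measure" ..
  interpret G: prob_space "gauss \<sigma>" by (rule prob_space_gauss[OF \<sigma>])
  interpret PG: product_sigma_finite "\<lambda>_::nat. gauss \<sigma>" ..
  note [measurable] = Suc.prems
  define F' where "F' w = (\<integral>\<^sup>+z. F (w(n := z)) \<partial>gauss \<sigma>)" for w
  have ins: "{..<Suc n} = insert n {..<n}" "{..Suc n} = insert (Suc n) {..n}" by auto
  have upd: "(\<lambda>(w, z). w(n := z)) \<in> Pi\<^sub>M {..<n} (\<lambda>_. borel) \<Otimes>\<^sub>M borel \<rightarrow>\<^sub>M Pi\<^sub>M {..<Suc n} (\<lambda>_. borel)"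
    unfolding ins by measurable
  have Fupd[measurable]: "(\<lambda>(w, z). F (w(n := z))) \<in> borel_measurable (Pi\<^sub>M {..<n} (\<lambda>_. borel) \<Otimes>\<^sub>M borel)"
    using measurable_compose[OF upd Suc.prems] by (simp add: case_prod_unfold del: fun_upd_apply)
  have F'[measurable]: "F' \<in> borel_measurable (Pi\<^sub>M {..<n} (\<lambda>_. borel))"
    unfolding F'_def by measurable
  let ?inc = "\<lambda>n (x::nat \<Rightarrow> real). \<lambda>i\<in>{..<n}. x (Suc i) - x i"
  have [measurable]: "?inc n \<in> Pi\<^sub>M {..n} (\<lambda>_. lborel) \<rightarrow>\<^sub>M Pi\<^sub>M {..<n} (\<lambda>_. borel)" for n
    by (intro measurable_restrict borel_measurable_diff) (auto intro!: measurable_component_singleton)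
  have [measurable]: "(\<lambda>x. ennreal (normal_density (x i) \<sigma> (x (Suc i)))) \<in> borel_measurable (Pi\<^sub>M {..n} (\<lambda>_. lborel))"
    if "i < n" for i n
    using that by (simp add: normal_density_shift[of "_ i"])
  have "(\<integral>\<^sup>+x. g (x 0) * (\<Prod>i<Suc n. ennreal (normal_density (x i) \<sigma> (x (Suc i))))
              * F (?inc (Suc n) x) \<partial>Pi\<^sub>M {..Suc n} (\<lambda>_. lborel))
     = (\<integral>\<^sup>+x. \<integral>\<^sup>+y. g ((x(Suc n := y)) 0)
            * (\<Prod>i<Suc n. ennreal (normal_density ((x(Suc n := y)) i) \<sigma> ((x(Suc n := y)) (Suc i))))
              * F (?inc (Suc n) (x(Suc n := y))) \<partial>lborel \<partial>Pi\<^sub>M {..n} (\<lambda>_. lborel))"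
    unfolding ins(2)
    by (rule L.product_nn_integral_insert) (auto simp del: prod.lessThan_Suc simp: ins(2)[symmetric])
  also have "\<dots> = (\<integral>\<^sup>+x. g (x 0) * (\<Prod>i<n. ennreal (normal_density (x i) \<sigma> (x (Suc i))))
              * F' (?inc n x) \<partial>Pi\<^sub>M {..n} (\<lambda>_. lborel))"
  proof (intro nn_integral_cong)
    fix x :: "nat \<Rightarrow> real"
    assume x: "x \<in> space (Pi\<^sub>M {..n} (\<lambda>_. lborel))"
    have 1: "?inc (Suc n) (x(Suc n := y)) = (?inc n x)(n := y - x n)" for y
      by (auto simp: fun_eq_iff restrict_def)
    have 2: "(\<Prod>i<Suc n. ennreal (normal_density ((x(Suc n := y)) i) \<sigma> ((x(Suc n := y)) (Suc i))))
      = (\<Prod>i<n. ennreal (normal_density (x i) \<sigma> (x (Suc i)))) * ennreal (normal_density (x n) \<sigma> y)" for y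
      by (auto intro!: arg_cong2[where f = "(*)"] prod.cong)
    define w where "w = ?inc n x"
    have "w \<in> space (Pi\<^sub>M {..<n} (\<lambda>_. borel))"
      by (auto simp: w_def space_PiM)
    from measurable_Pair2[OF Fupd this]
    have [measurable]: "(\<lambda>z. F (w(n := z))) \<in> borel_measurable borel"
      by (simp only: prod.case)
    show "(\<integral>\<^sup>+y. g ((x(Suc n := y)) 0)
            * (\<Prod>i<Suc n. ennreal (normal_density ((x(Suc n := y)) i) \<sigma> ((x(Suc n := y)) (Suc i))))
              * F (?inc (Suc n) (x(Suc n := y))) \<partial>lborel)
      = g (x 0) * (\<Prod>i<n. ennreal (normal_density (x i) \<sigma> (x (Suc i)))) * F' (?inc n x)"
      unfolding 1 2 F'_def w_def[symmetric]
      using nn_integral_normal_shift[of "\<lambda>z. F (w(n := z))" "x n" \<sigma>]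
      by (simp add: mult.assoc nn_integral_cmult)
  qed
  also have "\<dots> = (\<integral>\<^sup>+x. g x \<partial>lborel) * (\<integral>\<^sup>+y. F' y \<partial>Pi\<^sub>M {..<n} (\<lambda>_. gauss \<sigma>))"
    by (rule Suc.IH[OF F'])
  also have "(\<integral>\<^sup>+y. F' y \<partial>Pi\<^sub>M {..<n} (\<lambda>_. gauss \<sigma>)) = (\<integral>\<^sup>+y. F y \<partial>Pi\<^sub>M {..<Suc n} (\<lambda>_. gauss \<sigma>))"
    unfolding ins(1) F'_def
    by (rule PG.product_nn_integral_insert[symmetric])
       (auto simp: ins(1)[symmetric] cong: measurable_cong_sets)
  finally show ?case .
qed

text \<open>The reflected point is farther from y. That \<open>killed_density\<close> lies below the
  Gaussian density is clear from its definition; this inequality supplies its nonnegativity, without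
  which the product over the grid could not be compared factor by factor.\<close>

lemma normal_density_reflect_le:
  assumes "0 < x" "0 < y"
  shows "normal_density (- x) \<sigma> y \<le> normal_density x \<sigma> y"
proof -
  have "(y - x)\<^sup>2 \<le> (y - - x)\<^sup>2"
    using assms by (simp add: power2_eq_square algebra_simps)
  then show ?thesis
    unfolding normal_density_def
    by (intro mult_left_mono iffD2[OF exp_le_cancel_iff] divide_right_mono) auto
qed

lemma hitting_density_nonneg: "0 < t \<Longrightarrow> 0 \<le> x \<Longrightarrow> 0 \<le> hitting_density t x"
  by (simp add: hitting_density_def)

text \<open>The exponential dominates the linear factor: x \<le> 1 + x^2, and this is at most 1 + 2t
  times exp(x^2 / (2t)). A uniform bound is wanted at the exit time, so that the factor of the last
  position can be pulled out of the integral.\<close>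

lemma hitting_density_bounded:
  assumes "0 < t"
  obtains H where "0 \<le> H" "\<And>x. 0 < x \<Longrightarrow> hitting_density t x \<le> H"
proof -
  have "hitting_density t x \<le> (1 + 2 * t) / t * (1 / sqrt (2 * pi * t))" if "0 < x" for x
  proof -
    have "x * exp (- (x\<^sup>2 / (2 * t))) \<le> 1 + 2 * t"
    proof -
      have "x \<le> 1 + x\<^sup>2"
        using zero_le_power2[of "x - 1"] that zero_le_power2[of x]
        by (simp add: power2_eq_square algebra_simps)
      also have "\<dots> \<le> (1 + 2 * t) * (1 + x\<^sup>2 / (2 * t))"
        using assms by (simp add: field_simps)
      also have "\<dots> \<le> (1 + 2 * t) * exp (x\<^sup>2 / (2 * t))"
        using assms by (intro mult_left_mono exp_ge_add_one_self) auto
      finally show ?thesis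
        by (simp add: exp_minus field_simps)
    qed
    then have "x * exp (- (x\<^sup>2 / (2 * t))) / t * (1 / sqrt (2 * pi * t)) \<le> (1 + 2 * t) / t * (1 / sqrt (2 * pi * t))"
      using assms by (intro mult_right_mono divide_right_mono) auto
    then show ?thesis
      using assms by (simp add: hitting_density_def normal_density_def field_simps)
  qed
  with assms show ?thesis
    by (intro that[of "(1 + 2 * t) / t * (1 / sqrt (2 * pi * t))"]) auto
qed

text \<open>Up to the factor 1/t this is the first absolute moment of a Gaussian law. Integrability
  is wanted at the entrance time, where the first position is integrated over the whole
  half-line.\<close>

lemma hitting_density_integrable:
  assumes "0 < t"
  shows "(\<integral>\<^sup>+x. ennreal (hitting_density t x) * indicator {0<..} x \<partial>lborel) < \<infinity>"
proof -
  have "integrable lborel (\<lambda>x. normal_density 0 (sqrt t) x * \<bar>x - 0\<bar>^1 * (1 / t))"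
    using assms by (intro integrable_mult_left integrable_normal_moment_abs) simp
  then have "(\<integral>\<^sup>+x. ennreal (norm (normal_density 0 (sqrt t) x * \<bar>x - 0\<bar>^1 * (1 / t))) \<partial>lborel) < \<infinity>"
    by (simp only: integrable_iff_bounded)
  moreover have "(\<integral>\<^sup>+x. ennreal (hitting_density t x) * indicator {0<..} x \<partial>lborel)
     \<le> (\<integral>\<^sup>+x. ennreal (norm (normal_density 0 (sqrt t) x * \<bar>x - 0\<bar>^1 * (1 / t))) \<partial>lborel)"
    using assms by (intro nn_integral_mono)
      (auto simp: hitting_density_def indicator_def field_simps abs_mult intro!: ennreal_leI)
  ultimately show ?thesis by (rule le_less_trans[rotated])
qed

text \<open>On the positive orthant, the exit factor is replaced by its bound and each killed
  transition by the Gaussian one. The entrance factor remains and is integrated out, together with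
  the normalising constant, into \<open>C\<close>. Thus \<open>C\<close> depends on the first and
  the last time only, and the number of grid points enters solely through the Gaussian product
  law.\<close>

lemma excursion_increments_bound:
  assumes e: "brownian_excursion M e" and u: "0 < u" and v: "v < 1"
  obtains C where "0 \<le> C"
    "\<And>n t d B. \<lbrakk>t 0 = u; t n = v; 0 < d; \<And>i. i < n \<Longrightarrow> t (Suc i) = t i + d;
        B \<in> sets (Pi\<^sub>M {..<n} (\<lambda>_. borel))\<rbrakk>
      \<Longrightarrow> measure M {\<omega>\<in>space M. (\<lambda>i\<in>{..<n}. e \<omega> (t (Suc i)) - e \<omega> (t i)) \<in> B}
         \<le> C * measure (Pi\<^sub>M {..<n} (\<lambda>_. gauss (sqrt d))) B"
proof -
  interpret prob_space M using e by (simp add: brownian_excursion_def)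
  obtain H where H: "0 \<le> H" "\<And>x. 0 < x \<Longrightarrow> hitting_density (1 - v) x \<le> H"
    using hitting_density_bounded[of "1 - v"] v by auto
  define g where "g x = ennreal (2 * sqrt (2 * pi) * H) * (ennreal (hitting_density u x) * indicator {0<..} x)" for x
  have [measurable]: "hitting_density u \<in> borel_measurable borel"
    unfolding hitting_density_def[abs_def] by measurable
  have [measurable]: "g \<in> borel_measurable borel"
    unfolding g_def by measurable
  have fin: "(\<integral>\<^sup>+x. g x \<partial>lborel) < \<infinity>"
    unfolding g_def using hitting_density_integrable[OF u]
    by (simp add: nn_integral_cmult ennreal_mult_less_top)
  define C where "C = enn2real (\<integral>\<^sup>+x. g x \<partial>lborel)"
  have "measure M {\<omega>\<in>space M. (\<lambda>i\<in>{..<n}. e \<omega> (t (Suc i)) - e \<omega> (t i)) \<in> B}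
         \<le> C * measure (Pi\<^sub>M {..<n} (\<lambda>_. gauss (sqrt d))) B"
    if t0: "t 0 = u" and tn: "t n = v" and d: "0 < d" and step: "\<And>i. i < n \<Longrightarrow> t (Suc i) = t i + d"
      and B: "B \<in> sets (Pi\<^sub>M {..<n} (\<lambda>_. borel))" for n t d B
  proof -
    let ?inc = "\<lambda>(x::nat \<Rightarrow> real). \<lambda>i\<in>{..<n}. x (Suc i) - x i"
    let ?X = "\<lambda>\<omega>. \<lambda>i\<in>{..n}. e \<omega> (t i)"
    interpret PG: prob_space "Pi\<^sub>M {..<n} (\<lambda>_. gauss (sqrt d))"
      using d by (intro prob_space_PiM prob_space_gauss) simp
    have D: "distributed M (Pi\<^sub>M {..n} (\<lambda>_. lborel)) ?X (\<lambda>x. ennreal (excursion_density n t x))"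
      using e t0 tn u v d step unfolding brownian_excursion_def by simp
    have [measurable]: "?inc \<in> Pi\<^sub>M {..n} (\<lambda>_. lborel) \<rightarrow>\<^sub>M Pi\<^sub>M {..<n} (\<lambda>_. borel)"
      by (intro measurable_restrict borel_measurable_diff) (auto intro!: measurable_component_singleton)
    note B[measurable]
    define A where "A = ?inc -` B \<inter> space (Pi\<^sub>M {..n} (\<lambda>_. lborel))"
    have A: "A \<in> sets (Pi\<^sub>M {..n} (\<lambda>_. lborel))"
      unfolding A_def by measurable
    have inc: "?inc (?X \<omega>) = (\<lambda>i\<in>{..<n}. e \<omega> (t (Suc i)) - e \<omega> (t i))" for \<omega>
      by (auto simp: restrict_def fun_eq_iff)
    have "{\<omega>\<in>space M. (\<lambda>i\<in>{..<n}. e \<omega> (t (Suc i)) - e \<omega> (t i)) \<in> B} = ?X -` A \<inter> space M"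
      unfolding A_def vimage_def inc[symmetric] by (auto simp: space_PiM)
    then have "emeasure M {\<omega>\<in>space M. (\<lambda>i\<in>{..<n}. e \<omega> (t (Suc i)) - e \<omega> (t i)) \<in> B}
       = (\<integral>\<^sup>+x. ennreal (excursion_density n t x) * indicator A x \<partial>Pi\<^sub>M {..n} (\<lambda>_. lborel))"
      using distributed_emeasure[OF D A] by simp
    also have "\<dots> \<le> (\<integral>\<^sup>+x. g (x 0) * (\<Prod>i<n. ennreal (normal_density (x i) (sqrt d) (x (Suc i))))
              * indicator B (?inc x) \<partial>Pi\<^sub>M {..n} (\<lambda>_. lborel))"
    proof (intro nn_integral_mono)
      fix x :: "nat \<Rightarrow> real"
      show "ennreal (excursion_density n t x) * indicator A x
        \<le> g (x 0) * (\<Prod>i<n. ennreal (normal_density (x i) (sqrt d) (x (Suc i)))) * indicator B (?inc x)"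
      proof (cases "(\<forall>i\<le>n. 0 < x i) \<and> x \<in> A")
        case True
        then have pos: "\<And>i. i \<le> n \<Longrightarrow> 0 < x i" and xA: "?inc x \<in> B" by (auto simp: A_def)
        have "excursion_density n t x = 2 * sqrt (2 * pi) * hitting_density u (x 0)
           * (\<Prod>i<n. killed_density d (x i) (x (Suc i))) * hitting_density (1 - v) (x n)"
          using pos t0 tn step by (simp add: excursion_density_def)
        also have "\<dots> \<le> 2 * sqrt (2 * pi) * hitting_density u (x 0)
           * (\<Prod>i<n. normal_density (x i) (sqrt d) (x (Suc i))) * H"
          using pos u v H(2)
          by (intro mult_mono mult_left_mono prod_mono prod_nonneg mult_nonneg_nonneg hitting_density_nonneg)
             (auto simp: killed_density_def less_imp_le intro!: normal_density_reflect_le)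
        finally have "ennreal (excursion_density n t x) \<le> ennreal (2 * sqrt (2 * pi) * H * hitting_density u (x 0)
           * (\<Prod>i<n. normal_density (x i) (sqrt d) (x (Suc i))))"
          by (intro ennreal_leI) (simp add: ac_simps)
        also have "\<dots> = g (x 0) * (\<Prod>i<n. ennreal (normal_density (x i) (sqrt d) (x (Suc i))))"
          using pos[of 0] H(1) hitting_density_nonneg[OF u, of "x 0"]
          by (simp add: g_def ennreal_mult prod_ennreal prod_nonneg)
        finally show ?thesis using xA by (simp add: True)
      next
        case False
        then show ?thesis by (auto simp: excursion_density_def indicator_def)
      qed
    qed
    also have "\<dots> = (\<integral>\<^sup>+x. g x \<partial>lborel) * (\<integral>\<^sup>+y. indicator B y \<partial>Pi\<^sub>M {..<n} (\<lambda>_. gauss (sqrt d)))"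
      using d by (intro nn_integral_increments) auto
    also have "(\<integral>\<^sup>+y. indicator B y \<partial>Pi\<^sub>M {..<n} (\<lambda>_. gauss (sqrt d))) = emeasure (Pi\<^sub>M {..<n} (\<lambda>_. gauss (sqrt d))) B"
      by (intro nn_integral_indicator) (simp cong: sets_PiM_cong)
    also have "(\<integral>\<^sup>+x. g x \<partial>lborel) * emeasure (Pi\<^sub>M {..<n} (\<lambda>_. gauss (sqrt d))) B
       = ennreal (C * measure (Pi\<^sub>M {..<n} (\<lambda>_. gauss (sqrt d))) B)"
      using fin by (simp add: C_def ennreal_mult PG.emeasure_eq_measure)
    finally show ?thesis
      by (subst (asm) emeasure_eq_measure, subst (asm) ennreal_le_iff) (simp_all only: C_def mult_nonneg_nonneg enn2real_nonneg measure_nonneg)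
  qed
  then show thesis by (intro that[of C]) (simp_all add: C_def)
qed

section \<open>Dips of a Gaussian walk\<close>

text \<open>One step of the induction for Kolmogorov's inequality: an independent centred increment
  raises the second moment by its variance. Here c stands for the variance of the remaining steps
  and d for the factor 1/K^2.\<close>

lemma nn_integral_gauss_square:
  assumes \<sigma>: "0 < \<sigma>" and c: "0 \<le> c" "0 \<le> d"
  shows "(\<integral>\<^sup>+y. ennreal (((x + y)\<^sup>2 + c) * d) \<partial>gauss \<sigma>) = ennreal ((x\<^sup>2 + \<sigma>\<^sup>2 + c) * d)"
proof -
  let ?n = "normal_density 0 \<sigma>"
  have "has_bochner_integral lborel (\<lambda>y. ((x\<^sup>2 + c) * (?n y * (y - 0)^(2 * 0)) + (2 * x) * (?n y * (y - 0)^(2 * 0 + 1))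
            + ?n y * (y - 0)^(2 * 1)) * d)
     (((x\<^sup>2 + c) * (fact (2 * 0) / ((2 / \<sigma>\<^sup>2)^0 * fact 0)) + (2 * x) * 0 + fact (2 * 1) / ((2 / \<sigma>\<^sup>2)^1 * fact 1)) * d)"
    by (intro has_bochner_integral_add has_bochner_integral_mult_right has_bochner_integral_mult_left
          normal_moment_even normal_moment_odd \<sigma>)
  also have "(\<lambda>y. ((x\<^sup>2 + c) * (?n y * (y - 0)^(2 * 0)) + (2 * x) * (?n y * (y - 0)^(2 * 0 + 1))
            + ?n y * (y - 0)^(2 * 1)) * d) = (\<lambda>y. ?n y * (((x + y)\<^sup>2 + c) * d))"
    by (auto simp: fun_eq_iff power2_eq_square algebra_simps)
  also have "((x\<^sup>2 + c) * (fact (2 * 0) / ((2 / \<sigma>\<^sup>2)^0 * fact 0)) + (2 * x) * 0 + fact (2 * 1) / ((2 / \<sigma>\<^sup>2)^1 * fact 1)) * d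
     = (x\<^sup>2 + \<sigma>\<^sup>2 + c) * d"
    using \<sigma> by (simp add: fact_numeral field_simps)
  finally have "(\<integral>\<^sup>+y. ennreal (?n y * (((x + y)\<^sup>2 + c) * d)) \<partial>lborel) = ennreal ((x\<^sup>2 + \<sigma>\<^sup>2 + c) * d)"
    using c by (subst nn_integral_eq_integral) (auto simp: has_bochner_integral_iff)
  then show ?thesis
    unfolding gauss_def using c
    by (subst nn_integral_density) (auto simp: ennreal_mult)
qed

lemma partial_sum_measurable:
  assumes "S \<subseteq> K" "\<And>i. sets (N i) = sets (borel :: real measure)"
  shows "(\<lambda>y. \<Sum>i\<in>S. y i) \<in> borel_measurable (Pi\<^sub>M K N)"
proof -
  have [measurable]: "(\<lambda>y. y i) \<in> borel_measurable (Pi\<^sub>M K N)" if "i \<in> S" for i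
    using measurable_component_singleton[of i K N] assms that
    by (subst measurable_cong_sets[OF refl assms(2)[of i, symmetric]]) auto
  show ?thesis by simp
qed

text \<open>
  Kolmogorov's inequality for the walk that is read from its last increment backwards, so that
  the induction on the number of steps splits off the step with the largest index.
\<close>

lemma kolmogorov_gauss:
  fixes m :: nat and x \<sigma> K :: real
  assumes \<sigma>: "0 < \<sigma>" and K: "0 < K"
  shows "emeasure (Pi\<^sub>M {..<m} (\<lambda>_. gauss \<sigma>))
           {y \<in> space (Pi\<^sub>M {..<m} (\<lambda>_. gauss \<sigma>)). \<exists>r\<le>m. K < x + (\<Sum>i\<in>{m - r..<m}. y i)}
         \<le> ennreal ((x\<^sup>2 + m * \<sigma>\<^sup>2) * (1 / K\<^sup>2))"
proof (induction m arbitrary: x)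
  case 0
  show ?case
  proof (cases "K < x")
    case True
    then have "K\<^sup>2 \<le> x\<^sup>2" using K by (intro power_mono) auto
    then show ?thesis using K True by (simp add: PiM_empty)
  qed simp
next
  case (Suc m)
  interpret G: prob_space "gauss \<sigma>" by (rule prob_space_gauss[OF \<sigma>])
  interpret PG: product_sigma_finite "\<lambda>_::nat. gauss \<sigma>" ..
  interpret P: prob_space "Pi\<^sub>M J (\<lambda>_. gauss \<sigma>)" for J :: "nat set"
    by (intro prob_space_PiM G.prob_space_axioms)
  define E where "E m x = {y \<in> space (Pi\<^sub>M {..<m} (\<lambda>_. gauss \<sigma>)). \<exists>r\<le>m. K < x + (\<Sum>i\<in>{m - r..<m}. y i)}"
    for m :: nat and x
  have E: "E m x \<in> sets (Pi\<^sub>M {..<m} (\<lambda>_. gauss \<sigma>))" for m x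
  proof -
    note [measurable] = partial_sum_measurable[where K = "{..<m}" and N = "\<lambda>_. gauss \<sigma>"]
    show ?thesis unfolding E_def by measurable auto
  qed
  show ?case
  proof (cases "K < x")
    case True
    then have "K\<^sup>2 \<le> x\<^sup>2 + (1 + real m) * \<sigma>\<^sup>2" using K by (intro add_increasing2 power_mono) auto
    then have "1 \<le> (x\<^sup>2 + Suc m * \<sigma>\<^sup>2) * (1 / K\<^sup>2)" using K by (simp add: field_simps)
    then have "1 \<le> ennreal ((x\<^sup>2 + Suc m * \<sigma>\<^sup>2) * (1 / K\<^sup>2))" by (simp add: ennreal_ge_1)
    then show ?thesis
      using P.measure_le_1 order_trans by blast
  next
    case False
    have ins: "{..<Suc m} = insert m {..<m}" by auto
    have step: "indicator (E (Suc m) x) (w(m := y)) = (indicator (E m (x + y)) w :: ennreal)"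
      if w: "w \<in> space (Pi\<^sub>M {..<m} (\<lambda>_. gauss \<sigma>))" for w y
    proof -
      have sp: "w(m := y) \<in> space (Pi\<^sub>M {..<Suc m} (\<lambda>_. gauss \<sigma>))"
        using w by (auto simp: space_PiM ins PiE_def extensional_def)
      have sm: "(\<Sum>i\<in>{Suc m - Suc r..<Suc m}. (w(m := y)) i) = y + (\<Sum>i\<in>{m - r..<m}. w i)" if "r \<le> m" for r
      proof -
        have "{Suc m - Suc r..<Suc m} = insert m {m - r..<m}" using that by auto
        then show ?thesis by (auto intro!: arg_cong2[where f = "(+)"] sum.cong)
      qed
      have "(\<exists>r\<le>Suc m. K < x + (\<Sum>i\<in>{Suc m - r..<Suc m}. (w(m := y)) i)) \<longleftrightarrow>
        (\<exists>r\<le>m. K < x + (\<Sum>i\<in>{Suc m - Suc r..<Suc m}. (w(m := y)) i))"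
      proof
        assume "\<exists>r\<le>Suc m. K < x + (\<Sum>i\<in>{Suc m - r..<Suc m}. (w(m := y)) i)"
        then obtain r where r: "r \<le> Suc m" "K < x + (\<Sum>i\<in>{Suc m - r..<Suc m}. (w(m := y)) i)" by blast
        then have "r \<noteq> 0" using False by (intro notI) simp
        then obtain r' where "r = Suc r'" by (cases r) auto
        with r show "\<exists>r\<le>m. K < x + (\<Sum>i\<in>{Suc m - Suc r..<Suc m}. (w(m := y)) i)" by blast
      next
        assume "\<exists>r\<le>m. K < x + (\<Sum>i\<in>{Suc m - Suc r..<Suc m}. (w(m := y)) i)"
        then show "\<exists>r\<le>Suc m. K < x + (\<Sum>i\<in>{Suc m - r..<Suc m}. (w(m := y)) i)"
          using Suc_le_mono by blast
      qed
      also have "\<dots> \<longleftrightarrow> (\<exists>r\<le>m. K < x + y + (\<Sum>i\<in>{m - r..<m}. w i))"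
        using sm by (simp add: add.assoc cong: conj_cong)
      finally show ?thesis
        using w sp unfolding E_def indicator_def by (simp del: fun_upd_apply)
    qed
    have "emeasure (Pi\<^sub>M {..<Suc m} (\<lambda>_. gauss \<sigma>)) (E (Suc m) x)
        = (\<integral>\<^sup>+y. indicator (E (Suc m) x) y \<partial>Pi\<^sub>M {..<Suc m} (\<lambda>_. gauss \<sigma>))"
      using E by simp
    also have "\<dots> = (\<integral>\<^sup>+y. \<integral>\<^sup>+w. indicator (E (Suc m) x) (w(m := y)) \<partial>Pi\<^sub>M {..<m} (\<lambda>_. gauss \<sigma>) \<partial>gauss \<sigma>)"
      unfolding ins using E[of "Suc m" x]
      by (intro PG.product_nn_integral_insert_rev) (auto simp: ins)
    also have "\<dots> = (\<integral>\<^sup>+y. emeasure (Pi\<^sub>M {..<m} (\<lambda>_. gauss \<sigma>)) (E m (x + y)) \<partial>gauss \<sigma>)"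
      using E by (intro nn_integral_cong) (simp add: step cong: nn_integral_cong)
    also have "\<dots> \<le> (\<integral>\<^sup>+y. ennreal (((x + y)\<^sup>2 + m * \<sigma>\<^sup>2) * (1 / K\<^sup>2)) \<partial>gauss \<sigma>)"
      using Suc.IH unfolding E_def by (intro nn_integral_mono) blast
    also have "\<dots> = ennreal ((x\<^sup>2 + \<sigma>\<^sup>2 + m * \<sigma>\<^sup>2) * (1 / K\<^sup>2))"
      using \<sigma> by (intro nn_integral_gauss_square) auto
    finally show ?thesis
      unfolding E_def by (simp add: algebra_simps)
  qed
qed

section \<open>Blocks and sums of independent Gaussian increments\<close>

lemma gauss_symmetric:
  assumes \<sigma>: "0 < \<sigma>"
  shows "distr (gauss \<sigma>) borel uminus = gauss \<sigma>"
proof -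
  interpret G: prob_space "gauss \<sigma>" by (rule prob_space_gauss[OF \<sigma>])
  have "distributed (gauss \<sigma>) lborel (\<lambda>x. x) (normal_density 0 \<sigma>)"
    by (simp add: distributed_def gauss_def distr_id2)
  from G.normal_density_affine[OF this \<sigma>, of "-1" 0]
  have "distributed (gauss \<sigma>) lborel (\<lambda>x. - x) (normal_density 0 \<sigma>)" by simp
  then have "distr (gauss \<sigma>) lborel uminus = gauss \<sigma>"
    by (simp add: distributed_def gauss_def)
  then show ?thesis by (simp cong: distr_cong)
qed

lemma distr_noise_coordinate:
  assumes \<sigma>: "0 < \<sigma>" and "i \<in> I"
  shows "distr (Pi\<^sub>M I (\<lambda>_. gauss \<sigma>)) borel (\<lambda>y. y i) = gauss \<sigma>"
proof -
  have "distr (Pi\<^sub>M I (\<lambda>_. gauss \<sigma>)) (gauss \<sigma>) (\<lambda>y. y i) = gauss \<sigma>"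
    using assms by (intro distr_PiM_component prob_space_gauss)
  then show ?thesis by (simp cong: distr_cong)
qed

lemma indep_vars_noise:
  assumes \<sigma>: "0 < \<sigma>" and I: "I \<noteq> {}"
  shows "prob_space.indep_vars (Pi\<^sub>M I (\<lambda>_. gauss \<sigma>)) (\<lambda>_. borel) (\<lambda>i y. y i) I"
proof -
  interpret P: prob_space "Pi\<^sub>M I (\<lambda>_. gauss \<sigma>)"
    using \<sigma> by (intro prob_space_PiM prob_space_gauss)
  have "distr (Pi\<^sub>M I (\<lambda>_. gauss \<sigma>)) (Pi\<^sub>M I (\<lambda>_. borel)) (\<lambda>y. \<lambda>i\<in>I. y i)
      = distr (Pi\<^sub>M I (\<lambda>_. gauss \<sigma>)) (Pi\<^sub>M I (\<lambda>_. gauss \<sigma>)) (\<lambda>y. y)"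
    by (intro distr_cong sets_PiM_cong) (auto simp: space_PiM PiE_restrict)
  also have "\<dots> = Pi\<^sub>M I (\<lambda>i. distr (Pi\<^sub>M I (\<lambda>_. gauss \<sigma>)) borel (\<lambda>y. y i))"
    by (simp add: distr_id2, intro PiM_cong refl) (simp add: distr_noise_coordinate[OF \<sigma>])
  finally show ?thesis
    using I by (subst P.indep_vars_iff_distr_eq_PiM')
      (auto intro!: measurable_PiM_component_rev)
qed

text \<open>Distinct coordinates, all with the same sign change or none, are again independent
  Gaussian variables. Through \<pi> and c, Kolmogorov's inequality becomes available on any stretch
  of the grid, in either direction of time, and for minima as well as for maxima.\<close>

lemma distr_noise_reindex:
  assumes \<sigma>: "0 < \<sigma>" and c: "c = 1 \<or> c = (-1::real)"
    and inj: "inj_on \<pi> J" "\<pi> ` J \<subseteq> I" and J: "J \<noteq> {}"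
  shows "distr (Pi\<^sub>M I (\<lambda>_. gauss \<sigma>)) (Pi\<^sub>M J (\<lambda>_. borel)) (\<lambda>y. \<lambda>j\<in>J. c * y (\<pi> j)) = Pi\<^sub>M J (\<lambda>_. gauss \<sigma>)"
proof -
  interpret P: prob_space "Pi\<^sub>M I (\<lambda>_. gauss \<sigma>)"
    using \<sigma> by (intro prob_space_PiM prob_space_gauss)
  have I: "I \<noteq> {}" using inj J by auto
  have "P.indep_vars (\<lambda>j. Pi\<^sub>M {\<pi> j} (\<lambda>_. borel)) (\<lambda>j y. restrict (\<lambda>i. y i) {\<pi> j}) J"
    using inj by (intro P.indep_vars_restrict[OF indep_vars_noise[OF \<sigma> I]])
      (auto simp: disjoint_family_on_def inj_on_def)
  then have ind: "P.indep_vars (\<lambda>_. borel) (\<lambda>j y. c * (restrict (\<lambda>i. y i) {\<pi> j}) (\<pi> j)) J"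
    by (rule P.indep_vars_compose2) measurable
  have m[measurable]: "(\<lambda>y. y (\<pi> j)) \<in> borel_measurable (Pi\<^sub>M I (\<lambda>_. gauss \<sigma>))" if "j \<in> J" for j
    using inj that by (auto intro!: measurable_PiM_component_rev)
  have "distr (Pi\<^sub>M I (\<lambda>_. gauss \<sigma>)) (Pi\<^sub>M J (\<lambda>_. borel)) (\<lambda>y. \<lambda>j\<in>J. c * y (\<pi> j))
      = Pi\<^sub>M J (\<lambda>j. distr (Pi\<^sub>M I (\<lambda>_. gauss \<sigma>)) borel (\<lambda>y. c * y (\<pi> j)))"
    using P.indep_vars_iff_distr_eq_PiM'[OF J, THEN iffD1, OF _ ind] by (simp add: m)
  also have "\<dots> = Pi\<^sub>M J (\<lambda>_. gauss \<sigma>)"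
  proof (intro PiM_cong refl)
    fix j assume j: "j \<in> J"
    then have "distr (gauss \<sigma>) borel (\<lambda>x. c * x) = distr (Pi\<^sub>M I (\<lambda>_. gauss \<sigma>)) borel (\<lambda>y. c * y (\<pi> j))"
      using inj by (subst distr_noise_coordinate[OF \<sigma>, of "\<pi> j" I, symmetric])
        (auto simp: distr_distr comp_def)
    moreover have "distr (gauss \<sigma>) borel (\<lambda>x. c * x) = gauss \<sigma>"
      using c gauss_symmetric[OF \<sigma>] by (auto simp: distr_id2)
    ultimately show "distr (Pi\<^sub>M I (\<lambda>_. gauss \<sigma>)) borel (\<lambda>y. c * y (\<pi> j)) = gauss \<sigma>" by simp
  qed
  finally show ?thesis .
qed

text \<open>Restrictions of the noise to disjoint index sets are independent. The assumption
  \<open>loc\<close> expresses that \<open>Q j\<close> looks at the coordinates in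
  \<open>K j\<close> only, so that its event is a preimage under the restriction.\<close>

lemma noise_blocks_independent:
  fixes K :: "'j \<Rightarrow> 'i set"
  assumes \<sigma>: "0 < \<sigma>" and L: "finite L" "L \<noteq> {}" and I: "I \<noteq> {}" "\<And>j. j \<in> L \<Longrightarrow> K j \<subseteq> I"
    and disj: "disjoint_family_on K L"
    and Q: "\<And>j. j \<in> L \<Longrightarrow> Measurable.pred (Pi\<^sub>M (K j) (\<lambda>_. borel)) (Q j)"
    and loc: "\<And>j y. j \<in> L \<Longrightarrow> Q j (restrict y (K j)) = Q j y"
  shows "measure (Pi\<^sub>M I (\<lambda>_. gauss \<sigma>)) {y \<in> space (Pi\<^sub>M I (\<lambda>_. gauss \<sigma>)). \<forall>j\<in>L. Q j y}
       = (\<Prod>j\<in>L. measure (Pi\<^sub>M I (\<lambda>_. gauss \<sigma>)) {y \<in> space (Pi\<^sub>M I (\<lambda>_. gauss \<sigma>)). Q j y})"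
proof -
  let ?P = "Pi\<^sub>M I (\<lambda>_. gauss \<sigma>)"
  interpret P: prob_space ?P
    using \<sigma> by (intro prob_space_PiM prob_space_gauss)
  have "P.indep_vars (\<lambda>j. Pi\<^sub>M (K j) (\<lambda>_. borel)) (\<lambda>j y. restrict (\<lambda>i. y i) (K j)) L"
    using I disj by (intro P.indep_vars_restrict[OF indep_vars_noise[OF \<sigma>]])
  from P.indep_varsD_finite[OF this L(2,1), of "\<lambda>j. {w \<in> space (Pi\<^sub>M (K j) (\<lambda>_. borel)). Q j w}"]
  have h: "P.prob (\<Inter>j\<in>L. (\<lambda>y. restrict y (K j)) -` {w \<in> space (Pi\<^sub>M (K j) (\<lambda>_. borel)). Q j w} \<inter> space ?P)
      = (\<Prod>j\<in>L. P.prob ((\<lambda>y. restrict y (K j)) -` {w \<in> space (Pi\<^sub>M (K j) (\<lambda>_. borel)). Q j w} \<inter> space ?P))"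
    using Q by (simp add: pred_def)
  have eq: "(\<lambda>y. restrict y (K j)) -` {w \<in> space (Pi\<^sub>M (K j) (\<lambda>_. borel)). Q j w} \<inter> space ?P
      = {y \<in> space ?P. Q j y}" if "j \<in> L" for j
    using loc[OF that] by (auto simp: space_PiM)
  have "{y \<in> space ?P. \<forall>j\<in>L. Q j y} = (\<Inter>j\<in>L. {y \<in> space ?P. Q j y})"
    using L by auto
  also have "\<dots> = (\<Inter>j\<in>L. (\<lambda>y. restrict y (K j)) -` {w \<in> space (Pi\<^sub>M (K j) (\<lambda>_. borel)). Q j w} \<inter> space ?P)"
    by (intro INF_cong refl eq[symmetric])
  finally have "P.prob {y \<in> space ?P. \<forall>j\<in>L. Q j y} = (\<Prod>j\<in>L. P.prob ((\<lambda>y. restrict y (K j)) -` {w \<in> space (Pi\<^sub>M (K j) (\<lambda>_. borel)). Q j w} \<inter> space ?P))"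
    using h by simp
  also have "(\<Prod>j\<in>L. P.prob ((\<lambda>y. restrict y (K j)) -` {w \<in> space (Pi\<^sub>M (K j) (\<lambda>_. borel)). Q j w} \<inter> space ?P))
      = (\<Prod>j\<in>L. P.prob {y \<in> space ?P. Q j y})"
    by (intro prod.cong refl arg_cong[where f = P.prob] eq)
  finally show ?thesis .
qed

lemma noise_walk_max:
  fixes q :: nat and \<sigma> K :: real
  assumes \<sigma>: "0 < \<sigma>" and K: "0 < K" and c: "c = 1 \<or> c = (-1::real)" and q: "0 < q"
    and inj: "inj_on \<pi> {..<q}" "\<pi> ` {..<q} \<subseteq> I"
  shows "measure (Pi\<^sub>M I (\<lambda>_. gauss \<sigma>))
      {y \<in> space (Pi\<^sub>M I (\<lambda>_. gauss \<sigma>)). \<forall>r\<le>q. (\<Sum>i\<in>{q - r..<q}. c * y (\<pi> i)) \<le> K}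
    \<ge> 1 - q * \<sigma>\<^sup>2 / K\<^sup>2"
proof -
  let ?P = "Pi\<^sub>M I (\<lambda>_. gauss \<sigma>)" and ?R = "Pi\<^sub>M {..<q} (\<lambda>_. gauss \<sigma>)"
  interpret P: prob_space ?P
    using \<sigma> by (intro prob_space_PiM prob_space_gauss)
  interpret R: prob_space ?R
    using \<sigma> by (intro prob_space_PiM prob_space_gauss)
  let ?E = "{y \<in> space ?R. \<exists>r\<le>q. K < (\<Sum>i\<in>{q - r..<q}. y i)}"
  let ?f = "\<lambda>y. \<lambda>j\<in>{..<q}. c * y (\<pi> j)"
  have D: "distr ?P (Pi\<^sub>M {..<q} (\<lambda>_. borel)) ?f = ?R"
    using q by (intro distr_noise_reindex \<sigma> c inj) auto
  have "{y \<in> space ?R. K < (\<Sum>i\<in>{q - r..<q}. y i)} \<in> sets ?R" for r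
    by (intro borel_measurable_less borel_measurable_const partial_sum_measurable) auto
  then have "(\<Union>r\<in>{..q}. {y \<in> space ?R. K < (\<Sum>i\<in>{q - r..<q}. y i)}) \<in> sets ?R"
    by (intro sets.finite_UN) auto
  also have "(\<Union>r\<in>{..q}. {y \<in> space ?R. K < (\<Sum>i\<in>{q - r..<q}. y i)}) = ?E" by auto
  finally have E: "?E \<in> sets ?R" .
  have f: "?f \<in> ?P \<rightarrow>\<^sub>M Pi\<^sub>M {..<q} (\<lambda>_. borel)"
    using inj by (intro measurable_restrict borel_measurable_times)
      (auto intro!: measurable_PiM_component_rev)
  have "sets ?R = sets (Pi\<^sub>M {..<q} (\<lambda>_. borel))" by (intro sets_PiM_cong) auto
  with E have E': "?E \<in> sets (Pi\<^sub>M {..<q} (\<lambda>_. borel))" by (simp only:)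
  have "measure (distr ?P (Pi\<^sub>M {..<q} (\<lambda>_. borel)) ?f) ?E = P.prob (?f -` ?E \<inter> space ?P)"
    using f E' by (rule measure_distr)
  then have "P.prob (?f -` ?E \<inter> space ?P) = R.prob ?E"
    unfolding D by (rule sym)
  also have "\<dots> \<le> q * \<sigma>\<^sup>2 / K\<^sup>2"
    using kolmogorov_gauss[OF \<sigma> K, of q 0] by (simp add: R.emeasure_eq_measure)
  finally have "P.prob (?f -` ?E \<inter> space ?P) \<le> q * \<sigma>\<^sup>2 / K\<^sup>2" .
  moreover have "?f -` ?E \<inter> space ?P \<in> sets ?P"
    using measurable_sets[OF f E'] .
  moreover have "{y \<in> space ?P. \<forall>r\<le>q. (\<Sum>i\<in>{q - r..<q}. c * y (\<pi> i)) \<le> K} = space ?P - (?f -` ?E \<inter> space ?P)"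
    by (auto simp: space_PiM not_le)
  ultimately show ?thesis
    by (simp add: P.prob_compl)
qed

lemma noise_sum_distributed:
  assumes \<sigma>: "0 < \<sigma>" and S: "finite S" "S \<noteq> {}" "S \<subseteq> I"
  shows "distributed (Pi\<^sub>M I (\<lambda>_. gauss \<sigma>)) lborel (\<lambda>y. \<Sum>i\<in>S. y i)
    (normal_density 0 (sqrt (card S) * \<sigma>))"
proof -
  let ?P = "Pi\<^sub>M I (\<lambda>_. gauss \<sigma>)"
  interpret P: prob_space ?P
    using \<sigma> by (intro prob_space_PiM prob_space_gauss)
  have 1: "distributed ?P lborel (\<lambda>y. y i) (normal_density 0 \<sigma>)" if "i \<in> I" for i
    using distr_noise_coordinate[OF \<sigma> that] that
    by (auto simp: distributed_def gauss_def cong: distr_cong intro!: measurable_PiM_component_rev)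
  have I: "I \<noteq> {}" using S by auto
  have ind: "P.indep_vars (\<lambda>_. borel) (\<lambda>i y. y i) S"
    using S by (intro P.indep_vars_subset[OF indep_vars_noise[OF \<sigma> I]])
  have "distributed ?P lborel (\<lambda>y. \<Sum>i\<in>S. y i) (normal_density (\<Sum>i\<in>S. 0) (sqrt (\<Sum>i\<in>S. \<sigma>\<^sup>2)))"
    using S \<sigma> 1 by (intro P.sum_indep_normal ind) auto
  then show ?thesis using \<sigma> by (simp add: real_sqrt_mult)
qed

section \<open>The probability of a dip in a block of a Gaussian walk\<close>

text \<open>
  The lower bound for the probability of a dip that is obtained by asking the two inner stretches of
  a block to move by three standard deviations (the tail of the Gaussian law) and the two outer
  ones to stay within two of them (probability at least 3/4 by Kolmogorov's inequality).
\<close>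

definition dip_prob :: real where
  "dip_prob = (3 / 4 * measure (gauss 1) {3..})\<^sup>2"

lemma gauss_tail_scale:
  assumes s: "0 < s"
  shows "measure (gauss s) {3 * s..} = measure (gauss 1) {3..}"
    "measure (gauss s) {..- (3 * s)} = measure (gauss 1) {3..}"
proof -
  interpret G: prob_space "gauss 1" by (rule prob_space_gauss) simp
  interpret S: prob_space "gauss s" by (rule prob_space_gauss[OF s])
  have "distributed (gauss 1) lborel (\<lambda>x. x) (normal_density 0 1)"
    by (simp add: distributed_def gauss_def distr_id2)
  from G.normal_density_affine[OF this, of s 0] s
  have D: "distr (gauss 1) lborel (\<lambda>x. s * x) = gauss s"
    by (simp add: distributed_def gauss_def)
  have "measure (distr (gauss 1) lborel (\<lambda>x. s * x)) {3 * s..} = measure (gauss 1) ((\<lambda>x. s * x) -` {3 * s..})"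
    by (subst measure_distr) (auto simp: measurable_cong_sets[OF sets_gauss refl])
  also have "(\<lambda>x. s * x) -` {3 * s..} = {3..}"
    using s by (auto simp: field_simps)
  finally show 1: "measure (gauss s) {3 * s..} = measure (gauss 1) {3..}" unfolding D .
  have "measure (distr (gauss s) borel uminus) {..- (3 * s)} = measure (gauss s) {3 * s..}"
    by (subst measure_distr) (auto simp: measurable_cong_sets[OF sets_gauss refl] intro!: arg_cong[where f = "measure (gauss s)"])
  then show "measure (gauss s) {..- (3 * s)} = measure (gauss 1) {3..}"
    unfolding gauss_symmetric[OF s] 1 .
qed

lemma dip_prob_pos: "0 < dip_prob"
proof -
  interpret G: prob_space "gauss 1" by (rule prob_space_gauss) simp
  have "emeasure (gauss 1) {3..} \<noteq> 0"
  proof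
    assume "emeasure (gauss 1) {3..} = 0"
    then have "AE x in lborel. x \<in> {3::real..} \<longrightarrow> ennreal (normal_density 0 1 x) = 0"
      by (subst (asm) gauss_def) (simp add: emeasure_density nn_integral_0_iff_AE indicator_def, auto elim!: eventually_mono)
    then have "AE x in lborel. \<not> (3::real) \<le> x"
      by eventually_elim (use normal_density_pos[of 1 0] in \<open>auto simp: ennreal_eq_0_iff not_le[symmetric]\<close>)
    then have "emeasure lborel {x \<in> space lborel. (3::real) \<le> x} = 0"
      by (rule emeasure_eq_0_AE)
    moreover have "emeasure lborel {3::real..4} \<le> emeasure lborel {x \<in> space lborel. (3::real) \<le> x}"
      by (intro emeasure_mono) auto
    ultimately show False by simp
  qed
  then have "measure (gauss 1) {3..} > 0"
    by (simp add: G.emeasure_eq_measure zero_less_measure_iff)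
  then show ?thesis by (simp add: dip_prob_def)
qed

lemma dip_prob_le_1: "dip_prob \<le> 1"
proof -
  interpret G: prob_space "gauss 1" by (rule prob_space_gauss) simp
  have "3 / 4 * measure (gauss 1) {3..} \<le> 1 * 1"
    by (intro mult_mono) auto
  then show ?thesis
    unfolding dip_prob_def by (intro power_le_one) auto
qed

text \<open>
  The walk with increments y has, seen from time A, a dip of depth at least h in the middle of
  four stretches of length q: its value after 2 * q steps is below all its values
  on the first and on the last stretch.
\<close>

definition block_dip :: "nat \<Rightarrow> nat \<Rightarrow> real \<Rightarrow> (nat \<Rightarrow> real) \<Rightarrow> bool" where
  "block_dip A q h y \<longleftrightarrow> (\<forall>g\<le>q. h \<le> - (\<Sum>i\<in>{A + g..<A + 2 * q}. y i)
     \<and> h \<le> (\<Sum>i\<in>{A + 2 * q..<A + 3 * q + g}. y i))"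

lemma block_dip_restrict:
  assumes "{A..<A + 4 * q} \<subseteq> K"
  shows "block_dip A q h (restrict y K) = block_dip A q h y"
proof -
  have r: "restrict y K i = y i" if "A \<le> i" "i < A + 4 * q" for i
    using assms that by auto
  have "(\<Sum>i\<in>{A + g..<A + 2 * q}. restrict y K i) = (\<Sum>i\<in>{A + g..<A + 2 * q}. y i)" for g
    by (intro sum.cong refl r) auto
  moreover have "(\<Sum>i\<in>{A + 2 * q..<A + 3 * q + g}. restrict y K i) = (\<Sum>i\<in>{A + 2 * q..<A + 3 * q + g}. y i)"
    if "g \<le> q" for g
    using that by (intro sum.cong refl r) auto
  ultimately show ?thesis unfolding block_dip_def by auto
qed

lemma block_dip_measurable:
  assumes "{A..<A + 4 * q} \<subseteq> K" "\<And>i. sets (N i) = sets (borel :: real measure)"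
  shows "Measurable.pred (Pi\<^sub>M K N) (block_dip A q h)"
proof -
  have c: "(\<lambda>y. y i) \<in> borel_measurable (Pi\<^sub>M K N)" if "i \<in> {A..<A + 4 * q}" for i
    using measurable_component_singleton[of i K N] assms(1) that
    by (subst measurable_cong_sets[OF refl assms(2)[of i, symmetric]]) auto
  have "Measurable.pred (Pi\<^sub>M K N) (\<lambda>y. \<forall>g\<in>{..q}. h \<le> - (\<Sum>i\<in>{A + g..<A + 2 * q}. y i)
     \<and> h \<le> (\<Sum>i\<in>{A + 2 * q..<A + 3 * q + g}. y i))"
  proof (intro pred_intros_finite(3) pred_intros_logic(3) finite_atMost)
    fix g assume "g \<in> {..q}"
    then show "Measurable.pred (Pi\<^sub>M K N) (\<lambda>y. h \<le> - (\<Sum>i\<in>{A + g..<A + 2 * q}. y i))"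
      "Measurable.pred (Pi\<^sub>M K N) (\<lambda>y. h \<le> (\<Sum>i\<in>{A + 2 * q..<A + 3 * q + g}. y i))"
      unfolding pred_def
      by (intro borel_measurable_le borel_measurable_const borel_measurable_uminus borel_measurable_sum c; simp)+
  qed
  then show ?thesis
    unfolding block_dip_def[abs_def] by (simp only: Ball_def atMost_iff)
qed

text \<open>With s the standard deviation over one stretch, the walk falls by 3s on the second
  stretch and rises by 3s on the third, and on the outer stretches it regains at most 2s of this. A
  margin of s remains. The four requirements concern disjoint sets of increments, so their
  probabilities multiply.\<close>

lemma block_dip_prob:
  assumes \<sigma>: "0 < \<sigma>" and q: "0 < q" and I: "{A..<A + 4 * q} \<subseteq> I"
  shows "dip_prob \<le> measure (Pi\<^sub>M I (\<lambda>_. gauss \<sigma>))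
      {y \<in> space (Pi\<^sub>M I (\<lambda>_. gauss \<sigma>)). block_dip A q (sqrt q * \<sigma>) y}"
proof -
  let ?P = "Pi\<^sub>M I (\<lambda>_. gauss \<sigma>)"
  interpret P: prob_space ?P
    using \<sigma> by (intro prob_space_PiM prob_space_gauss)
  define s where "s = sqrt q * \<sigma>"
  have s: "0 < s" "s\<^sup>2 = q * \<sigma>\<^sup>2" using \<sigma> q by (auto simp: s_def power_mult_distrib)
  define K where "K j = {A + j * q..<A + (j + 1) * q}" for j
  \<comment> \<open>Both outer conditions are written as bounds on sums of final terms, the form in
    which Kolmogorov's inequality is available. For the first stretch these are the increments up to
    time A + q; for the last one the index is reversed, so that they are the increments after time A
    + 3q, with the sign changed.\<close>
  define Q where "Q j y = (if j = 0 then \<forall>r\<in>{..q}. (\<Sum>i\<in>{q - r..<q}. 1 * y (A + i)) \<le> 2 * s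
     else if j = 1 then (\<Sum>i\<in>K 1. y i) \<le> - (3 * s)
     else if j = 2 then 3 * s \<le> (\<Sum>i\<in>K 2. y i)
     else \<forall>r\<in>{..q}. (\<Sum>i\<in>{q - r..<q}. (-1) * y (A + 4 * q - 1 - i)) \<le> 2 * s)" for j :: nat and y :: "nat \<Rightarrow> real"
  have Q: "Q 0 = (\<lambda>y. \<forall>r\<in>{..q}. (\<Sum>i\<in>{q - r..<q}. 1 * y (A + i)) \<le> 2 * s)"
    "Q 1 = (\<lambda>y. (\<Sum>i\<in>K 1. y i) \<le> - (3 * s))"
    "Q 2 = (\<lambda>y. 3 * s \<le> (\<Sum>i\<in>K 2. y i))"
    "Q 3 = (\<lambda>y. \<forall>r\<in>{..q}. (\<Sum>i\<in>{q - r..<q}. (-1) * y (A + 4 * q - 1 - i)) \<le> 2 * s)"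
    unfolding Q_def by (rule ext, simp only: if_True if_False refl one_neq_zero zero_neq_numeral numeral_eq_one_iff num.distinct numeral_eq_iff one_eq_numeral_iff numeral_neq_zero num.inject simp_thms)+
  have KI: "K j \<subseteq> I" if "j < 4" for j
  proof -
    have "q + j * q \<le> 4 * q" using that mult_right_mono[of "j + 1" 4 q] by simp
    then have "K j \<subseteq> {A..<A + 4 * q}" by (auto simp: K_def)
    with I show ?thesis by simp
  qed
  have "P.prob {y \<in> space ?P. \<forall>j\<in>{..<4}. Q j y} = (\<Prod>j\<in>{..<4}. P.prob {y \<in> space ?P. Q j y})"
  proof (rule noise_blocks_independent[OF \<sigma>])
    show "I \<noteq> {}" using I q by force
    show "K j \<subseteq> I" if "j \<in> {..<4}" for j using KI that by auto
    show "disjoint_family_on K {..<4}"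
    proof -
      have "K j \<inter> K k = {}" if "j < k" for j k
      proof -
        have "(j + 1) * q \<le> k * q" using that by (intro mult_right_mono) auto
        then show ?thesis by (auto simp: K_def)
      qed
      then show ?thesis
        unfolding disjoint_family_on_def by (metis inf_commute linorder_neqE_nat)
    qed
    fix j :: nat assume "j \<in> {..<4}"
    then consider "j = 0" | "j = 1" | "j = 2" | "j = 3" by force
    note j = this
    have c: "(\<lambda>y::nat \<Rightarrow> real. y i) \<in> borel_measurable (Pi\<^sub>M (K j) (\<lambda>_. borel))" if "i \<in> K j" for i
      using that by (intro measurable_component_singleton)
    show "Measurable.pred (Pi\<^sub>M (K j) (\<lambda>_. borel)) (Q j)"
    proof (cases rule: j)
      case 1
      have "{y \<in> space (Pi\<^sub>M (K j) (\<lambda>_. borel)). \<forall>r\<in>{..q}. (\<Sum>i\<in>{q - r..<q}. 1 * y (A + i)) \<le> 2 * s}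
          \<in> sets (Pi\<^sub>M (K j) (\<lambda>_. borel))"
        by (rule sets.sets_Collect_finite_All, rule borel_measurable_le, rule borel_measurable_sum,
            rule borel_measurable_times[OF borel_measurable_const], rule c) (auto simp: K_def 1)
      then show ?thesis unfolding 1 Q(1) pred_def .
    next
      case 2
      have "{y \<in> space (Pi\<^sub>M (K j) (\<lambda>_. borel)). (\<Sum>i\<in>K 1. y i) \<le> - (3 * s)} \<in> sets (Pi\<^sub>M (K j) (\<lambda>_. borel))"
        by (intro borel_measurable_le borel_measurable_const borel_measurable_sum c) (auto simp: 2)
      then show ?thesis unfolding 2 Q(2) pred_def .
    next
      case 3
      have "{y \<in> space (Pi\<^sub>M (K j) (\<lambda>_. borel)). 3 * s \<le> (\<Sum>i\<in>K 2. y i)} \<in> sets (Pi\<^sub>M (K j) (\<lambda>_. borel))"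
        by (intro borel_measurable_le borel_measurable_const borel_measurable_sum c) (auto simp: 3)
      then show ?thesis unfolding 3 Q(3) pred_def .
    next
      case 4
      have "{y \<in> space (Pi\<^sub>M (K j) (\<lambda>_. borel)).
          \<forall>r\<in>{..q}. (\<Sum>i\<in>{q - r..<q}. (-1) * y (A + 4 * q - 1 - i)) \<le> 2 * s}
          \<in> sets (Pi\<^sub>M (K j) (\<lambda>_. borel))"
        by (rule sets.sets_Collect_finite_All, rule borel_measurable_le, rule borel_measurable_sum,
            rule borel_measurable_times[OF borel_measurable_const], rule c) (auto simp: K_def 4)
      then show ?thesis unfolding 4 Q(4) pred_def .
    qed
    fix y :: "nat \<Rightarrow> real"
    have "restrict y (K j) i = y i" if "i \<in> K j" for i using that by simp
    note r = this
    show "Q j (restrict y (K j)) = Q j y"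
    proof (cases rule: j)
      case 1
      have "(\<Sum>i\<in>{q - r'..<q}. 1 * restrict y (K j) (A + i)) = (\<Sum>i\<in>{q - r'..<q}. 1 * y (A + i))" for r'
        by (intro sum.cong refl arg_cong[where f = "\<lambda>t. 1 * t"] r) (auto simp: K_def 1)
      then show ?thesis unfolding 1 Q(1) by (simp only:)
    next
      case 4
      have "(\<Sum>i\<in>{q - r'..<q}. (-1) * restrict y (K j) (A + 4 * q - 1 - i)) = (\<Sum>i\<in>{q - r'..<q}. (-1) * y (A + 4 * q - 1 - i))" for r'
        by (intro sum.cong refl arg_cong[where f = "\<lambda>t. (-1) * t"] r) (auto simp: K_def 4)
      then show ?thesis unfolding 4 Q(4) by (simp only:)
    next
      case 2
      then show ?thesis unfolding 2 Q(2) by simp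
    next
      case 3
      then show ?thesis unfolding 3 Q(3) by simp
    qed
  qed (simp_all add: lessThan_empty_iff)
  also have "\<dots> \<ge> dip_prob"
  proof -
    let ?g = "measure (gauss 1) {3..}"
    have 0: "P.prob {y \<in> space ?P. Q 0 y} \<ge> 3 / 4"
    proof -
      have "1 - q * \<sigma>\<^sup>2 / (2 * s)\<^sup>2 \<le> P.prob {y \<in> space ?P. \<forall>r\<le>q. (\<Sum>i\<in>{q - r..<q}. 1 * y (A + i)) \<le> 2 * s}"
        using I s q by (intro noise_walk_max[OF \<sigma>]) (auto intro!: inj_onI)
      then show ?thesis using s \<sigma> q unfolding Q by (simp add: power_mult_distrib Ball_def)
    qed
    have 3: "P.prob {y \<in> space ?P. Q 3 y} \<ge> 3 / 4"
    proof -
      have "1 - q * \<sigma>\<^sup>2 / (2 * s)\<^sup>2 \<le> P.prob {y \<in> space ?P. \<forall>r\<le>q. (\<Sum>i\<in>{q - r..<q}. (-1) * y (A + 4 * q - 1 - i)) \<le> 2 * s}"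
        using I s q by (intro noise_walk_max[OF \<sigma>]) (auto intro!: inj_onI)
      then show ?thesis using s \<sigma> q unfolding Q by (simp add: power_mult_distrib Ball_def)
    qed
    have D: "distr ?P lborel (\<lambda>y. \<Sum>i\<in>K j. y i) = gauss s"
      and M: "(\<lambda>y. \<Sum>i\<in>K j. y i) \<in> ?P \<rightarrow>\<^sub>M lborel" if "j < 4" for j
    proof -
      have "distributed ?P lborel (\<lambda>y. \<Sum>i\<in>K j. y i) (normal_density 0 (sqrt (card (K j)) * \<sigma>))"
        using q by (intro noise_sum_distributed \<sigma> KI that) (auto simp: K_def)
      then show "distr ?P lborel (\<lambda>y. \<Sum>i\<in>K j. y i) = gauss s" "(\<lambda>y. \<Sum>i\<in>K j. y i) \<in> ?P \<rightarrow>\<^sub>M lborel"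
        by (auto simp: distributed_def gauss_def s_def K_def)
    qed
    have 1: "P.prob {y \<in> space ?P. Q 1 y} = ?g"
    proof -
      have "P.prob {y \<in> space ?P. Q 1 y} = measure (distr ?P lborel (\<lambda>y. \<Sum>i\<in>K 1. y i)) {..- (3 * s)}"
        unfolding Q by (subst measure_distr[OF M]) (auto intro!: arg_cong[where f = P.prob])
      also have "\<dots> = measure (gauss s) {..- (3 * s)}"
        by (subst D) auto
      finally show ?thesis using gauss_tail_scale(2)[OF s(1)] by simp
    qed
    have 2: "P.prob {y \<in> space ?P. Q 2 y} = ?g"
    proof -
      have "P.prob {y \<in> space ?P. Q 2 y} = measure (distr ?P lborel (\<lambda>y. \<Sum>i\<in>K 2. y i)) {3 * s..}"
        unfolding Q by (subst measure_distr[OF M]) (auto intro!: arg_cong[where f = P.prob])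
      also have "\<dots> = measure (gauss s) {3 * s..}"
        by (subst D) auto
      finally show ?thesis using gauss_tail_scale(1)[OF s(1)] by simp
    qed
    have "dip_prob = (3 / 4 * ?g) * (?g * (3 / 4))" by (simp add: dip_prob_def power2_eq_square)
    also have "\<dots> \<le> (P.prob {y \<in> space ?P. Q 0 y} * P.prob {y \<in> space ?P. Q 1 y})
        * (P.prob {y \<in> space ?P. Q 2 y} * P.prob {y \<in> space ?P. Q 3 y})"
      using 0 3 unfolding 1 2 by (intro mult_mono) auto
    also have "\<dots> = (\<Prod>j\<in>{..<4}. P.prob {y \<in> space ?P. Q j y})"
      by (simp add: eval_nat_numeral)
    finally show ?thesis .
  qed
  also have "P.prob {y \<in> space ?P. \<forall>j\<in>{..<4}. Q j y} \<le> P.prob {y \<in> space ?P. block_dip A q s y}"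
  proof (intro P.finite_measure_mono subsetI)
    show "{y \<in> space ?P. block_dip A q s y} \<in> P.events"
      using block_dip_measurable[OF I, of "\<lambda>_. gauss \<sigma>" s] by (simp add: pred_def)
    fix y assume y: "y \<in> {y \<in> space ?P. \<forall>j\<in>{..<4}. Q j y}"
    then have Q': "Q 0 y" "Q 1 y" "Q 2 y" "Q 3 y" by auto
    have K12: "K 1 = {A + q..<A + 2 * q}" "K 2 = {A + 2 * q..<A + 3 * q}"
      by (simp_all add: K_def mult_2)
    have "s \<le> - (\<Sum>i\<in>{A + g..<A + 2 * q}. y i)" if g: "g \<le> q" for g
    proof -
      have "(\<Sum>i\<in>{A + g..<A + 2 * q}. y i) = (\<Sum>i\<in>{A + g..<A + q}. y i) + (\<Sum>i\<in>K 1. y i)"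
        unfolding K12 using g by (subst sum.atLeastLessThan_concat) auto
      also have "(\<Sum>i\<in>{A + g..<A + q}. y i) = (\<Sum>i\<in>{q - (q - g)..<q}. 1 * y (A + i))"
        using g sum.shift_bounds_nat_ivl[of y g A q] by (simp add: add.commute)
      also have "\<dots> \<le> 2 * s" using Q'(1) unfolding Q by simp
      finally show ?thesis using Q'(2) unfolding Q by simp
    qed
    moreover have "s \<le> (\<Sum>i\<in>{A + 2 * q..<A + 3 * q + g}. y i)" if g: "g \<le> q" for g
    proof -
      have "(\<Sum>i\<in>{A + 2 * q..<A + 3 * q + g}. y i) = (\<Sum>i\<in>K 2. y i) + (\<Sum>i\<in>{A + 3 * q..<A + 3 * q + g}. y i)"
        unfolding K12 by (subst sum.atLeastLessThan_concat) auto
      also have "(\<Sum>i\<in>{A + 3 * q..<A + 3 * q + g}. y i) = (\<Sum>i\<in>{q - g..<q}. y (A + 4 * q - 1 - i))"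
        using g by (intro sum.reindex_bij_witness[of _ "\<lambda>i. A + 4 * q - 1 - i" "\<lambda>i. A + 4 * q - 1 - i"]) auto
      finally have "(\<Sum>i\<in>{A + 2 * q..<A + 3 * q + g}. y i) = (\<Sum>i\<in>K 2. y i) + (\<Sum>i\<in>{q - g..<q}. y (A + 4 * q - 1 - i))" .
      moreover have "- (2 * s) \<le> (\<Sum>i\<in>{q - g..<q}. y (A + 4 * q - 1 - i))"
        using Q'(4)[unfolded Q, THEN bspec, of g] g by (simp add: sum_negf)
      ultimately show ?thesis using Q'(3) unfolding Q by simp
    qed
    ultimately show "y \<in> {y \<in> space ?P. block_dip A q s y}"
      using y by (simp add: block_dip_def)
  qed
  finally show ?thesis by (simp add: s_def)
qed

text \<open>The block lengths may differ: the blocks will be cells of several levels, all read on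
  one common grid. The bound depends neither on the lengths nor on \<sigma>, since the required
  depth scales with both.\<close>

lemma no_block_dip_prob:
  assumes \<sigma>: "0 < \<sigma>" and L: "finite L" and q: "\<And>l. l \<in> L \<Longrightarrow> 0 < q l"
    and I: "\<And>l. l \<in> L \<Longrightarrow> {A l..<A l + 4 * q l} \<subseteq> I"
    and disj: "disjoint_family_on (\<lambda>l. {A l..<A l + 4 * q l}) L"
  shows "measure (Pi\<^sub>M I (\<lambda>_. gauss \<sigma>))
      {y \<in> space (Pi\<^sub>M I (\<lambda>_. gauss \<sigma>)). \<forall>l\<in>L. \<not> block_dip (A l) (q l) (sqrt (q l) * \<sigma>) y}
    \<le> (1 - dip_prob) ^ card L"
proof (cases "L = {}")
  case True
  interpret P: prob_space "Pi\<^sub>M I (\<lambda>_. gauss \<sigma>)"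
    using \<sigma> by (intro prob_space_PiM prob_space_gauss)
  show ?thesis using True by simp
next
  case False
  let ?P = "Pi\<^sub>M I (\<lambda>_. gauss \<sigma>)"
  interpret P: prob_space ?P
    using \<sigma> by (intro prob_space_PiM prob_space_gauss)
  let ?dip = "\<lambda>l. block_dip (A l) (q l) (sqrt (q l) * \<sigma>)"
  from False obtain l0 where "l0 \<in> L" by auto
  then have "I \<noteq> {}" using I[of l0] q[of l0] by force
  then have "P.prob {y \<in> space ?P. \<forall>l\<in>L. \<not> ?dip l y} = (\<Prod>l\<in>L. P.prob {y \<in> space ?P. \<not> ?dip l y})"
    using I by (intro noise_blocks_independent[OF \<sigma> L False, where K = "\<lambda>l. {A l..<A l + 4 * q l}"])
      (auto simp: block_dip_restrict intro!: disj pred_intros_logic(2) block_dip_measurable)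
  also have "\<dots> \<le> (\<Prod>l\<in>L. 1 - dip_prob)"
  proof (intro prod_mono conjI measure_nonneg)
    fix l assume l: "l \<in> L"
    have E: "{y \<in> space ?P. ?dip l y} \<in> P.events"
      using block_dip_measurable[OF I[OF l], of "\<lambda>_. gauss \<sigma>"] by (simp add: pred_def)
    have "{y \<in> space ?P. \<not> ?dip l y} = space ?P - {y \<in> space ?P. ?dip l y}" by auto
    then show "P.prob {y \<in> space ?P. \<not> ?dip l y} \<le> 1 - dip_prob"
      using P.prob_compl[OF E] block_dip_prob[OF \<sigma> q[OF l] I[OF l]] by simp
  qed
  finally show ?thesis by simp
qed

section \<open>Passing from grids to paths\<close>

text \<open>An exceptional path is recognised on all grids beyond a level that depends on the path.
  The event is an increasing union of intersections over tails, and each intersection is contained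
  in some \<open>G L\<close> of probability at most c.\<close>

lemma (in prob_space) liminf_event_prob:
  assumes G: "\<And>L. G L \<in> events" and c: "\<And>L. L \<ge> N \<Longrightarrow> prob (G L) \<le> c"
  shows "{\<omega> \<in> space M. \<exists>L0. \<forall>L\<ge>L0. \<omega> \<in> G L} \<in> events"
    "prob {\<omega> \<in> space M. \<exists>L0::nat. \<forall>L\<ge>L0. \<omega> \<in> G L} \<le> c"
proof -
  define V where "V L0 = (\<Inter>L\<in>{L0..}. G L)" for L0
  have V: "V L0 \<in> events" for L0
    unfolding V_def using G by (intro sets.countable_INT') auto
  have eq: "{\<omega> \<in> space M. \<exists>L0. \<forall>L\<ge>L0. \<omega> \<in> G L} = (\<Union>L0. V L0)"
    using sets.sets_into_space[OF G] by (auto simp: V_def)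
  show "{\<omega> \<in> space M. \<exists>L0. \<forall>L\<ge>L0. \<omega> \<in> G L} \<in> events"
    unfolding eq using V by auto
  have "incseq V" by (auto simp: incseq_def V_def)
  then have "(\<lambda>L0. prob (V L0)) \<longlonglongrightarrow> prob (\<Union>L0. V L0)"
    using V by (intro finite_Lim_measure_incseq) auto
  moreover have "prob (V L0) \<le> c" for L0
  proof -
    have "V L0 \<subseteq> G (max L0 N)" by (auto simp: V_def)
    then have "prob (V L0) \<le> prob (G (max L0 N))" using G by (intro finite_measure_mono)
    also have "\<dots> \<le> c" by (rule c) simp
    finally show ?thesis .
  qed
  ultimately show "prob {\<omega> \<in> space M. \<exists>L0. \<forall>L\<ge>L0. \<omega> \<in> G L} \<le> c"
    unfolding eq by (intro LIMSEQ_le_const2) auto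
qed

text \<open>The set where \<open>P\<close> fails need not be an event; it suffices that it is
  covered by each of the events \<open>V n\<close>, whose intersection is null.\<close>

lemma (in prob_space) AE_of_small_exceptional_events:
  fixes V :: "nat \<Rightarrow> 'a set"
  assumes V: "\<And>n. V n \<in> events" and lim: "\<And>n. prob (V n) \<le> c n" "c \<longlonglongrightarrow> 0"
    and P: "\<And>\<omega> n. \<omega> \<in> space M \<Longrightarrow> \<not> P \<omega> \<Longrightarrow> \<omega> \<in> V n"
  shows "AE \<omega> in M. P \<omega>"
proof (rule AE_I)
  show "{\<omega> \<in> space M. \<not> P \<omega>} \<subseteq> (\<Inter>n. V n)" using P by auto
  show "(\<Inter>n. V n) \<in> events" using V by auto
  have "prob (\<Inter>n. V n) \<le> c n" for n
    using V by (intro order_trans[OF finite_measure_mono lim(1)]) auto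
  then have "prob (\<Inter>n. V n) \<le> 0"
    using lim(2) by (intro LIMSEQ_le_const) auto
  then show "emeasure M (\<Inter>n. V n) = 0"
    by (simp add: emeasure_eq_measure measure_le_0_iff)
qed

text \<open>The grid point is t rounded down. Rounding does not leave the interval on the left,
  because for L \<ge> l the left endpoint itself belongs to the grid of level L.\<close>

lemma grid_approximation:
  fixes f :: "real \<Rightarrow> real"
  assumes f: "continuous_on {0..1} f" and j: "j' \<le> 4 ^ l"
    and t: "t \<in> {real j / 4 ^ l..real j' / 4 ^ l}" and \<epsilon>: "0 < \<epsilon>"
  obtains L0 where "l \<le> L0"
    "\<And>L. L0 \<le> L \<Longrightarrow> \<exists>g. j * 4 ^ (L - l) \<le> g \<and> g \<le> j' * 4 ^ (L - l) \<and> \<bar>f (real g / 4 ^ L) - f t\<bar> < \<epsilon>"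
proof -
  have t0: "0 \<le> t" using t by (auto intro: order_trans[rotated])
  have "real j' \<le> 4 ^ l" using j by (metis of_nat_le_iff of_nat_numeral of_nat_power)
  then have "real j' / 4 ^ l \<le> 1" by simp
  moreover have "t \<le> real j' / 4 ^ l" using t by simp
  ultimately have t1: "t \<le> 1" by linarith
  from f t0 t1 \<epsilon> obtain \<delta> where \<delta>: "0 < \<delta>" "\<And>u. u \<in> {0..1} \<Longrightarrow> dist u t < \<delta> \<Longrightarrow> dist (f u) (f t) < \<epsilon>"
    unfolding continuous_on_iff by (metis atLeastAtMost_iff)
  obtain N where N: "1 / (4::real) ^ N < \<delta>"
    using real_arch_pow_inv[of \<delta> "1 / 4"] \<delta>(1) by (auto simp: power_one_over)
  show thesis
  proof (rule that[of "max l N"])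
    fix L assume L: "max l N \<le> L"
    define g where "g = nat \<lfloor>t * 4 ^ L\<rfloor>"
    have g: "real g \<le> t * 4 ^ L" "t * 4 ^ L < real g + 1"
      unfolding g_def using t0 by (simp_all add: of_nat_nat)
    have pw: "(4::real) ^ L = 4 ^ l * 4 ^ (L - l)"
      using L by (simp flip: power_add)
    have "real (j * 4 ^ (L - l)) = (real j / 4 ^ l) * 4 ^ L" by (simp add: pw)
    also have "\<dots> \<le> t * 4 ^ L" using t by (intro mult_right_mono) auto
    finally have "real (j * 4 ^ (L - l)) < real g + 1" using g by linarith
    then have 1: "j * 4 ^ (L - l) \<le> g" by linarith
    have "t * 4 ^ L \<le> (real j' / 4 ^ l) * 4 ^ L" using t by (intro mult_right_mono) auto
    also have "\<dots> = real (j' * 4 ^ (L - l))" by (simp add: pw)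
    finally have 2: "g \<le> j' * 4 ^ (L - l)" using g by linarith
    have "real g / 4 ^ L \<le> t" using g(1) by (simp add: field_simps)
    have "(t * 4 ^ L - real g) / 4 ^ L < 1 / 4 ^ L"
      using g(2) by (intro divide_strict_right_mono) auto
    then have "t - real g / 4 ^ L < 1 / 4 ^ L" by (simp only: diff_divide_distrib) simp
    moreover have "1 / (4::real) ^ L \<le> 1 / 4 ^ N" using L by (simp add: frac_le)
    ultimately have "dist (real g / 4 ^ L) t < \<delta>"
      using N \<open>real g / 4 ^ L \<le> t\<close> by (simp add: dist_real_def)
    moreover have "real g / 4 ^ L \<le> 1" using \<open>real g / 4 ^ L \<le> t\<close> t1 by (rule order_trans)
    then have "real g / 4 ^ L \<in> {0..1}"
      by (simp only: atLeastAtMost_iff simp_thms divide_nonneg_nonneg of_nat_0_le_iff zero_le_power zero_le_numeral)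
    ultimately have "dist (f (real g / 4 ^ L)) (f t) < \<epsilon>" by (intro \<delta>(2))
    with 1 2 show "\<exists>g. j * 4 ^ (L - l) \<le> g \<and> g \<le> j' * 4 ^ (L - l) \<and> \<bar>f (real g / 4 ^ L) - f t\<bar> < \<epsilon>"
      by (auto simp: dist_real_def)
  qed simp
qed

section \<open>Increments on the 4-adic grids\<close>

text \<open>
  The grid of mesh 1 / 4 ^ L on the interval from 1 / 4 ^ m to 1 - 1 / 4 ^ m, away from the
  endpoints of the excursion.
\<close>

definition grid_steps :: "nat \<Rightarrow> nat \<Rightarrow> nat" where
  "grid_steps m L = 4 ^ L - 2 * 4 ^ (L - m)"

definition grid_increments :: "nat \<Rightarrow> nat \<Rightarrow> (real \<Rightarrow> real) \<Rightarrow> nat \<Rightarrow> real" where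
  "grid_increments m L f = (\<lambda>i\<in>{..<grid_steps m L}.
     f (real (4 ^ (L - m) + Suc i) / 4 ^ L) - f (real (4 ^ (L - m) + i) / 4 ^ L))"

lemma grid_steps_last:
  assumes "1 \<le> m" "m \<le> L"
  shows "4 ^ (L - m) + grid_steps m L = 4 ^ L - 4 ^ (L - m)" "2 * 4 ^ (L - m) \<le> (4::nat) ^ L"
proof -
  have "2 * 4 ^ (L - m) \<le> 4 * (4::nat) ^ (L - m)" by simp
  also have "\<dots> = 4 ^ (Suc (L - m))" by simp
  also have "\<dots> \<le> 4 ^ L" using assms by (intro power_increasing) auto
  finally show "2 * 4 ^ (L - m) \<le> (4::nat) ^ L" .
  then show "4 ^ (L - m) + grid_steps m L = 4 ^ L - 4 ^ (L - m)"
    unfolding grid_steps_def by linarith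
qed

lemma sum_grid_increments:
  assumes "a \<le> b" "b \<le> grid_steps m L"
  shows "(\<Sum>i\<in>{a..<b}. grid_increments m L f i)
       = f (real (4 ^ (L - m) + b) / 4 ^ L) - f (real (4 ^ (L - m) + a) / 4 ^ L)"
proof -
  have "(\<Sum>i\<in>{a..<b}. grid_increments m L f i)
     = (\<Sum>i\<in>{a..<b}. f (real (4 ^ (L - m) + Suc i) / 4 ^ L) - f (real (4 ^ (L - m) + i) / 4 ^ L))"
    using assms by (intro sum.cong) (auto simp: grid_increments_def)
  also have "\<dots> = f (real (4 ^ (L - m) + b) / 4 ^ L) - f (real (4 ^ (L - m) + a) / 4 ^ L)"
    using assms by (intro sum_Suc_diff')
  finally show ?thesis .
qed

text \<open>The form of the comparison used from here on: \<open>C\<close> depends on the margin m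
  at the endpoints but not on the level L, and measurability is part of the conclusion because
  events of all levels are later combined into a lower limit.\<close>

lemma grid_increments_bound:
  assumes e: "brownian_excursion M e" and m: "1 \<le> m"
  obtains C where "0 \<le> C"
    "\<And>L (Q :: (nat \<Rightarrow> real) \<Rightarrow> bool). \<lbrakk>m \<le> L; Measurable.pred (Pi\<^sub>M {..<grid_steps m L} (\<lambda>_. borel)) Q\<rbrakk>
      \<Longrightarrow> {\<omega> \<in> space M. Q (grid_increments m L (e \<omega>))} \<in> sets M \<and>
        measure M {\<omega> \<in> space M. Q (grid_increments m L (e \<omega>))}
         \<le> C * measure (Pi\<^sub>M {..<grid_steps m L} (\<lambda>_. gauss (1 / 2 ^ L)))
           {y \<in> space (Pi\<^sub>M {..<grid_steps m L} (\<lambda>_. gauss (1 / 2 ^ L))). Q y}"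
proof -
  have "1 / (4::real) ^ m < 1" using m by (simp add: power_gt1_lemma one_less_power)
  then obtain C where C: "0 \<le> C"
    "\<And>n t d B. \<lbrakk>t 0 = 1 / 4 ^ m; t n = 1 - 1 / 4 ^ m; 0 < d; \<And>i. i < n \<Longrightarrow> t (Suc i) = t i + d;
        B \<in> sets (Pi\<^sub>M {..<n} (\<lambda>_. borel))\<rbrakk>
      \<Longrightarrow> measure M {\<omega>\<in>space M. (\<lambda>i\<in>{..<n}. e \<omega> (t (Suc i)) - e \<omega> (t i)) \<in> B}
         \<le> C * measure (Pi\<^sub>M {..<n} (\<lambda>_. gauss (sqrt d))) B"
    using excursion_increments_bound[OF e, of "1 / 4 ^ m" "1 - 1 / 4 ^ m"] by auto
  show thesis
  proof (rule that[OF C(1)], intro conjI)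
    fix L and Q :: "(nat \<Rightarrow> real) \<Rightarrow> bool"
    assume L: "m \<le> L" and Q: "Measurable.pred (Pi\<^sub>M {..<grid_steps m L} (\<lambda>_. borel)) Q"
    let ?n = "grid_steps m L" and ?t = "\<lambda>i. real (4 ^ (L - m) + i) / 4 ^ L"
    let ?B = "{y \<in> space (Pi\<^sub>M {..<?n} (\<lambda>_. gauss (1 / 2 ^ L))). Q y}"
    have sp: "space (Pi\<^sub>M {..<?n} (\<lambda>_. gauss (1 / 2 ^ L))) = space (Pi\<^sub>M {..<?n} (\<lambda>_. borel))"
      by (simp add: space_PiM)
    have B: "?B \<in> sets (Pi\<^sub>M {..<?n} (\<lambda>_. borel))"
      unfolding sp using Q by (simp add: pred_def)
    have pw: "(4::real) ^ L = 4 ^ m * 4 ^ (L - m)"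
      using L by (simp flip: power_add)
    have t0: "?t 0 = 1 / 4 ^ m" by (simp add: pw)
    have "real (4 ^ (L - m) + ?n) = 4 ^ L - 4 ^ (L - m)"
      unfolding grid_steps_last(1)[OF m L] using grid_steps_last(2)[OF m L] by (simp add: of_nat_diff)
    then have "?t ?n = 1 - 4 ^ (L - m) / 4 ^ L" by (simp only: diff_divide_distrib) simp
    also have "\<dots> = 1 - 1 / 4 ^ m" by (simp add: pw)
    finally have tn: "?t ?n = 1 - 1 / 4 ^ m" .
    have step: "?t (Suc i) = ?t i + 1 / 4 ^ L" for i by (simp add: field_simps)
    have sq: "sqrt (1 / 4 ^ L) = 1 / (2::real) ^ L"
      by (simp add: real_sqrt_divide real_sqrt_power)
    have t01: "?t i \<in> {0..1}" if "i \<le> ?n" for i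
    proof -
      have "4 ^ (L - m) + i \<le> (4::nat) ^ L"
        using that grid_steps_last[OF m L] by linarith
      then have "real (4 ^ (L - m) + i) \<le> 4 ^ L"
        by (metis of_nat_le_iff of_nat_numeral of_nat_power)
      then show ?thesis by simp
    qed
    have em: "(\<lambda>\<omega>. e \<omega> s) \<in> borel_measurable M" if "s \<in> {0..1}" for s
      using e that unfolding brownian_excursion_def by blast
    have inc: "(\<lambda>\<omega>. grid_increments m L (e \<omega>)) \<in> M \<rightarrow>\<^sub>M Pi\<^sub>M {..<?n} (\<lambda>_. borel)"
      unfolding grid_increments_def
      by (intro measurable_restrict borel_measurable_diff em) (use t01 Suc_leI less_imp_le in \<open>blast+\<close>)
    show "{\<omega> \<in> space M. Q (grid_increments m L (e \<omega>))} \<in> sets M"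
      using measurable_compose[OF inc Q] by (simp add: pred_def)
    have "{\<omega> \<in> space M. Q (grid_increments m L (e \<omega>))}
        = {\<omega> \<in> space M. (\<lambda>i\<in>{..<?n}. e \<omega> (?t (Suc i)) - e \<omega> (?t i)) \<in> ?B}"
      by (simp add: grid_increments_def space_PiM)
    then show "measure M {\<omega> \<in> space M. Q (grid_increments m L (e \<omega>))}
         \<le> C * measure (Pi\<^sub>M {..<?n} (\<lambda>_. gauss (1 / 2 ^ L))) ?B"
      using C(2)[OF t0 tn _ step B] by (simp only: sq) simp
  qed
qed

section \<open>Infinitely many dips along a sequence of cells\<close>

text \<open>The points 4k, ..., 4k + 4 of level n + 1 are the quarter points of cell k of level n.
  The height \<open>1 / 2 ^ Suc n\<close> is the Brownian standard deviation over a quarter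
  cell.\<close>

definition path_dip :: "nat \<Rightarrow> nat \<Rightarrow> (real \<Rightarrow> real) \<Rightarrow> bool" where
  "path_dip n k f \<longleftrightarrow>
     (\<forall>t\<in>{real (4 * k) / 4 ^ Suc n..real (4 * k + 1) / 4 ^ Suc n}
          \<union> {real (4 * k + 3) / 4 ^ Suc n..real (4 * k + 4) / 4 ^ Suc n}.
        f (real (4 * k + 2) / 4 ^ Suc n) + 1 / 2 ^ Suc n \<le> f t)"

text \<open>Grid indices are counted from the time \<open>1 / 4 ^ m\<close>, so the left end of cell
  k of level n has the index \<open>k * 4 ^ (L - n) - 4 ^ (L - m)\<close>. The bounds on k keep the
  cell within the margins, so that this subtraction is not truncated and the block ends inside the
  grid.\<close>

lemma block_position:
  assumes m: "1 \<le> m" "m \<le> n" and nL: "Suc n \<le> L"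
    and k: "4 ^ (n - m) \<le> k" "Suc k + 4 ^ (n - m) \<le> 4 ^ n"
  shows "4 * (4::nat) ^ (L - Suc n) = 4 ^ (L - n)"
    "4 ^ (L - m) + (k * 4 ^ (L - n) - 4 ^ (L - m)) = k * 4 ^ (L - n)"
    "k * 4 ^ (L - n) - 4 ^ (L - m) + 4 * 4 ^ (L - Suc n) \<le> grid_steps m L"
proof -
  define q where "q = (4::nat) ^ (L - Suc n)"
  have q4: "4 ^ (L - n) = 4 * q"
    using nL by (simp add: q_def Suc_diff_le flip: power_Suc)
  then show "4 * (4::nat) ^ (L - Suc n) = 4 ^ (L - n)" by (simp add: q_def)
  have qm: "(4::nat) ^ (L - m) = 4 ^ (n - m) * (4 * q)"
    using nL m by (simp flip: power_add q4)
  have qL: "(4::nat) ^ L = 4 ^ n * (4 * q)"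
    using nL by (simp flip: power_add q4)
  have "(4::nat) ^ (L - m) \<le> k * (4 * q)"
    unfolding qm using k(1) by (intro mult_right_mono) auto
  then show A: "4 ^ (L - m) + (k * 4 ^ (L - n) - 4 ^ (L - m)) = k * 4 ^ (L - n)" unfolding q4 by simp
  have "(Suc k + 4 ^ (n - m)) * (4 * q) \<le> 4 ^ n * (4 * q)"
    using k(2) by (intro mult_right_mono) auto
  then show "k * 4 ^ (L - n) - 4 ^ (L - m) + 4 * 4 ^ (L - Suc n) \<le> grid_steps m L"
    using A grid_steps_last[OF m(1), of L] nL m(2) unfolding qL[symmetric] q_def[symmetric] q4
    by (simp add: algebra_simps qm)
qed

text \<open>A path that is not a dip violates a weak inequality at some t in an outer quarter, hence
  by a positive amount. By continuity the violation persists at a grid point of the same quarter for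
  every fine enough L, and the midpoint of the cell is itself a grid point.\<close>

lemma not_path_dip_on_grid:
  fixes f :: "real \<Rightarrow> real"
  assumes f: "continuous_on {0..1} f" and m: "1 \<le> m" "m \<le> n"
    and k: "4 ^ (n - m) \<le> k" "Suc k + 4 ^ (n - m) \<le> 4 ^ n" and "\<not> path_dip n k f"
  obtains L0 where "\<And>L. L0 \<le> L \<Longrightarrow> \<not> block_dip (k * 4 ^ (L - n) - 4 ^ (L - m)) (4 ^ (L - Suc n))
     (1 / 2 ^ Suc n) (grid_increments m L f)"
proof -
  let ?mid = "real (4 * k + 2) / 4 ^ Suc n" and ?h = "1 / (2::real) ^ Suc n"
  from \<open>\<not> path_dip n k f\<close> obtain t where
    t: "t \<in> {real (4 * k) / 4 ^ Suc n..real (4 * k + 1) / 4 ^ Suc n} \<or> t \<in> {real (4 * k + 3) / 4 ^ Suc n..real (4 * k + 4) / 4 ^ Suc n}"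
    and ft: "f t < f ?mid + ?h"
    unfolding path_dip_def by (meson UnE not_le)
  have k4: "4 * k + 4 \<le> 4 ^ Suc n" using k by simp
  from t have "\<exists>j\<in>{4 * k, 4 * k + 3}. t \<in> {real j / 4 ^ Suc n..real (j + 1) / 4 ^ Suc n}"
    by (auto simp: add.commute)
  then obtain j where j: "j = 4 * k \<or> j = 4 * k + 3" and tj: "t \<in> {real j / 4 ^ Suc n..real (j + 1) / 4 ^ Suc n}"
    by blast
  have j4: "j + 1 \<le> 4 ^ Suc n" using j k4 by auto
  from ft have "0 < f ?mid + ?h - f t" by simp
  then obtain L0 where L0: "Suc n \<le> L0"
    and g: "\<And>L. L0 \<le> L \<Longrightarrow> \<exists>g. j * 4 ^ (L - Suc n) \<le> g \<and> g \<le> (j + 1) * 4 ^ (L - Suc n)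
       \<and> \<bar>f (real g / 4 ^ L) - f t\<bar> < f ?mid + ?h - f t"
    by (rule grid_approximation[OF f j4 tj], intro that)
  show thesis
  proof (rule that[of L0])
    fix L assume L: "L0 \<le> L"
    define q where "q = (4::nat) ^ (L - Suc n)"
    define A where "A = k * 4 ^ (L - n) - 4 ^ (L - m)"
    have nL: "Suc n \<le> L" using L L0 by simp
    note pos = block_position[OF m nL k]
    have A: "4 ^ (L - m) + A = k * (4 * q)"
      using pos(2) unfolding A_def q_def pos(1) .
    have An: "A + 4 * q \<le> grid_steps m L"
      using pos(3) unfolding A_def q_def .
    have real_q: "real (j' * q) / 4 ^ L = real j' / 4 ^ Suc n" for j'
    proof -
      have "(4::real) ^ L = 4 ^ (Suc n + (L - Suc n))" using nL by (simp only: le_add_diff_inverse)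
      also have "\<dots> = 4 ^ Suc n * real q"
        unfolding q_def by (simp only: power_add of_nat_power of_nat_numeral)
      finally have "(4::real) ^ L = 4 ^ Suc n * real q" .
      then show ?thesis by (simp add: field_simps) (simp add: q_def)
    qed
    obtain g where g: "j * q \<le> g" "g \<le> (j + 1) * q" "f (real g / 4 ^ L) < f ?mid + ?h"
      using g[OF L] unfolding q_def by (auto simp: abs_if split: if_splits)
    have mid: "?mid = real (4 ^ (L - m) + (A + 2 * q)) / 4 ^ L"
    proof -
      have "4 ^ (L - m) + (A + 2 * q) = (4 * k + 2) * q" using A by (simp add: algebra_simps)
      then show ?thesis by (simp only: real_q)
    qed
    show "\<not> block_dip (k * 4 ^ (L - n) - 4 ^ (L - m)) (4 ^ (L - Suc n)) ?h (grid_increments m L f)"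
      unfolding A_def[symmetric] q_def[symmetric]
    proof
      assume dip: "block_dip A q ?h (grid_increments m L f)"
      from j show False
      proof
        assume "j = 4 * k"
        with g A have *: "4 ^ (L - m) + A \<le> g" "g \<le> 4 ^ (L - m) + A + q" by (simp_all add: algebra_simps)
        define r where "r = g - (4 ^ (L - m) + A)"
        have r: "r \<le> q" "g = 4 ^ (L - m) + (A + r)" using * by (auto simp: r_def)
        from dip r(1) have "?h \<le> - (\<Sum>i\<in>{A + r..<A + 2 * q}. grid_increments m L f i)"
          unfolding block_dip_def by blast
        also have "\<dots> = f (real g / 4 ^ L) - f ?mid"
          unfolding mid using r An by (subst sum_grid_increments) auto
        finally show False using g(3) by simp
      next
        assume "j = 4 * k + 3"
        with g A have *: "4 ^ (L - m) + A + 3 * q \<le> g" "g \<le> 4 ^ (L - m) + A + 4 * q" by (simp_all add: algebra_simps)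
        define r where "r = g - (4 ^ (L - m) + A + 3 * q)"
        have r: "r \<le> q" "g = 4 ^ (L - m) + (A + 3 * q + r)" using * by (auto simp: r_def)
        from dip r(1) have "?h \<le> (\<Sum>i\<in>{A + 2 * q..<A + 3 * q + r}. grid_increments m L f i)"
          unfolding block_dip_def by blast
        also have "\<dots> = f (real g / 4 ^ L) - f ?mid"
          unfolding mid using r An by (subst sum_grid_increments) auto
        finally show False using g(3) by simp
      qed
    qed
  qed
qed

text \<open>By \<open>left\<close>, finer cells end before coarser ones begin, so N consecutive
  levels give N disjoint blocks. On a fine grid they all fail with probability at most
  \<open>C * (1 - dip_prob) ^ N\<close>, and this bound is kept in the limit of fine grids.\<close>

lemma infinitely_many_dips:
  assumes e: "brownian_excursion M e" and m: "1 \<le> m"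
    and k: "\<And>n. m \<le> n \<Longrightarrow> 4 ^ (n - m) \<le> k n" "\<And>n. m \<le> n \<Longrightarrow> Suc (k n) + 4 ^ (n - m) \<le> 4 ^ n"
    and left: "\<And>n n'. m \<le> n \<Longrightarrow> n < n' \<Longrightarrow> Suc (k n') \<le> k n * 4 ^ (n' - n)"
  shows "AE \<omega> in M. \<forall>n0. \<exists>n\<ge>n0. path_dip n (k n) (e \<omega>)"
proof -
  interpret prob_space M using e by (simp add: brownian_excursion_def)
  obtain C where C: "0 \<le> C"
    "\<And>L (Q :: (nat \<Rightarrow> real) \<Rightarrow> bool). \<lbrakk>m \<le> L; Measurable.pred (Pi\<^sub>M {..<grid_steps m L} (\<lambda>_. borel)) Q\<rbrakk>
      \<Longrightarrow> {\<omega> \<in> space M. Q (grid_increments m L (e \<omega>))} \<in> sets M \<and>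
        measure M {\<omega> \<in> space M. Q (grid_increments m L (e \<omega>))}
         \<le> C * measure (Pi\<^sub>M {..<grid_steps m L} (\<lambda>_. gauss (1 / 2 ^ L)))
           {y \<in> space (Pi\<^sub>M {..<grid_steps m L} (\<lambda>_. gauss (1 / 2 ^ L))). Q y}"
    by (rule grid_increments_bound[OF e m], intro that)
  define A where "A L n = k n * 4 ^ (L - n) - 4 ^ (L - m)" for L n
  define q where "q L n = (4::nat) ^ (L - Suc n)" for L n
  define Q where "Q L S y = (\<forall>n\<in>S. \<not> block_dip (A L n) (q L n) (1 / 2 ^ Suc n) y)"
    for L S and y :: "nat \<Rightarrow> real"
  have G: "{\<omega> \<in> space M. Q L S (grid_increments m L (e \<omega>))} \<in> events \<and>
      prob {\<omega> \<in> space M. Q L S (grid_increments m L (e \<omega>))} \<le> C * (1 - dip_prob) ^ card S"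
    if L: "m \<le> L" and S: "finite S" "\<And>n. n \<in> S \<Longrightarrow> m \<le> n \<and> n < L" for L S
  proof -
    let ?I = "{..<grid_steps m L}"
    have q4: "4 * q L n = 4 ^ (L - n)" and A: "4 ^ (L - m) + A L n = k n * 4 ^ (L - n)"
      and An: "A L n + 4 * q L n \<le> grid_steps m L" if "n \<in> S" for n
    proof -
      from S(2)[OF that] have n: "m \<le> n" "Suc n \<le> L" by auto
      from block_position[OF m n k(1)[OF n(1)] k(2)[OF n(1)]]
      show "4 * q L n = 4 ^ (L - n)" "4 ^ (L - m) + A L n = k n * 4 ^ (L - n)"
        "A L n + 4 * q L n \<le> grid_steps m L"
        unfolding q_def A_def .
    qed
    have sub: "{A L n..<A L n + 4 * q L n} \<subseteq> ?I" if "n \<in> S" for n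
      using An[OF that] by auto
    have "Measurable.pred (Pi\<^sub>M ?I (\<lambda>_. borel)) (Q L S)"
      unfolding Q_def using S sub
      by (intro pred_intros_finite(3) pred_intros_logic(2) block_dip_measurable) auto
    note C(2)[OF L this]
    moreover have "measure (Pi\<^sub>M ?I (\<lambda>_. gauss (1 / 2 ^ L))) {y \<in> space (Pi\<^sub>M ?I (\<lambda>_. gauss (1 / 2 ^ L))). Q L S y}
        \<le> (1 - dip_prob) ^ card S"
    proof -
      have h: "sqrt (real (q L n)) * (1 / 2 ^ L) = 1 / 2 ^ Suc n" if "n \<in> S" for n
      proof -
        have "(2::real) ^ L = 2 ^ (Suc n + (L - Suc n))"
          using S(2)[OF that] by (simp only: le_add_diff_inverse Suc_leI)
        then have "(2::real) ^ L = 2 ^ Suc n * 2 ^ (L - Suc n)" by (simp only: power_add)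
        then show ?thesis by (simp add: q_def real_sqrt_power)
      qed
      have "disjoint_family_on (\<lambda>n. {A L n..<A L n + 4 * q L n}) S"
      proof -
        have "A L n' + 4 * q L n' \<le> A L n" if n: "n \<in> S" "n' \<in> S" "n < n'" for n n'
        proof -
          have "4 ^ (L - m) + A L n' + 4 * q L n' = Suc (k n') * 4 ^ (L - n')"
            unfolding q4[OF n(2)] A[OF n(2)] by simp
          also have "\<dots> \<le> (k n * 4 ^ (n' - n)) * 4 ^ (L - n')"
            using S(2)[OF n(1)] n(3) by (intro mult_right_mono left) auto
          also have "\<dots> = k n * 4 ^ (L - n)"
            using S(2)[OF n(2)] n(3) by (simp flip: power_add)
          also have "\<dots> = 4 ^ (L - m) + A L n" using A[OF n(1)] by simp
          finally show ?thesis by simp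
        qed
        note le = this
        have "{A L n..<A L n + 4 * q L n} \<inter> {A L n'..<A L n' + 4 * q L n'} = {}"
          if "n \<in> S" "n' \<in> S" "n \<noteq> n'" for n n'
          using that(3) le[OF that(1,2)] le[OF that(2,1)] by (cases "n < n'") auto
        then show ?thesis unfolding disjoint_family_on_def by blast
      qed
      then have "measure (Pi\<^sub>M ?I (\<lambda>_. gauss (1 / 2 ^ L)))
         {y \<in> space (Pi\<^sub>M ?I (\<lambda>_. gauss (1 / 2 ^ L))). \<forall>n\<in>S. \<not> block_dip (A L n) (q L n) (sqrt (q L n) * (1 / 2 ^ L)) y}
        \<le> (1 - dip_prob) ^ card S"
        using sub by (intro no_block_dip_prob S(1)) (auto simp: q_def)
      then show ?thesis unfolding Q_def using h by (simp cong: ball_cong)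
    qed
    ultimately show ?thesis
      using C(1) by (blast intro: order_trans mult_left_mono)
  qed
  have "AE \<omega> in M. \<exists>n\<ge>n0. path_dip n (k n) (e \<omega>)" if n0: "m \<le> n0" for n0
  proof -
    \<comment> \<open>On grids too coarse to show all N cells the event is set to be empty, which
      makes it measurable for every L and does not affect the lower limit.\<close>
    define GG where "GG N L = (if n0 + N \<le> L then {\<omega> \<in> space M. Q L {n0..<n0 + N} (grid_increments m L (e \<omega>))} else {})"
      for N L
    have GG: "GG N L \<in> events" "n0 + N \<le> L \<Longrightarrow> prob (GG N L) \<le> C * (1 - dip_prob) ^ N" for N L
      using G[of L "{n0..<n0 + N}"] n0 by (auto simp: GG_def)
    show ?thesis
    proof (rule AE_of_small_exceptional_events)
      let ?V = "\<lambda>N. {\<omega> \<in> space M. \<exists>L0. \<forall>L\<ge>L0. \<omega> \<in> GG N L}"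
      show "?V N \<in> events" "prob (?V N) \<le> C * (1 - dip_prob) ^ N" for N
        using liminf_event_prob[of "GG N" "n0 + N", OF GG] by blast+
      show "(\<lambda>N. C * (1 - dip_prob) ^ N) \<longlonglongrightarrow> 0"
        using dip_prob_pos dip_prob_le_1 by (intro tendsto_mult_right_zero LIMSEQ_realpow_zero) auto
      fix \<omega> N assume \<omega>: "\<omega> \<in> space M" and no: "\<not> (\<exists>n\<ge>n0. path_dip n (k n) (e \<omega>))"
      have cont: "continuous_on {0..1} (e \<omega>)" using e \<omega> by (auto simp: brownian_excursion_def)
      have "\<exists>L0. \<forall>L\<ge>L0. \<not> block_dip (A L n) (q L n) (1 / 2 ^ Suc n) (grid_increments m L (e \<omega>))"
        if "n0 \<le> n" for n
      proof -
        have mn: "m \<le> n" using that n0 by simp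
        have "\<not> path_dip n (k n) (e \<omega>)" using no that by blast
        then obtain L0 where "\<And>L. L0 \<le> L \<Longrightarrow> \<not> block_dip (k n * 4 ^ (L - n) - 4 ^ (L - m)) (4 ^ (L - Suc n))
            (1 / 2 ^ Suc n) (grid_increments m L (e \<omega>))"
          by (rule not_path_dip_on_grid[OF cont m mn k(1)[OF mn] k(2)[OF mn]], intro that)
        then show ?thesis unfolding A_def q_def by blast
      qed
      then obtain F where F: "\<And>n L. n0 \<le> n \<Longrightarrow> F n \<le> L \<Longrightarrow>
          \<not> block_dip (A L n) (q L n) (1 / 2 ^ Suc n) (grid_increments m L (e \<omega>))"
        by metis
      \<comment> \<open>Each of the N levels fails from its own grid level on; finitely many of them
        have a common bound.\<close>
      define L0 where "L0 = max (n0 + N) (Max (insert 0 (F ` {n0..<n0 + N})))"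
      have "F n \<le> L0" if "n \<in> {n0..<n0 + N}" for n
        unfolding L0_def using that by (intro max.coboundedI2 Max_ge) auto
      then have "\<omega> \<in> GG N L" if "L0 \<le> L" for L
        using that \<omega> F unfolding GG_def Q_def L0_def by fastforce
      with \<omega> show "\<omega> \<in> ?V N" by blast
    qed
  qed
  then have "AE \<omega> in M. \<forall>n0. \<exists>n\<ge>n0 + m. path_dip n (k n) (e \<omega>)"
    by (simp add: AE_all_countable)
  then show ?thesis
    by eventually_elim (meson le_add1 order_trans)
qed

section \<open>Minima over separated intervals do not tie\<close>

lemma gauss_small_ball:
  assumes s: "0 < s" and \<epsilon>: "0 < \<epsilon>"
  shows "emeasure (gauss s) {z. \<bar>w + z\<bar> < \<epsilon>} \<le> ennreal (2 * \<epsilon> / sqrt (2 * pi * s\<^sup>2))"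
proof -
  have eq: "{z. \<bar>w + z\<bar> < \<epsilon>} = {- w - \<epsilon><..<- w + \<epsilon>}" by auto
  have "emeasure (gauss s) {z. \<bar>w + z\<bar> < \<epsilon>}
      = (\<integral>\<^sup>+z. ennreal (normal_density 0 s z) * indicator {- w - \<epsilon><..<- w + \<epsilon>} z \<partial>lborel)"
    unfolding eq gauss_def by (subst emeasure_density) auto
  also have "\<dots> \<le> (\<integral>\<^sup>+z. ennreal (1 / sqrt (2 * pi * s\<^sup>2)) * indicator {- w - \<epsilon><..<- w + \<epsilon>} z \<partial>lborel)"
  proof (intro nn_integral_mono mult_right_mono ennreal_leI)
    fix z
    have "normal_density 0 s z \<le> 1 / sqrt (2 * pi * s\<^sup>2) * 1"
      unfolding normal_density_def by (intro mult_left_mono) auto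
    then show "normal_density 0 s z \<le> 1 / sqrt (2 * pi * s\<^sup>2)" by simp
  qed simp
  also have "\<dots> = ennreal (1 / sqrt (2 * pi * s\<^sup>2)) * ennreal (2 * \<epsilon>)"
    using \<epsilon> by (subst nn_integral_cmult_indicator) (auto simp: algebra_simps)
  also have "\<dots> = ennreal (2 * \<epsilon> / sqrt (2 * pi * s\<^sup>2))"
    using \<epsilon> by (subst ennreal_mult[symmetric]) auto
  finally show ?thesis .
qed

text \<open>
  The difference of the minima of a walk over the stretches from c to d and from a to b, up to
  the increment over the gap from b to c, which is independent of it.
\<close>

definition min_difference :: "nat \<Rightarrow> nat \<Rightarrow> nat \<Rightarrow> nat \<Rightarrow> (nat \<Rightarrow> real) \<Rightarrow> real" where
  "min_difference a b c d y =
     Min ((\<lambda>g. \<Sum>i\<in>{c..<g}. y i) ` {c..d}) - Min ((\<lambda>g. - (\<Sum>i\<in>{g..<b}. y i)) ` {a..b})"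

lemma min_difference_measurable:
  assumes "{a..<b} \<union> {c..<d} \<subseteq> K"
  shows "min_difference a b c d \<in> borel_measurable (Pi\<^sub>M K (\<lambda>_. borel))"
  unfolding min_difference_def
  by (rule borel_measurable_diff; rule borel_measurable_Min;
      (rule borel_measurable_uminus)?; (rule partial_sum_measurable)?)
     (use assms in \<open>auto simp: subset_iff\<close>)

lemma min_difference_restrict:
  assumes "{a..<b} \<union> {c..<d} \<subseteq> K"
  shows "min_difference a b c d (restrict y K) = min_difference a b c d y"
proof -
  have "(\<Sum>i\<in>{c..<g}. restrict y K i) = (\<Sum>i\<in>{c..<g}. y i)" if "g \<in> {c..d}" for g
    using that assms by (intro sum.cong) (auto simp: subset_iff)
  moreover have "(\<Sum>i\<in>{g..<b}. restrict y K i) = (\<Sum>i\<in>{g..<b}. y i)" if "g \<in> {a..b}" for g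
    using that assms by (intro sum.cong) (auto simp: subset_iff)
  ultimately show ?thesis unfolding min_difference_def
    by (intro arg_cong2[where f = "(-)"] arg_cong[where f = Min] image_cong refl; simp only:)
qed

text \<open>The increment over the gap from b to c is independent of \<open>min_difference\<close>,
  and its density is at most the value at 0. So the sum of both hits an interval of length
  2\<epsilon> with probability at most 2\<epsilon> times that value. The variance
  \<open>(c - b) * \<sigma>^2\<close> is the duration of the gap, which does not change when the
  grid is refined.\<close>

lemma noise_min_difference:
  assumes \<sigma>: "0 < \<sigma>" and \<epsilon>: "0 < \<epsilon>" and o: "b < c" and I: "{a..<d} \<subseteq> I" "a \<le> b" "c \<le> d"
  shows "measure (Pi\<^sub>M I (\<lambda>_. gauss \<sigma>)) {y \<in> space (Pi\<^sub>M I (\<lambda>_. gauss \<sigma>)).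
      \<bar>min_difference a b c d y + (\<Sum>i\<in>{b..<c}. y i)\<bar> < \<epsilon>}
    \<le> 2 * \<epsilon> / sqrt (2 * pi * (real (c - b) * \<sigma>\<^sup>2))"
proof -
  let ?P = "Pi\<^sub>M I (\<lambda>_. gauss \<sigma>)"
  interpret P: prob_space ?P
    using \<sigma> by (intro prob_space_PiM prob_space_gauss)
  define s where "s = sqrt (card {b..<c}) * \<sigma>"
  have s: "0 < s" "s\<^sup>2 = real (c - b) * \<sigma>\<^sup>2" using \<sigma> o by (auto simp: s_def power_mult_distrib)
  let ?K = "{a..<b} \<union> {c..<d}"
  let ?W = "min_difference a b c d" and ?Z = "\<lambda>y. \<Sum>i\<in>{b..<c}. y i :: real"
  have D: "distributed ?P lborel ?Z (normal_density 0 s)"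
    unfolding s_def using o I by (intro noise_sum_distributed \<sigma>) auto
  then have DZ: "distr ?P borel ?Z = gauss s"
    by (auto simp: distributed_def gauss_def cong: distr_cong)
  have ne: "I \<noteq> {}" using I o by force
  have "P.indep_var (Pi\<^sub>M ?K (\<lambda>_. borel)) (\<lambda>y. restrict (\<lambda>i. y i) ?K)
       (Pi\<^sub>M {b..<c} (\<lambda>_. borel)) (\<lambda>y. restrict (\<lambda>i. y i) {b..<c})"
    using o I by (intro P.indep_var_restrict[OF indep_vars_noise[OF \<sigma> ne]]) auto
  from P.indep_var_compose[OF this min_difference_measurable[of a b c d ?K] partial_sum_measurable[of "{b..<c}" "{b..<c}"]]
  have "P.indep_var borel (\<lambda>y. ?W (restrict y ?K)) borel (\<lambda>y. ?Z (restrict y {b..<c}))"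
    by (simp add: comp_def)
  then have ind: "P.indep_var borel ?W borel ?Z"
    by (simp add: min_difference_restrict)
  have [measurable]: "?W \<in> borel_measurable ?P" "?Z \<in> borel_measurable ?P"
    using P.indep_var_rv1[OF ind] P.indep_var_rv2[OF ind] by simp_all
  interpret W: prob_space "distr ?P borel ?W" by (rule P.prob_space_distr) simp
  interpret G: prob_space "gauss s" by (rule prob_space_gauss[OF s(1)])
  let ?S = "{p :: real \<times> real. \<bar>fst p + snd p\<bar> < \<epsilon>}"
  have S: "?S \<in> sets (borel \<Otimes>\<^sub>M borel)"
  proof -
    have "{p \<in> space (borel \<Otimes>\<^sub>M borel). \<bar>fst p + snd p\<bar> < \<epsilon>} \<in> sets (borel \<Otimes>\<^sub>M (borel :: real measure))"
      by measurable
    then show ?thesis by (simp add: space_pair_measure)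
  qed
  have J: "distr ?P borel ?W \<Otimes>\<^sub>M gauss s = distr ?P (borel \<Otimes>\<^sub>M borel) (\<lambda>y. (?W y, ?Z y))"
    using ind unfolding P.indep_var_distribution_eq DZ by blast
  have "emeasure ?P {y \<in> space ?P. \<bar>?W y + ?Z y\<bar> < \<epsilon>}
      = emeasure (distr ?P (borel \<Otimes>\<^sub>M borel) (\<lambda>y. (?W y, ?Z y))) ?S"
    using S by (subst emeasure_distr) (auto intro!: arg_cong[where f = "emeasure ?P"])
  also have "\<dots> = (\<integral>\<^sup>+w. emeasure (gauss s) (Pair w -` ?S) \<partial>distr ?P borel ?W)"
    unfolding J[symmetric]
    using S by (intro G.emeasure_pair_measure_alt) (simp cong: sets_pair_measure_cong)
  also have "\<dots> \<le> (\<integral>\<^sup>+w. ennreal (2 * \<epsilon> / sqrt (2 * pi * s\<^sup>2)) \<partial>distr ?P borel ?W)"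
    using gauss_small_ball[OF s(1) \<epsilon>] by (intro nn_integral_mono) (simp add: vimage_def)
  also have "\<dots> = ennreal (2 * \<epsilon> / sqrt (2 * pi * s\<^sup>2))"
    using W.emeasure_space_1 by simp
  finally show ?thesis
    using \<epsilon> s by (simp add: P.emeasure_eq_measure)
qed

text \<open>A tie forces the two grid minima to agree up to \<epsilon> on every fine grid, an event
  of probability at most a constant times \<epsilon>. The constant contains the duration of the gap
  between the intervals but not the mesh.\<close>

lemma no_equal_minima:
  fixes j1 j2 j3 j4 l :: nat
  assumes e: "brownian_excursion M e" and j: "1 \<le> j1" "j1 \<le> j2" "j2 < j3" "j3 \<le> j4" "j4 < 4 ^ l"
  shows "AE \<omega> in M. \<not> (\<exists>t\<in>{real j1 / 4 ^ l..real j2 / 4 ^ l}. \<exists>t'\<in>{real j3 / 4 ^ l..real j4 / 4 ^ l}.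
      e \<omega> t = e \<omega> t' \<and> (\<forall>u\<in>{real j1 / 4 ^ l..real j4 / 4 ^ l}. e \<omega> t \<le> e \<omega> u))"
proof -
  interpret prob_space M using e by (simp add: brownian_excursion_def)
  have l: "1 \<le> l" using j by (cases l) auto
  obtain C where C: "0 \<le> C"
    "\<And>L (Q :: (nat \<Rightarrow> real) \<Rightarrow> bool). \<lbrakk>l \<le> L; Measurable.pred (Pi\<^sub>M {..<grid_steps l L} (\<lambda>_. borel)) Q\<rbrakk>
      \<Longrightarrow> {\<omega> \<in> space M. Q (grid_increments l L (e \<omega>))} \<in> sets M \<and>
        measure M {\<omega> \<in> space M. Q (grid_increments l L (e \<omega>))}
         \<le> C * measure (Pi\<^sub>M {..<grid_steps l L} (\<lambda>_. gauss (1 / 2 ^ L)))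
           {y \<in> space (Pi\<^sub>M {..<grid_steps l L} (\<lambda>_. gauss (1 / 2 ^ L))). Q y}"
    by (rule grid_increments_bound[OF e l], intro that)
  \<comment> \<open>The grid starts at \<open>1 / 4 ^ l\<close>, hence the index of the point
    \<open>j / 4 ^ l\<close> involves j - 1.\<close>
  define A where "A j L = (j - 1) * 4 ^ (L - l)" for j L :: nat
  have A: "4 ^ (L - l) + A j L = j * 4 ^ (L - l)" if "1 \<le> j" for j L
    using that by (cases j) (auto simp: A_def)
  have A_mono: "A j L \<le> A j' L" if "j \<le> j'" for j j' L
    unfolding A_def using that by (intro mult_right_mono) auto
  have A_less: "A j2 L < A j3 L" for L
    unfolding A_def using j by (intro mult_strict_right_mono) auto
  have A4: "A j4 L \<le> grid_steps l L" if L: "l \<le> L" for L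
  proof -
    have "(j4 + 1) * 4 ^ (L - l) \<le> 4 ^ l * 4 ^ (L - l)" using j by (intro mult_right_mono) auto
    also have "\<dots> = 4 ^ L" using L by (simp flip: power_add)
    finally show ?thesis using A[of j4 L] grid_steps_last[OF l L] j by (simp add: algebra_simps)
  qed
  define D where "D L y = min_difference (A j1 L) (A j2 L) (A j3 L) (A j4 L) y + (\<Sum>i\<in>{A j2 L..<A j3 L}. y i)" for L y
  define c where "c = C * (2 / sqrt (2 * pi * (real (j3 - j2) / 4 ^ l)))"
  have G: "{\<omega> \<in> space M. \<bar>D L (grid_increments l L (e \<omega>))\<bar> < \<epsilon>} \<in> events \<and>
      prob {\<omega> \<in> space M. \<bar>D L (grid_increments l L (e \<omega>))\<bar> < \<epsilon>} \<le> c * \<epsilon>" if L: "l \<le> L" and \<epsilon>: "0 < \<epsilon>" for L \<epsilon>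
  proof -
    let ?I = "{..<grid_steps l L}"
    have "D L \<in> borel_measurable (Pi\<^sub>M ?I (\<lambda>_. borel))"
      unfolding D_def using A4[OF L] A_mono[of j3 j4 L] A_mono[of j1 j2 L] A_less[of L] j
      by (intro borel_measurable_add min_difference_measurable partial_sum_measurable) auto
    then have "Measurable.pred (Pi\<^sub>M ?I (\<lambda>_. borel)) (\<lambda>y. \<bar>D L y\<bar> < \<epsilon>)"
      by measurable
    note p1 = C(2)[OF L this]
    have p2: "measure (Pi\<^sub>M ?I (\<lambda>_. gauss (1 / 2 ^ L))) {y \<in> space (Pi\<^sub>M ?I (\<lambda>_. gauss (1 / 2 ^ L))). \<bar>D L y\<bar> < \<epsilon>}
        \<le> 2 * \<epsilon> / sqrt (2 * pi * (real (A j3 L - A j2 L) * (1 / 2 ^ L)\<^sup>2))"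
      unfolding D_def using A4[OF L] A_mono[of j3 j4 L] A_mono[of j1 j2 L] A_less[of L] j \<epsilon>
      by (intro noise_min_difference) auto
    have eqn: "real (A j3 L - A j2 L) * (1 / 2 ^ L)\<^sup>2 = real (j3 - j2) / 4 ^ l"
    proof -
      have "A j3 L - A j2 L = (j3 - j2) * 4 ^ (L - l)"
        using j by (simp add: A_def flip: diff_mult_distrib)
      moreover have "(1 / (2::real) ^ L)\<^sup>2 = 1 / (4 ^ l * 4 ^ (L - l))"
        using L by (simp add: power_one_over power2_eq_square flip: power_mult_distrib power_add)
      ultimately show ?thesis by simp
    qed
    have "prob {\<omega> \<in> space M. \<bar>D L (grid_increments l L (e \<omega>))\<bar> < \<epsilon>}
        \<le> C * (2 * \<epsilon> / sqrt (2 * pi * (real (j3 - j2) / 4 ^ l)))"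
      by (rule order_trans[OF conjunct2[OF p1] mult_left_mono[OF p2[unfolded eqn] C(1)]])
    moreover have "C * (2 * \<epsilon> / sqrt (2 * pi * (real (j3 - j2) / 4 ^ l))) = c * \<epsilon>" by (simp add: c_def)
    ultimately show ?thesis using conjunct1[OF p1] by simp
  qed
  define GG where "GG N L = (if l \<le> L then {\<omega> \<in> space M. \<bar>D L (grid_increments l L (e \<omega>))\<bar> < 1 / real (Suc N)} else {})"
    for N L
  have GG: "GG N L \<in> events" "l \<le> L \<Longrightarrow> prob (GG N L) \<le> c * (1 / real (Suc N))" for N L
    using G[of L "1 / real (Suc N)"] by (auto simp: GG_def)
  show ?thesis
  proof (rule AE_of_small_exceptional_events)
    let ?V = "\<lambda>N. {\<omega> \<in> space M. \<exists>L0. \<forall>L\<ge>L0. \<omega> \<in> GG N L}"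
    show "?V N \<in> events" "prob (?V N) \<le> c * (1 / real (Suc N))" for N
      using liminf_event_prob[of "GG N" l, OF GG] by blast+
    show "(\<lambda>N. c * (1 / real (Suc N))) \<longlonglongrightarrow> 0"
      using LIMSEQ_inverse_real_of_nat by (intro tendsto_mult_right_zero) (simp add: inverse_eq_divide)
    fix \<omega> N assume \<omega>: "\<omega> \<in> space M" and "\<not> \<not> (\<exists>t\<in>{real j1 / 4 ^ l..real j2 / 4 ^ l}. \<exists>t'\<in>{real j3 / 4 ^ l..real j4 / 4 ^ l}.
      e \<omega> t = e \<omega> t' \<and> (\<forall>u\<in>{real j1 / 4 ^ l..real j4 / 4 ^ l}. e \<omega> t \<le> e \<omega> u))"
    then obtain t t' where t: "t \<in> {real j1 / 4 ^ l..real j2 / 4 ^ l}" "t' \<in> {real j3 / 4 ^ l..real j4 / 4 ^ l}"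
      and eq: "e \<omega> t = e \<omega> t'" and mi: "\<And>u. u \<in> {real j1 / 4 ^ l..real j4 / 4 ^ l} \<Longrightarrow> e \<omega> t \<le> e \<omega> u"
      by blast
    have cont: "continuous_on {0..1} (e \<omega>)" using e \<omega> by (auto simp: brownian_excursion_def)
    let ?\<epsilon> = "1 / real (Suc N)"
    have \<epsilon>: "0 < ?\<epsilon>" by simp
    have j2l: "j2 \<le> 4 ^ l" and j4l: "j4 \<le> 4 ^ l" using j by auto
    obtain L1 where L1: "l \<le> L1" "\<And>L. L1 \<le> L \<Longrightarrow>
        \<exists>g. j1 * 4 ^ (L - l) \<le> g \<and> g \<le> j2 * 4 ^ (L - l) \<and> \<bar>e \<omega> (real g / 4 ^ L) - e \<omega> t\<bar> < ?\<epsilon>"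
      by (rule grid_approximation[OF cont j2l t(1) \<epsilon>], intro that)
    obtain L2 where L2: "l \<le> L2" "\<And>L. L2 \<le> L \<Longrightarrow>
        \<exists>g. j3 * 4 ^ (L - l) \<le> g \<and> g \<le> j4 * 4 ^ (L - l) \<and> \<bar>e \<omega> (real g / 4 ^ L) - e \<omega> t'\<bar> < ?\<epsilon>"
      by (rule grid_approximation[OF cont j4l t(2) \<epsilon>], intro that)
    have "\<omega> \<in> GG N L" if L: "max L1 L2 \<le> L" for L
    proof -
      have lL: "l \<le> L" using L L1 by simp
      define E where "E g = e \<omega> (real (4 ^ (L - l) + g) / 4 ^ L)" for g
      note bounds = A4[OF lL] A_mono[of j3 j4 L] A_mono[of j1 j2 L] A_less[of L] j
      let ?y = "grid_increments l L (e \<omega>)"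
      have pw: "(4::real) ^ L = 4 ^ l * 4 ^ (L - l)" using lL by (simp flip: power_add)
      have low: "e \<omega> t \<le> E g" if "A j1 L \<le> g" "g \<le> A j4 L" for g
      proof -
        have "j1 * 4 ^ (L - l) \<le> 4 ^ (L - l) + g" "4 ^ (L - l) + g \<le> j4 * 4 ^ (L - l)"
          using that A[of j1 L] A[of j4 L] j by linarith+
        then have "real j1 * 4 ^ (L - l) \<le> real (4 ^ (L - l) + g)" "real (4 ^ (L - l) + g) \<le> real j4 * 4 ^ (L - l)"
          by (metis of_nat_le_iff of_nat_mult of_nat_numeral of_nat_power)+
        moreover have "real j1 / 4 ^ l = real j1 * 4 ^ (L - l) / 4 ^ L" "real j4 / 4 ^ l = real j4 * 4 ^ (L - l) / 4 ^ L"
          by (simp_all add: pw)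
        ultimately show ?thesis
          unfolding E_def by (intro mi) (simp only: atLeastAtMost_iff divide_right_mono zero_le_power zero_le_numeral simp_thms)
      qed
      have near: "\<exists>g. A j L \<le> g \<and> g \<le> A j' L \<and> E g < e \<omega> t + ?\<epsilon>"
        if "\<exists>g. j * 4 ^ (L - l) \<le> g \<and> g \<le> j' * 4 ^ (L - l) \<and> \<bar>e \<omega> (real g / 4 ^ L) - e \<omega> t\<bar> < ?\<epsilon>"
          "1 \<le> j" "j \<le> j'" for j j'
      proof -
        from that(1) obtain g where g: "j * 4 ^ (L - l) \<le> g" "g \<le> j' * 4 ^ (L - l)"
          "\<bar>e \<omega> (real g / 4 ^ L) - e \<omega> t\<bar> < ?\<epsilon>" by blast
        have "4 ^ (L - l) + A j L \<le> g" "g \<le> 4 ^ (L - l) + A j' L"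
          using g that A[of j L] A[of j' L] by simp_all
        then have "A j L \<le> g - 4 ^ (L - l)" "g - 4 ^ (L - l) \<le> A j' L" "4 ^ (L - l) + (g - 4 ^ (L - l)) = g"
          by linarith+
        moreover from this(3) g(3) have "E (g - 4 ^ (L - l)) < e \<omega> t + ?\<epsilon>"
          unfolding E_def by simp
        ultimately show ?thesis by blast
      qed
      define U1 where "U1 = Min ((\<lambda>g. - (\<Sum>i\<in>{g..<A j2 L}. ?y i)) ` {A j1 L..A j2 L})"
      define U2 where "U2 = Min ((\<lambda>g. \<Sum>i\<in>{A j3 L..<g}. ?y i) ` {A j3 L..A j4 L})"
      have Z: "(\<Sum>i\<in>{A j2 L..<A j3 L}. ?y i) = E (A j3 L) - E (A j2 L)"
        unfolding E_def using bounds by (intro sum_grid_increments) auto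
      have y1: "- (\<Sum>i\<in>{g..<A j2 L}. ?y i) = E g - E (A j2 L)" if "g \<in> {A j1 L..A j2 L}" for g
        unfolding E_def using bounds that by (subst sum_grid_increments) auto
      have y2: "(\<Sum>i\<in>{A j3 L..<g}. ?y i) = E g - E (A j3 L)" if "g \<in> {A j3 L..A j4 L}" for g
        unfolding E_def using bounds that by (subst sum_grid_increments) auto
      have "U1 \<in> (\<lambda>g. - (\<Sum>i\<in>{g..<A j2 L}. ?y i)) ` {A j1 L..A j2 L}"
        unfolding U1_def using bounds by (intro Min_in) auto
      then obtain g1 where "g1 \<in> {A j1 L..A j2 L}" "U1 = E g1 - E (A j2 L)" using y1 by auto
      then have 1: "e \<omega> t - E (A j2 L) \<le> U1" using low[of g1] bounds by auto
      have "U2 \<in> (\<lambda>g. \<Sum>i\<in>{A j3 L..<g}. ?y i) ` {A j3 L..A j4 L}"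
        unfolding U2_def using bounds by (intro Min_in) auto
      then obtain g2 where "g2 \<in> {A j3 L..A j4 L}" "U2 = E g2 - E (A j3 L)" using y2 by auto
      then have 2: "e \<omega> t - E (A j3 L) \<le> U2" using low[of g2] bounds by auto
      obtain h1 where h1: "A j1 L \<le> h1" "h1 \<le> A j2 L" "E h1 < e \<omega> t + ?\<epsilon>"
        using near[OF L1(2)] L j by auto
      have "U1 \<le> - (\<Sum>i\<in>{h1..<A j2 L}. ?y i)"
        unfolding U1_def using h1 by (intro Min_le) auto
      then have 3: "U1 < e \<omega> t + ?\<epsilon> - E (A j2 L)" using y1[of h1] h1 by auto
      obtain h2 where h2: "A j3 L \<le> h2" "h2 \<le> A j4 L" "E h2 < e \<omega> t + ?\<epsilon>"
        using near[OF L2(2)[folded eq]] L j by auto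
      have "U2 \<le> (\<Sum>i\<in>{A j3 L..<h2}. ?y i)"
        unfolding U2_def using h2 by (intro Min_le) auto
      then have 4: "U2 < e \<omega> t + ?\<epsilon> - E (A j3 L)" using y2[of h2] h2 by auto
      \<comment> \<open>\<open>D\<close> is the difference of the two grid minima of the path. Both
        lie between the value of the tie, which bounds the path from below on the whole span, and
        this value plus 1/(N + 1).\<close>
      have "D L ?y = U2 - U1 + (E (A j3 L) - E (A j2 L))"
        unfolding D_def min_difference_def U1_def U2_def Z by simp
      then have "\<bar>D L ?y\<bar> < ?\<epsilon>" using 1 2 3 4 by linarith
      then show ?thesis unfolding GG_def using lL \<omega> by simp
    qed
    with \<omega> show "\<omega> \<in> ?V N" by blast
  qed
qed

section \<open>Lebesgue density and independent sets\<close>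

text \<open>If I had positive measure, it would lie in an open T only slightly larger. Disjoint
  balls inside T cover almost all of I by Vitali, and I fills at most the fraction c of each, so I
  would have measure at most c times that of T, less than its own. Arbitrarily small radii suffice,
  which fits dips that occur at infinitely many scales but not at all.\<close>

lemma negligible_of_upper_density:
  fixes I G :: "'a::euclidean_space set"
  assumes I: "I \<in> lmeasurable" and c: "0 \<le> c" "c < 1" and G: "negligible (I - G)"
    and dens: "\<And>x d. x \<in> G \<Longrightarrow> 0 < d \<Longrightarrow>
      \<exists>r>0. r < d \<and> measure lebesgue (I \<inter> cball x r) \<le> c * measure lebesgue (cball x r)"
  shows "negligible I"
proof (rule ccontr)
  assume "\<not> negligible I"
  then have pos: "0 < measure lebesgue I"
    using I by (simp add: negligible_iff_measure0 zero_less_measure_iff)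
  \<comment> \<open>With this choice c times the measure of T is less than 1 - (1 - c)^2 times that
    of I, or zero if c = 0; either way it is less than the measure of I.\<close>
  define \<epsilon> where "\<epsilon> = (1 - c) * measure lebesgue I"
  have "0 < \<epsilon>" using pos c by (simp add: \<epsilon>_def)
  with fmeasurableD[OF I] obtain T where T: "open T" "I \<subseteq> T" "T - I \<in> lmeasurable"
    "emeasure lebesgue (T - I) < ennreal \<epsilon>"
    by (rule sets_lebesgue_outer_open)
  have "T = I \<union> (T - I)" using T(2) by auto
  then have Tm: "T \<in> lmeasurable" using I T(3) by (metis fmeasurable.Un)
  have "measure lebesgue (T - I) < \<epsilon>"
    using T(3,4) \<open>0 < \<epsilon>\<close> by (simp add: emeasure_eq_measure2 ennreal_less_iff)
  moreover have "measure lebesgue T \<le> measure lebesgue I + measure lebesgue (T - I)"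
    using \<open>T = I \<union> (T - I)\<close> I T(3) measure_Un_le[of I lebesgue "T - I"] by (simp add: fmeasurableD)
  ultimately have TI: "measure lebesgue T < measure lebesgue I + \<epsilon>" by linarith
  define K where "K = {(x, r). x \<in> G \<inter> I \<and> 0 < r \<and> cball x r \<subseteq> T \<and>
     measure lebesgue (I \<inter> cball x r) \<le> c * measure lebesgue (cball x r)}"
  have cover: "\<exists>i. i \<in> K \<and> x \<in> cball (fst i) (snd i) \<and> snd i < d" if x: "x \<in> G \<inter> I" and d: "0 < d" for x d
  proof -
    from x T obtain \<delta> where \<delta>: "0 < \<delta>" "cball x \<delta> \<subseteq> T" by (metis IntD2 open_contains_cball subsetD)
    from dens[of x "min \<delta> d"] x d \<delta> obtain r where r: "0 < r" "r < min \<delta> d"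
      "measure lebesgue (I \<inter> cball x r) \<le> c * measure lebesgue (cball x r)" by auto
    moreover have "cball x r \<subseteq> T" using \<delta>(2) r(2) by (meson less_imp_le min_less_iff_conj order_trans subset_cball)
    ultimately have "(x, r) \<in> K" using x by (simp add: K_def)
    then show ?thesis using r by (intro exI[of _ "(x, r)"]) auto
  qed
  have KT: "cball (fst i) (snd i) \<subseteq> T" if "i \<in> K" for i using that unfolding K_def by (cases i) simp
  have rpos: "0 < snd i" if "i \<in> K" for i using that by (auto simp: K_def)
  obtain C where C: "countable C" "C \<subseteq> K"
    "pairwise (\<lambda>i j. disjnt (cball (fst i) (snd i)) (cball (fst j) (snd j))) C"
    "negligible (G \<inter> I - (\<Union>i\<in>C. cball (fst i) (snd i)))"
    by (rule Vitali_covering_theorem_cballs[where K = K and r = snd and S = "G \<inter> I" and a = fst];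
        (rule rpos cover that)?; assumption)
  let ?B = "\<lambda>i. cball (fst i) (snd i)"
  have disj: "disjoint_family_on ?B C" "disjoint_family_on (\<lambda>i. I \<inter> ?B i) C"
    using C(3) unfolding pairwise_def disjoint_family_on_def disjnt_def by blast+
  have IB: "I \<inter> ?B i \<in> lmeasurable" for i using I by (intro fmeasurable.Int) auto
  have U: "(\<Union>i\<in>C. I \<inter> ?B i) \<in> sets lebesgue" "(\<Union>i\<in>C. ?B i) \<in> sets lebesgue"
    using C(1) IB by (intro sets.countable_UN'; auto simp: fmeasurableD)+
  have "negligible (I - (\<Union>i\<in>C. I \<inter> ?B i))"
    using negligible_Un[OF G C(4)] by (rule negligible_subset) auto
  then have "emeasure lebesgue (I - (\<Union>i\<in>C. I \<inter> ?B i)) = 0"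
    using negligible_iff_emeasure0[OF sets.Diff[OF fmeasurableD[OF I] U(1)]] by (rule iffD1[rotated])
  moreover have "emeasure lebesgue I \<le> emeasure lebesgue (I - (\<Union>i\<in>C. I \<inter> ?B i)) + emeasure lebesgue (\<Union>i\<in>C. I \<inter> ?B i)"
    using I U by (intro order_trans[OF emeasure_mono emeasure_subadditive]) (auto simp: fmeasurableD)
  ultimately have "emeasure lebesgue I \<le> emeasure lebesgue (\<Union>i\<in>C. I \<inter> ?B i)" by simp
  also have "\<dots> = (\<integral>\<^sup>+i. emeasure lebesgue (I \<inter> ?B i) \<partial>count_space C)"
    using IB by (intro emeasure_UN_countable C disj) (auto simp: fmeasurableD)
  also have "\<dots> \<le> (\<integral>\<^sup>+i. ennreal c * emeasure lebesgue (?B i) \<partial>count_space C)"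
  proof (intro nn_integral_mono)
    fix i assume "i \<in> space (count_space C)"
    then have "measure lebesgue (I \<inter> ?B i) \<le> c * measure lebesgue (?B i)" using C(2) by (auto simp: K_def)
    then have "ennreal (measure lebesgue (I \<inter> ?B i)) \<le> ennreal c * ennreal (measure lebesgue (?B i))"
      using c by (subst ennreal_mult[symmetric]) (auto intro: ennreal_leI)
    then show "emeasure lebesgue (I \<inter> ?B i) \<le> ennreal c * emeasure lebesgue (?B i)"
      using IB[of i] by (simp add: emeasure_eq_measure2 lmeasurable_cball)
  qed
  also have "\<dots> = ennreal c * emeasure lebesgue (\<Union>i\<in>C. ?B i)"
    using C(1) by (subst emeasure_UN_countable[OF _ C(1) disj(1)]) (auto simp: nn_integral_cmult)
  also have "\<dots> \<le> ennreal c * emeasure lebesgue T"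
    using KT C(2) Tm by (intro mult_left_mono emeasure_mono UN_least) (auto simp: fmeasurableD)
  finally have "ennreal (measure lebesgue I) \<le> ennreal (c * measure lebesgue T)"
    using I Tm c by (simp add: emeasure_eq_measure2 ennreal_mult)
  then have "measure lebesgue I \<le> c * measure lebesgue T" using c by (simp add: ennreal_le_iff)
  also have "\<dots> \<le> c * (measure lebesgue I + \<epsilon>)" using TI c by (intro mult_left_mono) auto
  also have "\<dots> = measure lebesgue I - (1 - c) * (1 - c) * measure lebesgue I"
    by (simp add: \<epsilon>_def algebra_simps)
  also have "\<dots> < measure lebesgue I" using pos c by simp
  finally show False by simp
qed

section \<open>The cographon around a decorated dip\<close>

text \<open>\<beta> is a time at which the minimum over the cell is attained. The bounds on k keep
  the cell away from 0 and 1, where neither \<open>local_minima\<close> nor the exclusion of ties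
  applies.\<close>

definition dip_at :: "nat \<Rightarrow> nat \<Rightarrow> (real \<Rightarrow> real) \<Rightarrow> real \<Rightarrow> bool" where
  "dip_at n k f \<beta> \<longleftrightarrow> 1 \<le> k \<and> Suc k < 4 ^ n \<and> path_dip n k f \<and>
     \<beta> \<in> {real k / 4 ^ n..real (Suc k) / 4 ^ n} \<and> (\<forall>t\<in>{real k / 4 ^ n..real (Suc k) / 4 ^ n}. f \<beta> \<le> f t)"

text \<open>Stated with natural numbers only, so that almost sure validity follows from countably
  many instances of \<open>no_equal_minima\<close>.\<close>

definition no_ties :: "(real \<Rightarrow> real) \<Rightarrow> bool" where
  "no_ties f \<longleftrightarrow> (\<forall>l j1 j2 j3 j4. 1 \<le> j1 \<and> j1 \<le> j2 \<and> j2 < j3 \<and> j3 \<le> j4 \<and> j4 < 4 ^ l \<longrightarrow>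
     \<not> (\<exists>t\<in>{real j1 / 4 ^ l..real j2 / 4 ^ l}. \<exists>t'\<in>{real j3 / 4 ^ l..real j4 / 4 ^ l}.
      f t = f t' \<and> (\<forall>u\<in>{real j1 / 4 ^ l..real j4 / 4 ^ l}. f t \<le> f u)))"

text \<open>Two distinct minimisers are separated by a full cell at a sufficiently fine level, where
  \<open>no_ties\<close> forbids them. The right endpoint is excluded so that the fine cell that
  begins at or before t still lies in the given cell.\<close>

lemma no_tiesD:
  assumes "no_ties f" and k: "1 \<le> k" "Suc k < 4 ^ n"
    and t: "t \<in> {real k / 4 ^ n..<real (Suc k) / 4 ^ n}" "t' \<in> {real k / 4 ^ n..<real (Suc k) / 4 ^ n}"
    and eq: "f t = f t'" and mi: "\<And>u. u \<in> {real k / 4 ^ n..real (Suc k) / 4 ^ n} \<Longrightarrow> f t \<le> f u"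
  shows "\<not> t < t'"
proof
  assume less: "t < t'"
  \<comment> \<open>A distance of more than two meshes leaves at least one whole fine cell between
    the cells of t and t'.\<close>
  obtain N where "(1 / 4) ^ N < (t' - t) / 2"
    using real_arch_pow_inv[of "(t' - t) / 2" "1 / 4"] less by auto
  then have N: "1 / (4::real) ^ N < (t' - t) / 2" by (simp add: power_one_over)
  define l where "l = n + N"
  have "1 / (4::real) ^ l \<le> 1 / 4 ^ N" unfolding l_def by (intro divide_left_mono power_increasing) auto
  with N have "1 / 4 ^ l < (t' - t) / 2" by linarith
  then have gap: "2 < (t' - t) * 4 ^ l" by (simp add: field_simps)
  have pw: "(4::real) ^ l = 4 ^ n * 4 ^ N" by (simp add: l_def power_add)
  have fl: "k * 4 ^ N \<le> nat \<lfloor>s * 4 ^ l\<rfloor> \<and> Suc (nat \<lfloor>s * 4 ^ l\<rfloor>) \<le> Suc k * 4 ^ N \<and>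
      real (nat \<lfloor>s * 4 ^ l\<rfloor>) \<le> s * 4 ^ l \<and> s * 4 ^ l < real (Suc (nat \<lfloor>s * 4 ^ l\<rfloor>))"
    if s: "s \<in> {real k / 4 ^ n..<real (Suc k) / 4 ^ n}" for s
  proof -
    have s1: "real k \<le> s * 4 ^ n" "s * 4 ^ n < real (Suc k)" using s by (simp_all add: field_simps)
    have "real k * 4 ^ N \<le> s * 4 ^ l"
      using mult_right_mono[OF s1(1), of "4 ^ N"] by (simp add: pw mult.assoc)
    moreover have "s * 4 ^ l < real (Suc k) * 4 ^ N"
      using mult_strict_right_mono[OF s1(2), of "4 ^ N"] by (simp add: pw mult.assoc)
    moreover have "0 \<le> s * 4 ^ l" using s by (auto intro!: mult_nonneg_nonneg intro: order_trans[rotated])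
    then have "real (nat \<lfloor>s * 4 ^ l\<rfloor>) \<le> s * 4 ^ l" "s * 4 ^ l < real (nat \<lfloor>s * 4 ^ l\<rfloor>) + 1"
      by (simp_all only: of_nat_nat zero_le_floor real_of_int_floor_add_one_gt of_int_floor_le)
    then have g: "real (nat \<lfloor>s * 4 ^ l\<rfloor>) \<le> s * 4 ^ l" "s * 4 ^ l < real (Suc (nat \<lfloor>s * 4 ^ l\<rfloor>))"
      unfolding of_nat_Suc by linarith+
    ultimately have "real (k * 4 ^ N) < real (Suc (nat \<lfloor>s * 4 ^ l\<rfloor>))" "real (nat \<lfloor>s * 4 ^ l\<rfloor>) < real (Suc k * 4 ^ N)"
      by (simp_all only: of_nat_mult of_nat_power of_nat_numeral)
    then have "k * 4 ^ N < Suc (nat \<lfloor>s * 4 ^ l\<rfloor>)" "nat \<lfloor>s * 4 ^ l\<rfloor> < Suc k * 4 ^ N"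
      by (simp_all only: of_nat_less_iff)
    with g show ?thesis by (simp del: of_nat_Suc mult_Suc)
  qed
  define j j' where "j = nat \<lfloor>t * 4 ^ l\<rfloor>" and "j' = nat \<lfloor>t' * 4 ^ l\<rfloor>"
  note f1 = fl[OF t(1), folded j_def] and f2 = fl[OF t(2), folded j'_def]
  have "real (Suc j) < real j'" using f1 f2 gap by (simp add: algebra_simps)
  then have jj: "Suc j < j'" by linarith
  have "1 * 1 \<le> k * 4 ^ N" using k by (intro mult_mono) auto
  then have j1: "1 \<le> j" using f1 by linarith
  have "Suc k * 4 ^ N < 4 ^ n * 4 ^ N" using k by (intro mult_strict_right_mono) auto
  then have j4: "Suc j' < 4 ^ l" using f2 by (simp add: l_def power_add)
  have "real (k * 4 ^ N) \<le> real j" "real (Suc j') \<le> real (Suc k * 4 ^ N)" using f1 f2 by (simp_all only: of_nat_le_iff)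
  then have "real (k * 4 ^ N) / 4 ^ l \<le> real j / 4 ^ l" "real (Suc j') / 4 ^ l \<le> real (Suc k * 4 ^ N) / 4 ^ l"
    by (intro divide_right_mono; simp)+
  then have sub: "{real j / 4 ^ l..real (Suc j') / 4 ^ l} \<subseteq> {real k / 4 ^ n..real (Suc k) / 4 ^ n}"
proof -
    have "real (k * 4 ^ N) / 4 ^ l = real k / 4 ^ n" "real (Suc k * 4 ^ N) / 4 ^ l = real (Suc k) / 4 ^ n"
      unfolding of_nat_mult of_nat_power of_nat_numeral pw by simp_all
    then show ?thesis
      using \<open>real (k * 4 ^ N) / 4 ^ l \<le> real j / 4 ^ l\<close> \<open>real (Suc j') / 4 ^ l \<le> real (Suc k * 4 ^ N) / 4 ^ l\<close>
      by (simp only: atLeastatMost_subset_iff simp_thms)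
  qed
  have tt: "t \<in> {real j / 4 ^ l..real (Suc j) / 4 ^ l}" "t' \<in> {real j' / 4 ^ l..real (Suc j') / 4 ^ l}"
    using f1 f2 by (simp_all add: field_simps)
  have "\<not> (\<exists>t\<in>{real j / 4 ^ l..real (Suc j) / 4 ^ l}. \<exists>t'\<in>{real j' / 4 ^ l..real (Suc j') / 4 ^ l}.
      f t = f t' \<and> (\<forall>u\<in>{real j / 4 ^ l..real (Suc j') / 4 ^ l}. f t \<le> f u))"
    using assms(1) j1 j4 jj unfolding no_ties_def by (metis le_Suc_eq order_refl)
  then show False using tt eq mi sub by blast
qed

lemma AE_not_in_imp_measure_0:
  assumes A: "A \<in> sets lebesgue" and "AE x in lborel. x \<notin> A"
  shows "measure lebesgue A = 0"
proof -
  have "AE x in lebesgue. x \<notin> A" using assms(2) by (rule AE_completion)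
  then have "A \<in> null_sets lebesgue" using A by (simp add: AE_iff_null_sets)
  then show ?thesis by (simp add: measure_eq_0_null_sets)
qed

text \<open>On the outer quarters the path stays strictly above the midpoint value, hence above its
  minimum over the cell. The minimiser \<open>b i\<close> is therefore strictly between x and y, and
  as [x, y] is contained in the cell, it is the only minimiser there as well.\<close>

lemma Dec_at_dip:
  assumes nt: "no_ties f" and b: "inj b" and dip: "dip_at n k f (b i)"
    and x: "x \<in> {real (4 * k) / 4 ^ Suc n..real (4 * k + 1) / 4 ^ Suc n}"
    and y: "y \<in> {real (4 * k + 3) / 4 ^ Suc n..real (4 * k + 4) / 4 ^ Suc n}"
  shows "Dec f b s x y = s i"
proof -
  let ?J = "{real k / 4 ^ n..real (Suc k) / 4 ^ n}"
  let ?out = "{real (4 * k) / 4 ^ Suc n..real (4 * k + 1) / 4 ^ Suc n} \<union> {real (4 * k + 3) / 4 ^ Suc n..real (4 * k + 4) / 4 ^ Suc n}"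
  have ends: "real (4 * k) / 4 ^ Suc n = real k / 4 ^ n" "real (4 * k + 4) / 4 ^ Suc n = real (Suc k) / 4 ^ n"
    by (simp_all add: field_simps)
  have lt: "real (4 * k + 1) / 4 ^ Suc n < real (4 * k + 3) / 4 ^ Suc n"
    "real (4 * k + 2) / 4 ^ Suc n \<in> {real (4 * k) / 4 ^ Suc n..real (4 * k + 4) / 4 ^ Suc n}"
    unfolding atLeastAtMost_iff by (intro conjI divide_strict_right_mono divide_right_mono; simp)+
  from dip have k: "1 \<le> k" "Suc k < 4 ^ n" and pd: "path_dip n k f" and \<beta>: "b i \<in> ?J"
    and mi: "\<And>t. t \<in> ?J \<Longrightarrow> f (b i) \<le> f t" by (auto simp: dip_at_def)
  have midJ: "real (4 * k + 2) / 4 ^ Suc n \<in> ?J" using lt(2) unfolding ends .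
  have out: "t \<notin> ?out" if t: "f t = f (b i)" for t
  proof
    assume "t \<in> ?out"
    then have "f (real (4 * k + 2) / 4 ^ Suc n) + 1 / 2 ^ Suc n \<le> f t" using pd unfolding path_dip_def by blast
    moreover have "0 < 1 / (2::real) ^ Suc n" by simp
    ultimately show False using mi[OF midJ] t by linarith
  qed
  have xy: "x < y" "{x..y} \<subseteq> ?J" using x y lt unfolding ends by auto
  have inner: "t \<in> {real k / 4 ^ n..<real (Suc k) / 4 ^ n} \<and> x < t \<and> t < y" if t: "f t = f (b i)" "t \<in> ?J" for t
    using out[OF t(1)] t(2) x y unfolding ends by (auto simp: not_le)
  have \<beta>xy: "x < b i" "b i < y" using inner[OF refl \<beta>] by auto
  have "argmins f {min x y..max x y} = {b i}"
  proof (intro set_eqI iffI)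
    fix t assume "t \<in> argmins f {min x y..max x y}"
    then have t: "t \<in> {x..y}" "\<And>u. u \<in> {x..y} \<Longrightarrow> \<not> f u < f t"
      using xy by (auto simp: argmins_def is_arg_min_def)
    have tJ: "t \<in> ?J" using t(1) xy by auto
    have eq: "f t = f (b i)" using t(2)[of "b i"] \<beta>xy mi[OF tJ] by auto
    have "\<not> t < b i" using inner[OF eq tJ] inner[OF refl \<beta>] mi eq by (intro no_tiesD[OF nt k]) auto
    moreover have "\<not> b i < t" using inner[OF eq tJ] inner[OF refl \<beta>] mi eq by (intro no_tiesD[OF nt k]) auto
    ultimately show "t \<in> {b i}" by simp
  next
    fix t assume "t \<in> {b i}"
    then show "t \<in> argmins f {min x y..max x y}"
      using xy \<beta>xy mi by (auto simp: argmins_def is_arg_min_def not_less subset_iff)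
  qed
  moreover have "(THE j. b j = b i) = i" using b by (auto simp: inj_eq)
  ultimately show ?thesis
    using \<beta>xy unfolding Dec_def Let_def by (simp add: is_singleton_def)
qed

text \<open>With h the length of the cell, the ball of radius 3h around x contains the cell and has
  length 6h. One of the outer quarters, of length h/4, meets I in a null set, and h/4 is 1/24 of
  6h.\<close>

lemma independent_set_density:
  assumes nt: "no_ties f" and b: "inj b" and I: "independent_set (Dec f b s) I"
    and dip: "dip_at n k f (b i)" and si: "s i \<noteq> 0"
    and x: "real k / 4 ^ n \<in> {x..x + 2 / 4 ^ n}"
  shows "measure lebesgue (I \<inter> cball x (3 / 4 ^ n)) \<le> 23 / 24 * measure lebesgue (cball x (3 / 4 ^ n))"
proof -
  let ?L = "{real (4 * k) / 4 ^ Suc n..real (4 * k + 1) / 4 ^ Suc n}"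
  let ?R = "{real (4 * k + 3) / 4 ^ Suc n..real (4 * k + 4) / 4 ^ Suc n}"
  let ?B = "cball x (3 / 4 ^ n)"
  have Im: "I \<in> sets lebesgue" using I by (simp add: independent_set_def)
  from I have "AE p in lborel \<Otimes>\<^sub>M lborel. fst p \<in> I \<and> snd p \<in> I \<longrightarrow> Dec f b s (fst p) (snd p) = 0"
    unfolding independent_set_def by (simp add: case_prod_unfold)
  \<comment> \<open>If some point of I in the left quarter has a good section, then almost no point
    of the right quarter belongs to I; if no point has one, then almost no point of the left quarter
    belongs to I.\<close>
  from lborel_pair.AE_pair[OF this] have ae: "AE y in lborel. AE z in lborel. y \<in> I \<and> z \<in> I \<longrightarrow> Dec f b s y z = 0"
    by simp
  have null: "measure lebesgue (I \<inter> ?L) = 0 \<or> measure lebesgue (I \<inter> ?R) = 0"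
  proof (cases "\<exists>y\<in>I \<inter> ?L. AE z in lborel. y \<in> I \<and> z \<in> I \<longrightarrow> Dec f b s y z = 0")
    case True
    then obtain y where y: "y \<in> I" "y \<in> ?L" "AE z in lborel. y \<in> I \<and> z \<in> I \<longrightarrow> Dec f b s y z = 0" by blast
    from y(3) have "AE z in lborel. z \<notin> I \<inter> ?R"
    proof eventually_elim
      case (elim z)
      then show ?case using Dec_at_dip[OF nt b dip y(2), of z s] si y(1) by auto
    qed
    then show ?thesis using Im by (intro disjI2 AE_not_in_imp_measure_0) auto
  next
    case False
    from ae have "AE y in lborel. y \<notin> I \<inter> ?L" by eventually_elim (use False in blast)
    then show ?thesis using Im by (intro disjI1 AE_not_in_imp_measure_0) auto
  qed
  define h where "h = 1 / (4::real) ^ n"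
  have h: "0 < h" by (simp add: h_def)
  have ends: "real (4 * k) / 4 ^ Suc n = real k * h" "real (4 * k + 1) / 4 ^ Suc n = real k * h + h / 4"
    "real (4 * k + 3) / 4 ^ Suc n = real k * h + 3 * h / 4" "real (4 * k + 4) / 4 ^ Suc n = real k * h + h"
    by (simp_all add: h_def field_simps)
  have B: "?B = {x - 3 * h..x + 3 * h}" by (simp add: h_def cball_eq_atLeastAtMost)
  have xk: "x \<le> real k * h" "real k * h \<le> x + 2 * h" using x by (simp_all add: h_def)
  have "measure lebesgue (I \<inter> ?B) \<le> 6 * h - h / 4"
    if Z: "measure lebesgue (I \<inter> {u..u + h / 4}) = 0" "{u..u + h / 4} \<subseteq> ?B" for u
  proof -
    have "I \<inter> ?B \<subseteq> (I \<inter> {u..u + h / 4}) \<union> (?B - {u..u + h / 4})" by auto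
    then have "measure lebesgue (I \<inter> ?B) \<le> measure lebesgue ((I \<inter> {u..u + h / 4}) \<union> (?B - {u..u + h / 4}))"
      using Im by (intro measure_mono_fmeasurable) (auto intro!: fmeasurable.Un fmeasurable.Diff fmeasurable_Int_fmeasurable
        simp: Int_commute[of I])
    also have "\<dots> \<le> measure lebesgue (I \<inter> {u..u + h / 4}) + measure lebesgue (?B - {u..u + h / 4})"
      using Im by (intro measure_Un_le) auto
    also have "measure lebesgue (?B - {u..u + h / 4}) = measure lebesgue ?B - measure lebesgue {u..u + h / 4}"
      using Z(2) by (intro measurable_measure_Diff) auto
    also have "\<dots> = 6 * h - h / 4" unfolding B using h by simp
    finally show ?thesis using Z(1) by simp
  qed
  note bound = this
  have "measure lebesgue (I \<inter> ?B) \<le> 6 * h - h / 4"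
    using null
  proof
    assume "measure lebesgue (I \<inter> ?L) = 0"
    then show ?thesis using xk h unfolding ends by (intro bound[of "real k * h"]) (auto simp: B)
  next
    assume "measure lebesgue (I \<inter> ?R) = 0"
    moreover have "real k * h + h = real k * h + 3 * h / 4 + h / 4" by simp
    ultimately show ?thesis using xk h unfolding ends by (intro bound[of "real k * h + 3 * h / 4"]) (auto simp: B)
  qed
  also have "\<dots> = 23 / 24 * measure lebesgue ?B" unfolding B using h by simp
  finally show ?thesis .
qed

text \<open>The deterministic conclusion for one path: infinitely many levels n give arbitrarily
  small radii \<open>3 / 4 ^ n\<close> at almost every point, with the same density bound 23/24 at
  each.\<close>

lemma independence_number_eq_0:
  assumes nt: "no_ties f" and b: "inj b"
    and dips: "AE x::real in lborel. x \<in> {0<..<1} \<longrightarrow> (\<forall>n0. \<exists>n\<ge>n0. \<exists>i. dip_at n (nat \<lfloor>x * 4 ^ n\<rfloor> + 2) f (b i) \<and> s i = 1)"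
  shows "independence_number (Dec f b s) = 0"
proof -
  have "measure lebesgue I = 0" if I: "independent_set (Dec f b s) I" for I
  proof -
    have I01: "I \<in> sets lebesgue" "I \<subseteq> {0..1}" using I by (auto simp: independent_set_def)
    have Il: "I \<in> lmeasurable" using I01 by (rule bounded_set_imp_lmeasurable[rotated, OF _ bounded_subset[OF bounded_closed_interval]])
    define G where "G = {x \<in> {0<..<1::real}. \<forall>n0. \<exists>n\<ge>n0. \<exists>i. dip_at n (nat \<lfloor>x * 4 ^ n\<rfloor> + 2) f (b i) \<and> s i = 1}"
    from dips obtain N where N: "N \<in> null_sets lborel" "{x::real. \<not> (x \<in> {0<..<1} \<longrightarrow> (\<forall>n0. \<exists>n\<ge>n0. \<exists>i. dip_at n (nat \<lfloor>x * 4 ^ n\<rfloor> + 2) f (b i) \<and> s i = 1))} \<subseteq> N"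
      unfolding eventually_ae_filter by auto
    have "negligible N" using N(1) by (simp add: negligible_iff_null_sets null_sets_completionI)
    then have "negligible (N \<union> {0, 1})" by (simp add: negligible_Un)
    moreover have "I - G \<subseteq> N \<union> {0, 1}"
    proof
      fix x assume x: "x \<in> I - G"
      show "x \<in> N \<union> {0, 1}"
      proof (cases "x \<in> {0<..<1}")
        case True
        with x show ?thesis by (intro UnI1 subsetD[OF N(2)]) (simp add: G_def)
      next
        case False
        have "x \<in> {0..1}" using x I01(2) by blast
        with False show ?thesis by auto
      qed
    qed
    ultimately have "negligible (I - G)" by (rule negligible_subset)
    then have "negligible I"
    proof (rule negligible_of_upper_density[OF Il, of "23 / 24", rotated 2])
      fix x d :: real assume x: "x \<in> G" and d: "0 < d"
      obtain n0 where "(1 / 4) ^ n0 < d / 3" using real_arch_pow_inv[of "d / 3" "1 / 4"] d by auto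
      then have n0: "3 / 4 ^ n0 < d" by (simp add: power_one_over field_simps)
      from x obtain n i where n: "n0 \<le> n" "dip_at n (nat \<lfloor>x * 4 ^ n\<rfloor> + 2) f (b i)" "s i = 1"
        unfolding G_def by blast
      have "3 / (4::real) ^ n \<le> 3 / 4 ^ n0" using n(1) by (intro divide_left_mono power_increasing) auto
      then have nd: "3 / 4 ^ n < d" using n0 by linarith
      have "0 \<le> x * 4 ^ n" using x by (simp add: G_def)
      then have "x * 4 ^ n \<le> real (nat \<lfloor>x * 4 ^ n\<rfloor> + 2)" "real (nat \<lfloor>x * 4 ^ n\<rfloor> + 2) \<le> x * 4 ^ n + 2"
        by (simp_all add: of_nat_nat) linarith+
      then have "real (nat \<lfloor>x * 4 ^ n\<rfloor> + 2) / 4 ^ n \<in> {x..x + 2 / 4 ^ n}"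
        by (simp only: atLeastAtMost_iff) (simp add: field_simps)
      with n have "measure lebesgue (I \<inter> cball x (3 / 4 ^ n)) \<le> 23 / 24 * measure lebesgue (cball x (3 / 4 ^ n))"
        by (intro independent_set_density[OF nt b I n(2)]) auto
      then show "\<exists>r>0. r < d \<and> measure lebesgue (I \<inter> cball x r) \<le> 23 / 24 * measure lebesgue (cball x r)"
        using nd by (intro exI[of _ "3 / 4 ^ n"]) auto
    qed auto
    then show ?thesis by (rule negligible_imp_measure0)
  qed
  moreover have "independent_set (Dec f b s) {}" by (simp add: independent_set_def)
  ultimately have "{measure lebesgue I |I. independent_set (Dec f b s) I} = {0}"
    by (auto intro!: exI[of _ "{}"])
  then show ?thesis by (simp add: independence_number_def)
qed

section \<open>Decorations\<close>

text \<open>A continuous path at a random time is the limit of its values at dyadic roundings of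
  that time, which take countably many values. The time is clamped to [0, 1] because nothing is
  known about X outside.\<close>

lemma eval_measurable:
  assumes X: "\<And>t. t \<in> {0..1} \<Longrightarrow> (\<lambda>\<omega>. X \<omega> t) \<in> borel_measurable N"
    and cont: "\<And>\<omega>. \<omega> \<in> space N \<Longrightarrow> continuous_on {0..1::real} (X \<omega>)"
    and \<beta>[measurable]: "\<beta> \<in> borel_measurable N"
  shows "(\<lambda>\<omega>. X \<omega> (max 0 (min 1 (\<beta> \<omega>))) :: real) \<in> borel_measurable N"
proof (rule borel_measurable_LIMSEQ_real)
  let ?c = "\<lambda>r. max 0 (min 1 r) :: real"
  let ?u = "\<lambda>k \<omega>. real_of_int \<lfloor>\<beta> \<omega> * 2 ^ k\<rfloor> / 2 ^ k"
  show "(\<lambda>\<omega>. X \<omega> (?c (?u k \<omega>))) \<in> borel_measurable N" for k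
  proof -
    have "(\<lambda>\<omega>. X \<omega> (?c (real_of_int i / 2 ^ k))) \<in> borel_measurable N" for i
      by (rule X) auto
    moreover have "(\<lambda>\<omega>. \<lfloor>\<beta> \<omega> * 2 ^ k\<rfloor>) \<in> measurable N (count_space UNIV)" by measurable
    ultimately show ?thesis by (rule measurable_compose_countable)
  qed
  fix \<omega> assume \<omega>: "\<omega> \<in> space N"
  have "(\<lambda>k. ?u k \<omega>) \<longlonglongrightarrow> \<beta> \<omega>"
  proof (rule tendsto_sandwich)
    show "\<forall>\<^sub>F k in sequentially. \<beta> \<omega> - (1 / 2) ^ k \<le> ?u k \<omega>"
    proof (intro always_eventually allI)
      fix k
      have "\<beta> \<omega> * 2 ^ k - 1 \<le> real_of_int \<lfloor>\<beta> \<omega> * 2 ^ k\<rfloor>" by linarith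
      then have "(\<beta> \<omega> * 2 ^ k - 1) / 2 ^ k \<le> ?u k \<omega>" by (intro divide_right_mono) auto
      then show "\<beta> \<omega> - (1 / 2) ^ k \<le> ?u k \<omega>" by (simp add: diff_divide_distrib power_one_over)
    qed
    show "\<forall>\<^sub>F k in sequentially. ?u k \<omega> \<le> \<beta> \<omega>"
      by (intro always_eventually allI) (simp add: divide_le_eq)
    have "(\<lambda>k. \<beta> \<omega> - (1 / 2) ^ k) \<longlonglongrightarrow> \<beta> \<omega> - 0"
      by (intro tendsto_intros LIMSEQ_realpow_zero) auto
    then show "(\<lambda>k. \<beta> \<omega> - (1 / 2) ^ k) \<longlonglongrightarrow> \<beta> \<omega>" by simp
  qed simp
  then have "(\<lambda>k. ?c (?u k \<omega>)) \<longlonglongrightarrow> ?c (\<beta> \<omega>)"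
    by (intro tendsto_max tendsto_min tendsto_const)
  then show "(\<lambda>k. X \<omega> (?c (?u k \<omega>))) \<longlonglongrightarrow> X \<omega> (?c (\<beta> \<omega>))"
    by (rule continuous_on_tendsto_compose[OF cont[OF \<omega>]]) auto
qed

text \<open>By continuity the rational times in the open interval decide, since they are dense in
  the closed one.\<close>

lemma ge_on_interval_measurable:
  assumes X: "\<And>t. t \<in> {0..1} \<Longrightarrow> (\<lambda>\<omega>. X \<omega> t) \<in> borel_measurable N"
    and cont: "\<And>\<omega>. \<omega> \<in> space N \<Longrightarrow> continuous_on {0..1::real} (X \<omega>)"
    and Y: "Y \<in> borel_measurable N" and ab: "0 \<le> u" "u < v" "v \<le> 1"
  shows "{\<omega> \<in> space N. \<forall>t\<in>{u..v}. Y \<omega> \<le> (X \<omega> t :: real)} \<in> sets N"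
proof -
  let ?Q = "{u<..<v} \<inter> \<rat>"
  have "closure ?Q = {u..v}"
  proof
    have "closure ?Q \<subseteq> closure {u<..<v}" by (intro closure_mono) auto
    then show "closure ?Q \<subseteq> {u..v}" using ab by simp
    have "{u<..<v} \<inter> closure \<rat> \<subseteq> closure ?Q" by (intro open_Int_closure_subset) auto
    then have "{u<..<v} \<subseteq> closure ?Q" by (simp add: Rats_closure_real)
    then have "closure {u<..<v} \<subseteq> closure ?Q" by (intro closure_minimal) auto
    then show "{u..v} \<subseteq> closure ?Q" using ab by simp
  qed
  have eq: "(\<forall>t\<in>{u..v}. Y \<omega> \<le> X \<omega> t) \<longleftrightarrow> (\<forall>t\<in>?Q. Y \<omega> \<le> X \<omega> t)" if \<omega>: "\<omega> \<in> space N" for \<omega>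
  proof
    assume ge: "\<forall>t\<in>?Q. Y \<omega> \<le> X \<omega> t"
    have "continuous_on (closure ?Q) (X \<omega>)"
      unfolding \<open>closure ?Q = {u..v}\<close> using ab by (intro continuous_on_subset[OF cont[OF \<omega>]]) auto
    from continuous_ge_on_closure[OF this] ge
    show "\<forall>t\<in>{u..v}. Y \<omega> \<le> X \<omega> t" unfolding \<open>closure ?Q = {u..v}\<close> by blast
  qed auto
  have "{\<omega> \<in> space N. Y \<omega> \<le> X \<omega> t} \<in> sets N" if "t \<in> ?Q" for t
    using that ab by (intro borel_measurable_le Y X) auto
  then have "{\<omega> \<in> space N. \<forall>t\<in>?Q. Y \<omega> \<le> X \<omega> t} \<in> sets N"
    by (intro sets.sets_Collect_countable_All' countable_Int2 countable_rat)
  also have "{\<omega> \<in> space N. \<forall>t\<in>?Q. Y \<omega> \<le> X \<omega> t} = {\<omega> \<in> space N. \<forall>t\<in>{u..v}. Y \<omega> \<le> X \<omega> t}"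
    using eq by blast
  finally show ?thesis .
qed

lemma dip_at_measurable:
  assumes X: "\<And>t. t \<in> {0..1} \<Longrightarrow> (\<lambda>\<omega>. X \<omega> t) \<in> borel_measurable N"
    and cont: "\<And>\<omega>. \<omega> \<in> space N \<Longrightarrow> continuous_on {0..1::real} (X \<omega>)"
    and \<beta>[measurable]: "\<beta> \<in> borel_measurable N"
  shows "Measurable.pred N (\<lambda>\<omega>. dip_at n k (X \<omega>) (\<beta> \<omega>))"
proof (cases "1 \<le> k \<and> Suc k < 4 ^ n")
  case False
  then have "(\<lambda>\<omega>. dip_at n k (X \<omega>) (\<beta> \<omega>)) = (\<lambda>_. False)"
    unfolding dip_at_def by blast
  then show ?thesis by simp
next
  case True
  define J where "J = {real k / 4 ^ n..real (Suc k) / 4 ^ n}"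
  \<comment> \<open>Clamping does not alter \<beta> inside the cell, and outside it the predicate is
    false anyway.\<close>
  define c where "c \<omega> = max 0 (min 1 (\<beta> \<omega>))" for \<omega>
  have "real (4 * k + 4) < real (4 ^ Suc n)"
    unfolding of_nat_less_iff using True by simp
  then have k4: "real (4 * k + 4) < 4 ^ Suc n"
    by (simp only: of_nat_power of_nat_numeral)
  have in01: "0 \<le> real (4 * k + i) / 4 ^ Suc n" "i \<le> 4 \<Longrightarrow> real (4 * k + i) / 4 ^ Suc n \<le> 1"
    "i < i' \<Longrightarrow> real (4 * k + i) / 4 ^ Suc n < real (4 * k + i') / 4 ^ Suc n" for i i'
    using k4 by (auto intro!: divide_strict_right_mono simp: divide_le_eq simp del: power_Suc)
  have J: "J = {real (4 * k) / 4 ^ Suc n..real (4 * k + 4) / 4 ^ Suc n}"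
    by (simp add: J_def field_simps)
  have J01: "J \<subseteq> {0..1}"
    unfolding J using in01(1)[of 0] in01(2)[of 4] by auto
  let ?mid = "\<lambda>\<omega>. X \<omega> (real (4 * k + 2) / 4 ^ Suc n) + 1 / 2 ^ Suc n"
  have mid: "?mid \<in> borel_measurable N"
    using in01(1,2)[of 2] by (intro borel_measurable_add X) auto
  have L: "{\<omega> \<in> space N. \<forall>t\<in>{real (4 * k + 0) / 4 ^ Suc n..real (4 * k + 1) / 4 ^ Suc n}. ?mid \<omega> \<le> X \<omega> t} \<in> sets N"
    by (intro ge_on_interval_measurable[OF X cont mid] in01) auto
  have R: "{\<omega> \<in> space N. \<forall>t\<in>{real (4 * k + 3) / 4 ^ Suc n..real (4 * k + 4) / 4 ^ Suc n}. ?mid \<omega> \<le> X \<omega> t} \<in> sets N"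
    by (intro ge_on_interval_measurable[OF X cont mid] in01) auto
  have A: "{\<omega> \<in> space N. \<forall>t\<in>{real (4 * k + 0) / 4 ^ Suc n..real (4 * k + 4) / 4 ^ Suc n}. X \<omega> (c \<omega>) \<le> X \<omega> t} \<in> sets N"
    unfolding c_def by (intro ge_on_interval_measurable[OF X cont eval_measurable[OF X cont \<beta>]] in01) auto
  have B: "{\<omega> \<in> space N. \<beta> \<omega> \<in> J} \<in> sets N"
    unfolding J_def by measurable
  have cJ: "c \<omega> = \<beta> \<omega>" if "\<beta> \<omega> \<in> J" for \<omega>
    using that J01 by (auto simp: c_def)
  have "dip_at n k (X \<omega>) (\<beta> \<omega>) \<longleftrightarrow>
      ((\<forall>t\<in>{real (4 * k + 0) / 4 ^ Suc n..real (4 * k + 1) / 4 ^ Suc n}. ?mid \<omega> \<le> X \<omega> t) \<and>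
      (\<forall>t\<in>{real (4 * k + 3) / 4 ^ Suc n..real (4 * k + 4) / 4 ^ Suc n}. ?mid \<omega> \<le> X \<omega> t)) \<and> (\<beta> \<omega> \<in> J \<and>
      (\<forall>t\<in>{real (4 * k + 0) / 4 ^ Suc n..real (4 * k + 4) / 4 ^ Suc n}. X \<omega> (c \<omega>) \<le> X \<omega> t))" for \<omega>
    unfolding dip_at_def path_dip_def add_0_right J[symmetric] J_def[symmetric] ball_Un
    using True cJ[of \<omega>] by auto
  then show ?thesis
    unfolding pred_def using L R A B by (simp only:) (intro sets.sets_Collect_conj)
qed

section \<open>Independence of the decorations from the path\<close>

lemma space_path_algebra [simp]: "space (path_algebra M e) = space M"
  by (simp add: path_algebra_def)

lemma measurable_path_algebra:
  assumes "t \<in> {0..1}"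
  shows "(\<lambda>\<omega>. e \<omega> t) \<in> borel_measurable (path_algebra M e)"
proof -
  have "(\<lambda>\<omega>. restrict (e \<omega>) {0..1}) \<in> path_algebra M e \<rightarrow>\<^sub>M Pi\<^sub>M {0..1} (\<lambda>_. borel)"
    unfolding path_algebra_def by (intro measurable_vimage_algebra1) (auto simp: space_PiM)
  from measurable_compose[OF this measurable_component_singleton[OF assms]] assms
  show ?thesis by simp
qed

lemma sets_path_algebra_subset:
  assumes "brownian_excursion M e"
  shows "sets (path_algebra M e) \<subseteq> sets M"
proof -
  have "(\<lambda>\<omega>. restrict (e \<omega>) {0..1}) \<in> M \<rightarrow>\<^sub>M Pi\<^sub>M {0..1} (\<lambda>_. borel)"
    using assms by (intro measurable_restrict) (auto simp: brownian_excursion_def)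
  then show ?thesis
    unfolding path_algebra_def by (subst sets_vimage_algebra2) (auto simp: space_PiM measurable_sets)
qed

lemma (in prob_space) decorated_in_infinite_set:
  assumes s: "indep_vars (\<lambda>_. borel) s UNIV" "\<And>i \<omega>. \<omega> \<in> space M \<Longrightarrow> s i \<omega> \<in> {0, 1::real}"
    "\<And>i::nat. prob {\<omega> \<in> space M. s i \<omega> = 0} = p" and p: "0 \<le> p" "p < 1" and J: "infinite J"
  shows "AE \<omega> in M. \<exists>i\<in>J. s i \<omega> = 1"
proof -
  obtain F where F: "\<And>n::nat. finite (F n) \<and> card (F n) = n \<and> F n \<subseteq> J"
    using infinite_arbitrarily_large[OF J] by metis
  have m: "s i \<in> borel_measurable M" for i using s(1) by (simp add: indep_vars_def)
  show ?thesis
  proof (rule AE_of_small_exceptional_events)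
    let ?V = "\<lambda>n. {\<omega> \<in> space M. \<forall>i\<in>F n. s i \<omega> = 0}"
    show "?V n \<in> events" for n
      using F[of n] m by (intro sets.sets_Collect_finite_All) auto
    show "prob (?V n) \<le> p ^ n" for n
    proof (cases "n = 0")
      case False
      then have ne: "F n \<noteq> {}" using F[of n] by auto
      have "prob (\<Inter>i\<in>F n. s i -` {0} \<inter> space M) = (\<Prod>i\<in>F n. prob (s i -` {0} \<inter> space M))"
        using F[of n] ne by (intro indep_varsD[OF s(1)]) auto
      moreover have "(\<Inter>i\<in>F n. s i -` {0} \<inter> space M) = ?V n" using ne by auto
      moreover have "prob (s i -` {0} \<inter> space M) = p" for i
      proof -
        have "s i -` {0} \<inter> space M = {\<omega> \<in> space M. s i \<omega> = 0}" by auto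
        then show ?thesis using s(3)[of i] by simp
      qed
      ultimately show ?thesis using F[of n] by simp
    qed simp
    show "(\<lambda>n. p ^ n) \<longlonglongrightarrow> 0" using p by (intro LIMSEQ_realpow_zero)
    fix \<omega> n assume "\<omega> \<in> space M" "\<not> (\<exists>i\<in>J. s i \<omega> = 1)"
    then show "\<omega> \<in> ?V n" using s(2)[of \<omega>] F[of n] by blast
  qed
qed

text \<open>The set of indices i with \<omega> in \<open>H i\<close> is random but determined by the
  path. By independence, path and decorations have a product law, so the path may be frozen; the
  index set is then a fixed infinite set and \<open>decorated_in_infinite_set\<close>
  applies.\<close>

lemma decorated_index:
  assumes e: "brownian_excursion M e" and s: "decorations M e p s" and p: "0 \<le> p" "p < 1"
    and H: "\<And>i. H i \<in> sets (path_algebra M e)" and inf: "AE \<omega> in M. infinite {i. \<omega> \<in> H i}"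
  shows "AE \<omega> in M. \<exists>i. \<omega> \<in> H i \<and> s i \<omega> = 1"
proof -
  interpret prob_space M using e by (simp add: brownian_excursion_def)
  let ?F = "path_algebra M e" and ?P = "Pi\<^sub>M UNIV (\<lambda>_::nat. borel :: real measure)"
  let ?S = "\<lambda>\<omega> i. s i \<omega>"
  from s have s': "indep_vars (\<lambda>_. borel) s UNIV" "\<And>i \<omega>. \<omega> \<in> space M \<Longrightarrow> s i \<omega> \<in> {0, 1}"
    "\<And>i. prob {\<omega> \<in> space M. s i \<omega> = 0} = p"
    and ind: "indep_set (sets ?F) (sets (sequence_algebra M s))"
    by (auto simp: decorations_def)
  \<comment> \<open>The identity into the coarser \<sigma>-algebra plays the role of the path as a
    random variable, so that events of \<open>path_algebra\<close> can be used directly without a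
    space of paths.\<close>
  have id: "(\<lambda>\<omega>. \<omega>) \<in> M \<rightarrow>\<^sub>M ?F"
    using sets_path_algebra_subset[OF e] by (intro measurableI) (auto dest: sets.sets_into_space simp: Int_absorb2)
  have m: "s i \<in> borel_measurable M" for i using s'(1) by (simp add: indep_vars_def)
  have S: "?S \<in> M \<rightarrow>\<^sub>M ?P"
    by (intro measurable_PiM_single') (auto simp: m)
  interpret E: prob_space "distr M ?F (\<lambda>\<omega>. \<omega>)" by (rule prob_space_distr[OF id])
  interpret T: prob_space "distr M ?P ?S" by (rule prob_space_distr[OF S])
  have D: "distr M ?F (\<lambda>\<omega>. \<omega>) \<Otimes>\<^sub>M distr M ?P ?S = distr M (?F \<Otimes>\<^sub>M ?P) (\<lambda>\<omega>. (\<omega>, ?S \<omega>))"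
  proof (rule pair_measure_eqI)
    fix A B assume "A \<in> sets (distr M ?F (\<lambda>\<omega>. \<omega>))" "B \<in> sets (distr M ?P ?S)"
    then have A: "A \<in> sets ?F" and B: "B \<in> sets ?P" by simp_all
    have AM: "A \<subseteq> space M" using sets.sets_into_space[OF A] by simp
    have "?S -` B \<inter> space M \<in> sets (sequence_algebra M s)"
      unfolding sequence_algebra_def using B by (intro in_vimage_algebra)
    with ind A have "prob (A \<inter> (?S -` B \<inter> space M)) = prob A * prob (?S -` B \<inter> space M)"
      unfolding indep_sets2_eq by blast
    moreover have "(\<lambda>\<omega>. (\<omega>, ?S \<omega>)) -` (A \<times> B) \<inter> space M = A \<inter> (?S -` B \<inter> space M)"
      "(\<lambda>\<omega>. \<omega>) -` A \<inter> space M = A" using AM by auto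
    ultimately show "emeasure (distr M ?F (\<lambda>\<omega>. \<omega>)) A * emeasure (distr M ?P ?S) B
        = emeasure (distr M (?F \<Otimes>\<^sub>M ?P) (\<lambda>\<omega>. (\<omega>, ?S \<omega>))) (A \<times> B)"
      using A B by (simp add: emeasure_distr id S measurable_Pair emeasure_eq_measure ennreal_mult)
  qed (simp_all add: E.sigma_finite_measure_axioms T.sigma_finite_measure_axioms cong: sets_pair_measure_cong)
  interpret ET: pair_sigma_finite "distr M ?F (\<lambda>\<omega>. \<omega>)" "distr M ?P ?S" ..
  define G where "G p \<longleftrightarrow> (\<exists>i. fst p \<in> H i \<and> snd p i = 1)" for p :: "'a \<times> (nat \<Rightarrow> real)"
  have G: "Measurable.pred (?F \<Otimes>\<^sub>M ?P) G"
  proof -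
    have [measurable]: "Measurable.pred ?F (\<lambda>\<omega>. \<omega> \<in> H i)" for i
      using H by simp
    show ?thesis unfolding G_def by measurable
  qed
  have Gi: "Measurable.pred ?P (\<lambda>\<sigma>. \<exists>i\<in>J. \<sigma> i = 1)" for J :: "nat set" by measurable
  have "AE \<omega> in distr M ?F (\<lambda>\<omega>. \<omega>). infinite {i. \<omega> \<in> H i}"
  proof -
    have [measurable]: "Measurable.pred ?F (\<lambda>\<omega>. \<omega> \<in> H i)" for i
      using H by simp
    have "Measurable.pred ?F (\<lambda>\<omega>. \<forall>n. \<exists>i\<in>{n..}. \<omega> \<in> H i)"
      by measurable
    then have "{\<omega> \<in> space ?F. infinite {i. \<omega> \<in> H i}} \<in> sets ?F"
      unfolding pred_def infinite_nat_iff_unbounded_le by (simp only: Bex_def atLeast_iff mem_Collect_eq)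
    then show ?thesis using inf by (subst AE_distr_iff[OF id]) auto
  qed
  then have "AE \<omega> in distr M ?F (\<lambda>\<omega>. \<omega>). AE \<sigma> in distr M ?P ?S. G (\<omega>, \<sigma>)"
  proof eventually_elim
    case (elim \<omega>)
    have "AE \<omega>' in M. \<exists>i\<in>{i. \<omega> \<in> H i}. s i \<omega>' = 1"
      by (rule decorated_in_infinite_set[OF s' p elim])
    then have "AE \<sigma> in distr M ?P ?S. \<exists>i\<in>{i. \<omega> \<in> H i}. \<sigma> i = 1"
      using Gi by (subst AE_distr_iff[OF S]) (auto simp: pred_def)
    then show ?case by (simp add: G_def)
  qed
  then have "AE q in distr M ?F (\<lambda>\<omega>. \<omega>) \<Otimes>\<^sub>M distr M ?P ?S. G q"
    using G by (intro ET.AE_pair_measure) (simp_all add: pred_def space_pair_measure cong: sets_pair_measure_cong)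
  then have "AE \<omega> in M. G (\<omega>, ?S \<omega>)"
    unfolding D using G measurable_Pair[OF id S] by (subst (asm) AE_distr_iff) (auto simp: pred_def)
  then show ?thesis by (simp add: G_def)
qed

section \<open>From dips to indices, and from points to paths\<close>

text \<open>A minimiser over the cell exists by compactness and avoids the outer quarters, so it is
  interior to the cell. It is therefore a local minimum and occurs in the enumeration.\<close>

lemma path_dip_imp_dip_at:
  assumes f: "continuous_on {0..1} f" and b: "bij_betw b UNIV (local_minima f)"
    and k: "1 \<le> k" "Suc k < 4 ^ n" and pd: "path_dip n k f"
  shows "\<exists>i. dip_at n k f (b i)"
proof -
  let ?J = "{real k / 4 ^ n..real (Suc k) / 4 ^ n}"
  have "real (Suc k) < real (4 ^ n)" unfolding of_nat_less_iff by (rule k)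
  then have k4: "real (Suc k) / 4 ^ n < 1" by simp
  have k0: "0 < real k / 4 ^ n" using k by simp
  have kk: "real k / 4 ^ n \<le> real (Suc k) / 4 ^ n" by (intro divide_right_mono) auto
  have J01: "?J \<subseteq> {0..1}" using k4 k0 by auto
  obtain \<beta> where \<beta>: "\<beta> \<in> ?J" "\<And>t. t \<in> ?J \<Longrightarrow> f \<beta> \<le> f t"
    using continuous_attains_inf[of ?J f] continuous_on_subset[OF f J01] kk by auto
  have ends: "real (4 * k) / 4 ^ Suc n = real k / 4 ^ n" "real (4 * k + 4) / 4 ^ Suc n = real (Suc k) / 4 ^ n"
    by (simp_all add: field_simps)
  have mid: "real (4 * k + 2) / 4 ^ Suc n \<in> ?J"
    unfolding ends[symmetric] atLeastAtMost_iff by (intro conjI divide_right_mono; simp)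
  have "f \<beta> < f t" if "t \<in> {real (4 * k) / 4 ^ Suc n..real (4 * k + 1) / 4 ^ Suc n}
          \<union> {real (4 * k + 3) / 4 ^ Suc n..real (4 * k + 4) / 4 ^ Suc n}" for t
  proof -
    have "f (real (4 * k + 2) / 4 ^ Suc n) + 1 / 2 ^ Suc n \<le> f t" using pd that unfolding path_dip_def by blast
    moreover have "0 < 1 / (2::real) ^ Suc n" by simp
    ultimately show ?thesis using \<beta>(2)[OF mid] by linarith
  qed
  moreover have "real (4 * k) / 4 ^ Suc n \<in> {real (4 * k) / 4 ^ Suc n..real (4 * k + 1) / 4 ^ Suc n}"
    "real (4 * k + 4) / 4 ^ Suc n \<in> {real (4 * k + 3) / 4 ^ Suc n..real (4 * k + 4) / 4 ^ Suc n}"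
    unfolding atLeastAtMost_iff by (intro conjI divide_right_mono; simp)+
  ultimately have "\<beta> \<noteq> real k / 4 ^ n" "\<beta> \<noteq> real (Suc k) / 4 ^ n"
    unfolding ends[symmetric] by blast+
  with \<beta>(1) have \<beta>': "real k / 4 ^ n < \<beta>" "\<beta> < real (Suc k) / 4 ^ n" by auto
  define \<delta> where "\<delta> = min (\<beta> - real k / 4 ^ n) (real (Suc k) / 4 ^ n - \<beta>)"
  have "0 < \<delta>" using \<beta>' by (simp add: \<delta>_def)
  moreover have "f \<beta> \<le> f u" if "\<bar>u - \<beta>\<bar> < \<delta>" for u
    using that by (intro \<beta>(2)) (auto simp: \<delta>_def)
  moreover have "0 < \<beta>" "\<beta> < 1" using \<beta>' k0 k4 by linarith+
  ultimately have "\<beta> \<in> local_minima f"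
    unfolding local_minima_def by auto
  then obtain i where "\<beta> = b i" using b unfolding bij_betw_def by blast
  then show ?thesis using \<beta> k pd unfolding dip_at_def by blast
qed

text \<open>The summand 2 puts more than one mesh between x and the cell. The finer cells end within
  3/4 of that mesh from x, so they lie strictly to the left of it; with 1 in place of 2 they could
  overlap.\<close>

lemma four_adic_cells_right_of:
  fixes x :: real
  assumes x: "0 < x" "x < 1" and k: "\<And>n. k n = nat \<lfloor>x * 4 ^ n\<rfloor> + 2"
  obtains m where "1 \<le> m" "\<And>n. m \<le> n \<Longrightarrow> 4 ^ (n - m) \<le> k n" "\<And>n. m \<le> n \<Longrightarrow> Suc (k n) + 4 ^ (n - m) \<le> 4 ^ n"
    "\<And>n n'. n < n' \<Longrightarrow> Suc (k n') < k n * 4 ^ (n' - n)"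
proof -
  \<comment> \<open>The cell ends at most three meshes to the right of x, and for n \<ge> m this is
    at most \<open>3 / 4 ^ m\<close>. Adding the margin \<open>1 / 4 ^ m\<close> at the right end
    explains the factor 4.\<close>
  obtain N where "(1 / 4) ^ N < min x ((1 - x) / 4)"
    using real_arch_pow_inv[of "min x ((1 - x) / 4)" "1 / 4"] x by auto
  then have N: "1 / 4 ^ N < x" "4 * (1 / 4 ^ N) < 1 - x" by (simp_all add: power_one_over)
  have fl: "x * 4 ^ n + 1 < real (k n)" "real (k n) \<le> x * 4 ^ n + 2" for n
  proof -
    have "0 \<le> x * 4 ^ n" using x by simp
    then have "real (nat \<lfloor>x * 4 ^ n\<rfloor>) \<le> x * 4 ^ n" "x * 4 ^ n < real (nat \<lfloor>x * 4 ^ n\<rfloor>) + 1"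
      by (simp_all only: of_nat_nat zero_le_floor real_of_int_floor_add_one_gt of_int_floor_le)
    then show "x * 4 ^ n + 1 < real (k n)" "real (k n) \<le> x * 4 ^ n + 2"
      unfolding k of_nat_add of_nat_numeral by linarith+
  qed
  show thesis
  proof (rule that[of "max 1 N"])
    define m where "m = max 1 N"
    have "1 / (4::real) ^ m \<le> 1 / 4 ^ N" unfolding m_def by (intro divide_left_mono power_increasing) auto
    with N have M: "1 / 4 ^ m < x" "4 * (1 / 4 ^ m) < 1 - x" by linarith+
    fix n assume "max 1 N \<le> n"
    then have mn: "m \<le> n" by (simp add: m_def)
    have pw: "(4::real) ^ n = 4 ^ m * 4 ^ (n - m)" using mn by (simp flip: power_add)
    have p1: "1 \<le> (4::real) ^ (n - m)" by simp
    have "(1 / 4 ^ m) * 4 ^ n < x * 4 ^ n" using M(1) by (intro mult_strict_right_mono) auto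
    then have "4 ^ (n - m) < x * 4 ^ n" by (simp add: pw)
    then have "real (4 ^ (n - m)) < real (k n)"
      using fl(1)[of n] unfolding of_nat_power of_nat_numeral by linarith
    then show "4 ^ (n - max 1 N) \<le> k n" unfolding of_nat_less_iff m_def by simp
    have "(4 * (1 / 4 ^ m)) * 4 ^ n < (1 - x) * 4 ^ n" using M(2) by (intro mult_strict_right_mono) auto
    then have "4 * 4 ^ (n - m) + x * 4 ^ n < 4 ^ n" by (simp add: pw algebra_simps)
    then have "real (Suc (k n) + 4 ^ (n - m)) < real (4 ^ n)"
      using fl(2)[of n] p1 unfolding of_nat_add of_nat_Suc of_nat_power of_nat_numeral by linarith
    then show "Suc (k n) + 4 ^ (n - max 1 N) \<le> 4 ^ n" unfolding of_nat_less_iff m_def by simp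
  next
    fix n n' :: nat assume n: "n < n'"
    have pw: "(4::real) ^ n' = 4 ^ n * 4 ^ (n' - n)" using n by (simp flip: power_add)
    have "(4::real) ^ 1 \<le> 4 ^ (n' - n)" using n by (intro power_increasing) auto
    then have p4: "4 \<le> (4::real) ^ (n' - n)" by simp
    have "(x * 4 ^ n + 1) * 4 ^ (n' - n) < real (k n) * 4 ^ (n' - n)"
      using fl(1)[of n] by (intro mult_strict_right_mono) auto
    then have "x * 4 ^ n' + 4 ^ (n' - n) < real (k n) * 4 ^ (n' - n)" by (simp add: pw algebra_simps)
    then have "real (Suc (k n')) < real (k n * 4 ^ (n' - n))"
      using fl(2)[of n'] p4 unfolding of_nat_mult of_nat_Suc of_nat_power of_nat_numeral by linarith
    then show "Suc (k n') < k n * 4 ^ (n' - n)" by (simp only: of_nat_less_iff)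
  qed simp
qed

theorem theorem3p4:
  fixes M :: "'a measure" and e :: "'a \<Rightarrow> real \<Rightarrow> real"
    and b s :: "nat \<Rightarrow> 'a \<Rightarrow> real" and p :: real
  assumes "0 \<le> p" and "p < 1"
    and "brownian_excursion M e"
    and "measurable_enumeration M e b"
    and "decorations M e p s"
  shows "AE \<omega> in M. independence_number (brownian_cographon e b s \<omega>) = 0"
proof -
  note e = assms(3)
  interpret prob_space M using e by (simp add: brownian_excursion_def)
  have cont: "continuous_on {0..1} (e \<omega>)" if "\<omega> \<in> space M" for \<omega>
    using e that by (auto simp: brownian_excursion_def)
  have b: "b i \<in> borel_measurable (path_algebra M e)" for i
    using assms(4) by (auto simp: measurable_enumeration_def)
  have bij: "AE \<omega> in M. bij_betw (\<lambda>i. b i \<omega>) UNIV (local_minima (e \<omega>))"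
    using assms(4) by (auto simp: measurable_enumeration_def)
  have s: "s i \<in> borel_measurable M" for i
    using assms(5) by (simp add: decorations_def indep_vars_def)
  have ties: "AE \<omega> in M. no_ties (e \<omega>)"
    unfolding no_ties_def AE_all_countable
    by (intro allI AE_impI no_equal_minima[OF e]) auto
  have dip: "Measurable.pred (path_algebra M e) (\<lambda>\<omega>. dip_at n k (e \<omega>) (b i \<omega>))" for n k i
    by (intro dip_at_measurable measurable_path_algebra b cont) auto
  have dipM: "Measurable.pred M (\<lambda>\<omega>. dip_at n k (e \<omega>) (b i \<omega>))" for n k i
    using dip[of n k i] sets_path_algebra_subset[OF e] by (auto simp: pred_def)
  define Good where "Good x \<omega> \<longleftrightarrow> (\<forall>n0. \<exists>n\<ge>n0. \<exists>i. dip_at n (nat \<lfloor>x * 4 ^ n\<rfloor> + 2) (e \<omega>) (b i \<omega>) \<and> s i \<omega> = 1)"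
    for x :: real and \<omega>
  have good: "AE \<omega> in M. Good x \<omega>" if x: "0 < x" "x < 1" for x
  proof -
    define k where "k n = nat \<lfloor>x * 4 ^ n\<rfloor> + 2" for n
    obtain m where m: "1 \<le> m" and k: "\<And>n. m \<le> n \<Longrightarrow> 4 ^ (n - m) \<le> k n"
      "\<And>n. m \<le> n \<Longrightarrow> Suc (k n) + 4 ^ (n - m) \<le> 4 ^ n"
      and left: "\<And>n n'. n < n' \<Longrightarrow> Suc (k n') < k n * 4 ^ (n' - n)"
      by (rule four_adic_cells_right_of[OF x k_def], intro that)
    have dips: "AE \<omega> in M. \<forall>n0. \<exists>n\<ge>n0. path_dip n (k n) (e \<omega>)"
      using left by (intro infinitely_many_dips[OF e m k]) (auto intro: less_imp_le)
    have "AE \<omega> in M. \<exists>i. \<omega> \<in> {\<omega> \<in> space M. \<exists>n\<ge>n0. dip_at n (k n) (e \<omega>) (b i \<omega>)} \<and> s i \<omega> = 1" for n0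
    proof (rule decorated_index[OF e assms(5,1,2)])
      show "{\<omega> \<in> space M. \<exists>n\<ge>n0. dip_at n (k n) (e \<omega>) (b i \<omega>)} \<in> sets (path_algebra M e)" for i
      proof -
        have "Measurable.pred (path_algebra M e) (\<lambda>\<omega>. \<exists>n\<in>{n0..}. dip_at n (k n) (e \<omega>) (b i \<omega>))"
          using dip by (intro pred_intros_countable_bounded)
        then show ?thesis by (simp only: pred_def Bex_def atLeast_iff space_path_algebra)
      qed
      show "AE \<omega> in M. infinite {i. \<omega> \<in> {\<omega> \<in> space M. \<exists>n\<ge>n0. dip_at n (k n) (e \<omega>) (b i \<omega>)}}"
        using dips bij AE_space
      proof eventually_elim
        case (elim \<omega>)
        define T where "T = {n. max m n0 \<le> n \<and> path_dip n (k n) (e \<omega>)}"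
        have "infinite T"
          unfolding infinite_nat_iff_unbounded_le
        proof
          fix n1
          obtain n where "max n1 (max m n0) \<le> n" "path_dip n (k n) (e \<omega>)"
            using elim(1) by blast
          then show "\<exists>n\<ge>n1. n \<in> T" by (auto simp: T_def)
        qed
        have "\<exists>i. dip_at n (k n) (e \<omega>) (b i \<omega>)" if "n \<in> T" for n
        proof (rule path_dip_imp_dip_at[OF cont[OF elim(3)] elim(2)])
          have mn: "m \<le> n" using that by (simp add: T_def)
          have "(1::nat) \<le> 4 ^ (n - m)" by simp
          with k(1)[OF mn] k(2)[OF mn] show "1 \<le> k n" "Suc (k n) < 4 ^ n" by linarith+
          show "path_dip n (k n) (e \<omega>)" using that by (simp add: T_def)
        qed
        then obtain \<iota> where \<iota>: "\<And>n. n \<in> T \<Longrightarrow> dip_at n (k n) (e \<omega>) (b (\<iota> n) \<omega>)" by metis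
        \<comment> \<open>The minima move strictly to the left as the level grows. Hence different
          levels use different indices, and the index set handed to \<open>decorated_index\<close>
          is infinite.\<close>
        have less: "b (\<iota> n') \<omega> < b (\<iota> n) \<omega>" if "n \<in> T" "n' \<in> T" "n < n'" for n n'
        proof -
          have "b (\<iota> n') \<omega> \<le> real (Suc (k n')) / 4 ^ n'" using \<iota>[OF that(2)] by (auto simp: dip_at_def)
          also have "\<dots> < real (k n * 4 ^ (n' - n)) / 4 ^ n'"
            using left[OF that(3)] by (intro divide_strict_right_mono) (simp_all only: of_nat_less_iff zero_less_power zero_less_numeral)
          also have "\<dots> = real (k n) / 4 ^ n"
          proof -
            have "(4::real) ^ n' = 4 ^ n * 4 ^ (n' - n)" using that by (simp flip: power_add)
            then show ?thesis by simp
          qed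
          also have "\<dots> \<le> b (\<iota> n) \<omega>" using \<iota>[OF that(1)] by (auto simp: dip_at_def)
          finally show ?thesis .
        qed
        have "inj_on \<iota> T"
        proof (rule inj_onI)
          fix n n' assume "n \<in> T" "n' \<in> T" "\<iota> n = \<iota> n'"
          then show "n = n'" using less[of n n'] less[of n' n] by (metis less_irrefl linorder_neqE_nat)
        qed
        with \<open>infinite T\<close> have "infinite (\<iota> ` T)" by (simp add: finite_image_iff)
        moreover have "\<iota> ` T \<subseteq> {i. \<omega> \<in> {\<omega> \<in> space M. \<exists>n\<ge>n0. dip_at n (k n) (e \<omega>) (b i \<omega>)}}"
          using \<iota> elim(3) by (auto simp: T_def)
        ultimately show ?case by (rule infinite_super[rotated])
      qed
    qed
    then have "AE \<omega> in M. \<forall>n0. \<exists>i. \<omega> \<in> {\<omega> \<in> space M. \<exists>n\<ge>n0. dip_at n (k n) (e \<omega>) (b i \<omega>)} \<and> s i \<omega> = 1"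
      unfolding AE_all_countable by blast
    then show ?thesis
      by eventually_elim (unfold Good_def k_def, blast)
  qed
  interpret XM: pair_sigma_finite "lborel :: real measure" M ..
  have "Measurable.pred (lborel \<Otimes>\<^sub>M M) (\<lambda>q. fst q \<in> {0<..<1} \<longrightarrow> Good (fst q) (snd q))"
  proof -
    \<comment> \<open>The point enters only through the number of its cell, which takes countably
      many values, so measurability in the path for each fixed cell suffices for joint
      measurability.\<close>
    have D: "Measurable.pred (lborel \<Otimes>\<^sub>M M) (\<lambda>q :: real \<times> 'a. dip_at n (nat \<lfloor>fst q * 4 ^ n\<rfloor> + 2) (e (snd q)) (b i (snd q)))" for n i
    proof (rule measurable_compose_countable[where f = "\<lambda>k (q :: real \<times> 'a). dip_at n k (e (snd q)) (b i (snd q))"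
          and g = "\<lambda>q :: real \<times> 'a. nat \<lfloor>fst q * 4 ^ n\<rfloor> + 2"])
      show "Measurable.pred (lborel \<Otimes>\<^sub>M M) (\<lambda>q :: real \<times> 'a. dip_at n k (e (snd q)) (b i (snd q)))" for k
        by (rule measurable_compose[OF measurable_snd dipM])
      show "(\<lambda>q :: real \<times> 'a. nat \<lfloor>fst q * 4 ^ n\<rfloor> + 2) \<in> lborel \<Otimes>\<^sub>M M \<rightarrow>\<^sub>M count_space UNIV"
        by measurable
    qed
    note [measurable] = D s
    show ?thesis unfolding Good_def by measurable
  qed
  then have "{q \<in> space (lborel \<Otimes>\<^sub>M M). fst q \<in> {0<..<1} \<longrightarrow> Good (fst q) (snd q)} \<in> sets (lborel \<Otimes>\<^sub>M M)"
    by (simp only: pred_def)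
  moreover have "AE x in lborel. AE \<omega> in M. x \<in> {0<..<1} \<longrightarrow> Good x \<omega>"
    by (rule AE_I2, rule AE_impI, rule good) auto
  ultimately have "AE \<omega> in M. AE x in lborel. x \<in> {0<..<1} \<longrightarrow> Good x \<omega>"
    by (subst (asm) XM.AE_commute)
  with bij ties show ?thesis
  proof eventually_elim
    case (elim \<omega>)
    then show ?case
      unfolding brownian_cographon_def Good_def
      by (intro independence_number_eq_0) (auto simp: bij_betw_def)
  qed
qed

end
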